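(* Let $0<T<\infty$, $\alpha_0>0$, and let $\mu_0$ be a Borel measure on $\mathbb R^D$ of total mass $1$ with $\int e^{\alpha_0|x|}d\mu_0<\infty$. Assume the dynamical hypothesis (stated in the context). For each $\varepsilon>0$ let $(\mu_t^\varepsilon)_{t\in[0,T]}$ be a solution of the deficient Hamiltonian ODE with initial datum $\mu_0$ constructed by time discretization as described in the context. Then there exist a sequence $\varepsilon_k\to0$ and measures $(\mu_t)_{t\in[0,T]}$, starting at $\mu_0$, such that $\mu_t^{\varepsilon_k}\rightharpoonup\mu_t$ in the sense of distributions for every $t\in[0,T]$, and (i) $t\mapsto\mu_t$ is a distributionally continuous path of finite Borel measures, and $\mu_t(\mathbb R^D)\le1$ for $t\in[0,T]$; (ii) $(\mu_t)_{t\in[0,T]}$ satisfies the Hamiltonian ODE $$\partial_t\mu_t+\nabla\cdot\big(J\nabla_W\mathcal H(\mu_t)\,\mu_t\big)=0$$ in the sense of distributions on $(0,T)\times\mathbb R^D$.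
   Context: Let $D=2d$ and write points of $\mathbb R^D$ as $x=(p,q)$, $p,q\in\mathbb R^d$. $W\in C_c^2(\mathbb R^d)$ is even, and $\Phi\in C^2(\mathbb R^d)$ satisfies $|\Phi(q)|\le B_1|q|^{b_2}$ for finite constants $B_1,b_2$. For a finite Borel measure $\mu$ on $\mathbb R^D$, $(W*\mu)(q)=\int W(q-q')\,d\mu(p',q')$. With $\mathcal H(\mu)=\frac12\int|p|^2d\mu+\frac12\int(W*\mu)(q)d\mu+\int\Phi(q)d\mu$ one sets $\nabla_W\mathcal H(\mu)(p,q)=(p,\nabla(W*\mu+\Phi)(q))$ and $J(p,q)=(-q,p)$, so $J\nabla_W\mathcal H(\mu)(p,q)=(-\nabla(W*\mu+\Phi)(q),\,p)$. Distributional convergence $\mu_n\rightharpoonup\mu$: $\int\varphi\,d\mu_n\to\int\varphi\,d\mu$ for all $\varphi\in C_c^\infty(\mathbb R^D)$; distributional continuity is continuity of $t\mapsto\int\varphi\,d\mu_t$ for all such $\varphi$. Construction of $\mu^\varepsilon$. For $n\ge1$ let $h=T/n$ and $\mu_0^{\varepsilon,n}=\mu_0$. Given $\mu_{kh}^{\varepsilon,n}$, let $v=J\nabla_W\mathcal H(\mu_{kh}^{\varepsilon,n})$ (a time-independent $C^1$ field), let $Y_s(x)$ be the maximal solution of $\dot Y_s=v(Y_s)$, $Y_0=x$, with lifetime $\sigma(x)$, and for $s\in[0,h]$ define $\mu^{\varepsilon,n}_{kh+s}$ by $\int\psi\,d\mu^{\varepsilon,n}_{kh+s}=\int_{\{\sigma>s\}}\psi(Y_s(x))\exp\big(-\varepsilon\int_0^s|\dot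 Y_r(x)|dr\big)d\mu_{kh}^{\varepsilon,n}(x)$ for bounded continuous $\psi$. Then $(\mu_t^\varepsilon)_{t\in[0,T]}$ is a limit, in the sense of distributions for each $t\in[0,T]$, of $\mu_t^{\varepsilon,n}$ along some increasing sequence of $n$'s (such limits exist); it solves $\partial_t\mu_t^\varepsilon+\nabla\cdot(J\nabla_W\mathcal H(\mu_t^\varepsilon)\mu_t^\varepsilon)=-\varepsilon|J\nabla_W\mathcal H(\mu_t^\varepsilon)|\mu_t^\varepsilon$. Dynamical hypothesis. Let $B>0$ satisfy $|W|\le B$ and $|\nabla W|<B$. There exist $u\in C^2(\mathbb R)$ with $$u'(r)\ge B+\max_{|q|=r}\langle\nabla\Phi(q),\hat q\rangle,\quad r\ge0,\qquad \hat q=q/|q|$$ (at $r=0$ the right-hand side is read as its limit as $r\to0^+$), and, with $\Upsilon(q)=u(|q|)$, a sequence $\{q_L^\star\}_{L\ge1}\subset\mathbb R^d$ with $|q_L^\star|$ increasing to $\infty$ and $\Upsilon(q)<\Upsilon(q_L^\star)$ for all $|q|>|q_L^\star|$ and all $L$. *)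

theory Defs
  imports "HOL-Analysis.Analysis"
begin

text \<open>Phase space is the product type \<open>'a \<times> 'a\<close>, written \<open>x = (p, q)\<close>, where the Euclidean
  space \<open>'a\<close> plays the role of \<open>\<real>\<^sup>d\<close>.\<close>

section \<open>Regularity, gradients and test functions\<close>

primrec C_k :: "nat \<Rightarrow> ('a::euclidean_space \<Rightarrow> real) \<Rightarrow> bool" where
  "C_k 0 f \<longleftrightarrow> continuous_on UNIV f"
| "C_k (Suc k) f \<longleftrightarrow> (\<forall>x. f differentiable (at x)) \<and>
     (\<forall>v. C_k k (\<lambda>x. frechet_derivative f (at x) v))"

definition grad :: "('a::euclidean_space \<Rightarrow> real) \<Rightarrow> 'a \<Rightarrow> 'a" where
  "grad f x = (THE g. GDERIV f x :> g)"

definition compact_support_in :: "'a::euclidean_space set \<Rightarrow> ('a \<Rightarrow> real) \<Rightarrow> bool" where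
  "compact_support_in \<Omega> f \<longleftrightarrow> compact (closure {x. f x \<noteq> 0}) \<and> closure {x. f x \<noteq> 0} \<subseteq> \<Omega>"

text \<open>\<open>C\<^sub>c\<^sup>\<infinity>(\<Omega>)\<close> for open \<open>\<Omega>\<close>, its elements being extended by zero to the whole space.\<close>

definition test_function :: "'a::euclidean_space set \<Rightarrow> ('a \<Rightarrow> real) \<Rightarrow> bool" where
  "test_function \<Omega> f \<longleftrightarrow> (\<forall>k. C_k k f) \<and> compact_support_in \<Omega> f"

section \<open>Finite Borel measures and distributional convergence\<close>

definition finite_borel :: "'b::euclidean_space measure \<Rightarrow> bool" where
  "finite_borel \<mu> \<longleftrightarrow> sets \<mu> = sets borel \<and> finite_measure \<mu>"

definition dist_conv :: "(nat \<Rightarrow> 'b::euclidean_space measure) \<Rightarrow> 'b measure \<Rightarrow> bool" where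
  "dist_conv M \<mu> \<longleftrightarrow>
     (\<forall>\<phi>. test_function UNIV \<phi> \<longrightarrow> (\<lambda>n. \<integral>x. \<phi> x \<partial>M n) \<longlonglongrightarrow> (\<integral>x. \<phi> x \<partial>\<mu>))"

definition dist_continuous_on :: "real set \<Rightarrow> (real \<Rightarrow> 'b::euclidean_space measure) \<Rightarrow> bool" where
  "dist_continuous_on I \<mu> \<longleftrightarrow>
     (\<forall>\<phi>. test_function UNIV \<phi> \<longrightarrow> continuous_on I (\<lambda>t. \<integral>x. \<phi> x \<partial>\<mu> t))"

section \<open>The Hamiltonian vector field\<close>

definition conv :: "('a::euclidean_space \<Rightarrow> real) \<Rightarrow> ('a \<times> 'a) measure \<Rightarrow> 'a \<Rightarrow> real" where
  "conv W \<mu> q = (\<integral>y. W (q - snd y) \<partial>\<mu>)"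

definition gradW_H ::
  "('a::euclidean_space \<Rightarrow> real) \<Rightarrow> ('a \<Rightarrow> real) \<Rightarrow> ('a \<times> 'a) measure \<Rightarrow> 'a \<times> 'a \<Rightarrow> 'a \<times> 'a" where
  "gradW_H W \<Phi> \<mu> x = (fst x, grad (\<lambda>q. conv W \<mu> q + \<Phi> q) (snd x))"

definition J :: "'a::euclidean_space \<times> 'a \<Rightarrow> 'a \<times> 'a" where
  "J x = (- snd x, fst x)"

definition ham_field ::
  "('a::euclidean_space \<Rightarrow> real) \<Rightarrow> ('a \<Rightarrow> real) \<Rightarrow> ('a \<times> 'a) measure \<Rightarrow> 'a \<times> 'a \<Rightarrow> 'a \<times> 'a" where
  "ham_field W \<Phi> \<mu> x = J (gradW_H W \<Phi> \<mu> x)"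

section \<open>Transport equations in the sense of distributions\<close>

text \<open>Weak form on \<open>(0,T) \<times> \<real>\<^sup>D\<close> of \<open>\<partial>\<^sub>t \<mu>\<^sub>t + \<nabla>\<cdot>(v\<^sub>t \<mu>\<^sub>t) = - c\<^sub>t \<mu>\<^sub>t\<close>. As the Lebesgue integral of a
  non-integrable function is 0 by convention, integrability in time is demanded explicitly;
  for finite \<open>\<mu>\<^sub>t\<close> and continuous \<open>v\<^sub>t\<close>, \<open>c\<^sub>t\<close> the inner integrand is bounded and continuous.\<close>

definition solves_transport ::
  "real \<Rightarrow> (real \<Rightarrow> 'b::euclidean_space \<Rightarrow> 'b) \<Rightarrow> (real \<Rightarrow> 'b \<Rightarrow> real) \<Rightarrow> (real \<Rightarrow> 'b measure) \<Rightarrow> bool" where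
  "solves_transport T v c \<mu> \<longleftrightarrow>
     (\<forall>\<phi>. test_function ({0<..<T} \<times> UNIV) \<phi> \<longrightarrow>
        (let F = (\<lambda>t. \<integral>x. (deriv (\<lambda>s. \<phi> (s, x)) t + grad (\<lambda>y. \<phi> (t, y)) x \<bullet> v t x
                             - c t x * \<phi> (t, x)) \<partial>\<mu> t)
         in set_integrable lborel {0<..<T} F \<and> (LINT t:{0<..<T}|lborel. F t) = 0))"

definition hamiltonian_ode ::
  "('a::euclidean_space \<Rightarrow> real) \<Rightarrow> ('a \<Rightarrow> real) \<Rightarrow> real \<Rightarrow> (real \<Rightarrow> ('a \<times> 'a) measure) \<Rightarrow> bool" where
  "hamiltonian_ode W \<Phi> T \<mu> \<longleftrightarrow>
     solves_transport T (\<lambda>t. ham_field W \<Phi> (\<mu> t)) (\<lambda>t x. 0) \<mu>"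

definition deficient_ode ::
  "('a::euclidean_space \<Rightarrow> real) \<Rightarrow> ('a \<Rightarrow> real) \<Rightarrow> real \<Rightarrow> real \<Rightarrow> (real \<Rightarrow> ('a \<times> 'a) measure) \<Rightarrow> bool" where
  "deficient_ode W \<Phi> T \<epsilon> \<mu> \<longleftrightarrow>
     solves_transport T (\<lambda>t. ham_field W \<Phi> (\<mu> t)) (\<lambda>t x. \<epsilon> * norm (ham_field W \<Phi> (\<mu> t) x)) \<mu>"

section \<open>Maximal forward solutions of autonomous equations\<close>

definition solves_until :: "('b::euclidean_space \<Rightarrow> 'b) \<Rightarrow> 'b \<Rightarrow> real \<Rightarrow> (real \<Rightarrow> 'b) \<Rightarrow> bool" where
  "solves_until v x s y \<longleftrightarrow>
     y 0 = x \<and> (\<forall>r\<in>{0..s}. (y has_vector_derivative v (y r)) (at r within {0..s}))"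

definition lifetime :: "('b::euclidean_space \<Rightarrow> 'b) \<Rightarrow> 'b \<Rightarrow> ereal" where
  "lifetime v x = (SUP s\<in>{s. 0 \<le> s \<and> (\<exists>y. solves_until v x s y)}. ereal s)"

text \<open>For a locally Lipschitz field \<open>v\<close>, \<open>flow v x\<close> is uniquely determined on \<open>[0, lifetime v x)\<close>;
  it is unspecified beyond the lifetime and never used there.\<close>

definition flow :: "('b::euclidean_space \<Rightarrow> 'b) \<Rightarrow> 'b \<Rightarrow> real \<Rightarrow> 'b" where
  "flow v x = (SOME y. \<forall>s\<ge>0. ereal s < lifetime v x \<longrightarrow> solves_until v x s y)"

section \<open>The time discretization\<close>

text \<open>Here \<open>norm (v (flow v x r))\<close> is the speed at time \<open>r\<close> of the trajectory \<open>flow v x\<close>. The relation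
  between the measures at the times \<open>kh\<close> and \<open>kh + s\<close> determines the latter uniquely, finite Borel
  measures being determined by their integrals of bounded continuous functions.\<close>

definition transported ::
  "real \<Rightarrow> ('b::euclidean_space \<Rightarrow> 'b) \<Rightarrow> real \<Rightarrow> 'b measure \<Rightarrow> 'b measure \<Rightarrow> bool" where
  "transported \<epsilon> v s \<mu> \<nu> \<longleftrightarrow>
     (\<forall>\<psi> :: 'b \<Rightarrow> real. continuous_on UNIV \<psi> \<and> bounded (range \<psi>) \<longrightarrow>
        (\<integral>x. \<psi> x \<partial>\<nu>) =
        (LINT x:{x. ereal s < lifetime v x}|\<mu>.
           \<psi> (flow v x s) * exp (- \<epsilon> * integral {0..s} (\<lambda>r. norm (v (flow v x r))))))"

definition discretization ::
  "('a::euclidean_space \<Rightarrow> real) \<Rightarrow> ('a \<Rightarrow> real) \<Rightarrow> real \<Rightarrow> real \<Rightarrow> ('a \<times> 'a) measure \<Rightarrow> nat \<Rightarrow>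
   (real \<Rightarrow> ('a \<times> 'a) measure) \<Rightarrow> bool" where
  "discretization W \<Phi> T \<epsilon> \<mu>0 n m \<longleftrightarrow>
     (\<forall>t\<in>{0..T}. finite_borel (m t)) \<and> m 0 = \<mu>0 \<and>
     (let h = T / real n in
       \<forall>k<n. \<forall>s\<in>{0..h}.
         transported \<epsilon> (ham_field W \<Phi> (m (real k * h))) s (m (real k * h)) (m (real k * h + s)))"

definition constructed_deficient_solution ::
  "('a::euclidean_space \<Rightarrow> real) \<Rightarrow> ('a \<Rightarrow> real) \<Rightarrow> real \<Rightarrow> real \<Rightarrow> ('a \<times> 'a) measure \<Rightarrow>
   (real \<Rightarrow> ('a \<times> 'a) measure) \<Rightarrow> bool" where
  "constructed_deficient_solution W \<Phi> T \<epsilon> \<mu>0 \<mu> \<longleftrightarrow>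
     (\<forall>t\<in>{0..T}. finite_borel (\<mu> t)) \<and>
     deficient_ode W \<Phi> T \<epsilon> \<mu> \<and>
     (\<exists>m ns. (\<forall>n\<ge>1. discretization W \<Phi> T \<epsilon> \<mu>0 n (m n)) \<and>
             strict_mono ns \<and> (\<forall>j. 1 \<le> ns j) \<and>
             (\<forall>t\<in>{0..T}. dist_conv (\<lambda>j. m (ns j) t) (\<mu> t)))"

section \<open>The dynamical hypothesis\<close>

definition max_radial_deriv :: "('a::euclidean_space \<Rightarrow> real) \<Rightarrow> real \<Rightarrow> real" where
  "max_radial_deriv \<Phi> r = (SUP q\<in>sphere 0 r. grad \<Phi> q \<bullet> sgn q)"

text \<open>The condition at \<open>r = 0\<close>, where \<open>sgn q\<close> is no unit vector, is read as a limit \<open>r \<rightarrow> 0\<^sup>+\<close>.\<close>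

definition dynamical_hypothesis ::
  "('a::euclidean_space \<Rightarrow> real) \<Rightarrow> ('a \<Rightarrow> real) \<Rightarrow> real \<Rightarrow> bool" where
  "dynamical_hypothesis W \<Phi> B \<longleftrightarrow>
     (\<forall>q. \<bar>W q\<bar> \<le> B) \<and> (\<forall>q. norm (grad W q) < B) \<and>
     (\<exists>(u :: real \<Rightarrow> real) (qs :: nat \<Rightarrow> 'a).
        C_k 2 u \<and>
        (\<forall>r>0. B + max_radial_deriv \<Phi> r \<le> deriv u r) \<and>
        Lim (at_right 0) (\<lambda>r. B + max_radial_deriv \<Phi> r) \<le> deriv u 0 \<and>
        mono_on {1..} (\<lambda>L. norm (qs L)) \<and>
        filterlim (\<lambda>L. norm (qs L)) at_top sequentially \<and>
        (\<forall>L\<ge>1. \<forall>q :: 'a. norm (qs L) < norm q \<longrightarrow> u (norm q) < u (norm (qs L))))"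

end

(* Each particle of the discretized dynamics obeys p' = - grad (W * mu + Phi) q, where
   |grad (W * mu)| < B since the masses never exceed 1. Writing r = |q| and rho = p . q / r, the
   dynamical hypothesis gives rho' > - u' r, so rho^2 / 2 + u r increases while rho > 0. A particle
   crossing the sphere r = |q*_L| outwards has energy at least u |q*_L|, which exceeds u outside
   that sphere, and therefore never comes back. So a particle that is inside the sphere at time t
   either started far away, which has small mu_0-probability, or stayed inside all the time and has
   bounded momentum. This makes the measures tight in p on bounded sets of q, uniformly in
   epsilon, which is what is needed to pass to the limit in W * mu: the kernel W (q - q') has
   compact support in q' but not in p'.

   Mass is lost only by trajectories leaving every compact set, so integrals of test functions are
   Lipschitz in time uniformly in epsilon, and a diagonal subsequence converges at all times. Vague
   compactness on the phase space is reduced to Helly's theorem on the line by a space-filling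
   curve, through which measures are lifted along a Borel section. *)

theory Submission
  imports Defs "HOL-Probability.Helly_Selection" "HOL-Probability.Giry_Monad"
begin

section \<open>Smooth functions and test functions\<close>

text \<open>Every discretization step has its own frozen field, so an invariant of the flow helps
  only if it does not mention the measure that generates the field. The radial energy is of this
  kind: \<open>u\<close> absorbs the radial part of every force that can occur, since
  \<open>B\<close> bounds the interaction force of every sub-probability measure. The gap between
  the maximum of \<open>norm (grad W)\<close> and \<open>B\<close> makes the inequality for \<rho>'
  strict, which settles the borderline case of a particle on the sphere with zero radial velocity.
  Both limits, in the step size and in \<epsilon>, are vague: mass may vanish at infinity, and only
  upper bounds for the mass of open sets survive. The invariant sets are therefore closed and the
  estimates concern their complements. Killing only lowers these masses, so no bound degenerates as
  \<epsilon> tends to 0. A particle far away carries no weight in a test function, however fast it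
  is. Hence the Lipschitz constant in time involves the field on a ball only, where it is bounded
  uniformly in the measure.\<close>

lemma C_k_SucI:
  assumes "\<And>x. (f has_derivative f' x) (at x)" "\<And>v. C_k k (\<lambda>x. f' x v)"
  shows "C_k (Suc k) f"
proof -
  have "frechet_derivative f (at x) = f' x" for x
    using frechet_derivative_at[OF assms(1)] by simp
  then show ?thesis
    using assms by (auto simp: differentiable_def)
qed

lemma C_k_SucD:
  assumes "C_k (Suc k) f"
  shows "(f has_derivative frechet_derivative f (at x)) (at x)"
    and "C_k k (\<lambda>x. frechet_derivative f (at x) v)"
  using assms by (auto simp: frechet_derivative_works)

lemma C_k_Suc_imp: "C_k (Suc k) f \<Longrightarrow> C_k k f"
proof (induction k arbitrary: f)
  case 0
  then show ?case
    by (auto simp: continuous_on_eq_continuous_within differentiable_imp_continuous_within)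
next
  case (Suc k)
  show ?case
    by (rule C_k_SucI[OF C_k_SucD(1)[OF Suc.prems] Suc.IH[OF C_k_SucD(2)[OF Suc.prems]]])
qed

lemma C_k_imp_continuous: "C_k k f \<Longrightarrow> continuous_on UNIV f"
  by (induction k) (use C_k_Suc_imp in auto)

lemma C_k_const: "C_k k (\<lambda>x. c)"
proof (induction k arbitrary: c)
  case (Suc k)
  show ?case
    by (rule C_k_SucI[where f'="\<lambda>x h. 0"]) (use Suc in auto)
qed auto

lemma C_k_add: "C_k k f \<Longrightarrow> C_k k g \<Longrightarrow> C_k k (\<lambda>x. f x + g x)"
proof (induction k arbitrary: f g)
  case (Suc k)
  note f = C_k_SucD[OF Suc.prems(1)] and g = C_k_SucD[OF Suc.prems(2)]
  show ?case
    by (rule C_k_SucI[OF has_derivative_add[OF f(1) g(1)]]) (use Suc.IH f(2) g(2) in auto)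
qed (auto intro: continuous_intros)

lemma C_k_mult: "C_k k f \<Longrightarrow> C_k k g \<Longrightarrow> C_k k (\<lambda>x. f x * g x)"
proof (induction k arbitrary: f g)
  case (Suc k)
  note f = C_k_SucD[OF Suc.prems(1)] and g = C_k_SucD[OF Suc.prems(2)]
  show ?case
    by (rule C_k_SucI[OF has_derivative_mult[OF f(1) g(1)]])
       (intro C_k_add Suc.IH f(2) g(2) Suc.prems[THEN C_k_Suc_imp])
qed (auto intro: continuous_intros)

lemma C_k_exp: "C_k k f \<Longrightarrow> C_k k (\<lambda>x. exp (f x))"
proof (induction k arbitrary: f)
  case (Suc k)
  note f = C_k_SucD[OF Suc.prems(1)]
  have "((\<lambda>x. exp (f x)) has_derivative (\<lambda>h. exp (f x) * frechet_derivative f (at x) h)) (at x)" for x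
    by (auto intro!: derivative_eq_intros f(1))
  then show ?case
    by (rule C_k_SucI) (intro C_k_mult Suc.IH f(2) Suc.prems[THEN C_k_Suc_imp])
qed (auto intro: continuous_intros)

lemma C_k_prod: "finite A \<Longrightarrow> (\<And>i. i \<in> A \<Longrightarrow> C_k k (f i)) \<Longrightarrow> C_k k (\<lambda>x. \<Prod>i\<in>A. f i x)"
  by (induction A rule: finite_induct) (auto intro: C_k_mult C_k_const)

section \<open>Bump functions that approximate the indicators of boxes\<close>

text \<open>With \<open>p = 1\<close> this is the classical smooth function that is flat at 0; the
  polynomial factor makes the family closed under differentiation.\<close>

definition flat :: "real poly \<Rightarrow> real \<Rightarrow> real" where
  "flat p x = (if 0 < x then poly p (inverse x) * exp (- inverse x) else 0)"

lemma tendsto_poly_div_exp_0: "((\<lambda>x. poly p x * exp (- x)) \<longlongrightarrow> (0::real)) at_top"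
proof -
  have "((\<lambda>x. \<Sum>i\<le>degree p. coeff p i * (x ^ i / exp x)) \<longlongrightarrow> (\<Sum>i\<le>degree p. coeff p i * 0)) at_top"
    by (intro tendsto_intros tendsto_power_div_exp_0)
  then show ?thesis
    by (simp add: poly_altdef exp_minus sum_divide_distrib divide_inverse sum_distrib_right mult.assoc)
qed

text \<open>For \<open>x > 0\<close> put \<open>y = 1 / x\<close>; then
  \<open>dy/dx = - y^2\<close>, so p(y) exp(-y) has derivative \<open>y^2\<close> (p - p')(y)
  exp(-y), and \<open>[:0, 0, 1:]\<close> is the polynomial \<open>X^2\<close>. At 0 the right
  difference quotient is again of the form q(y) exp(-y), with \<open>q = X * p\<close>, and tends to
  0.\<close>

lemma DERIV_flat:
  "(flat p has_field_derivative flat ([:0, 0, 1:] * (p - pderiv p)) x) (at x)"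
proof -
  consider "x < 0" | "x > 0" | "x = 0" by linarith
  then show ?thesis
  proof cases
    case 1
    have "((\<lambda>x. 0) has_field_derivative 0) (at x)" by simp
    then have "(flat p has_field_derivative 0) (at x)"
      by (rule has_field_derivative_transform_within_open[where S="{..<0}"])
         (use 1 in \<open>auto simp: flat_def\<close>)
    then show ?thesis using 1 by (simp add: flat_def)
  next
    case 2
    have "((\<lambda>x. poly p (inverse x) * exp (- inverse x)) has_field_derivative
           flat ([:0, 0, 1:] * (p - pderiv p)) x) (at x)"
      using 2 by (auto intro!: derivative_eq_intros DERIV_chain2[OF poly_DERIV]
          simp: flat_def algebra_simps power2_eq_square divide_inverse)
    then show ?thesis
      by (rule has_field_derivative_transform_within_open[where S="{0<..}"])
         (use 2 in \<open>auto simp: flat_def\<close>)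
  next
    case 3
    have r: "((\<lambda>h. flat p h / h) \<longlongrightarrow> 0) (at_right 0)"
    proof -
      have "((\<lambda>h. poly ([:0, 1:] * p) (inverse h) * exp (- inverse h)) \<longlongrightarrow> 0) (at_right 0)"
        by (rule filterlim_compose[OF tendsto_poly_div_exp_0 filterlim_inverse_at_top_right])
      then show ?thesis
        by (rule Lim_transform_eventually)
           (auto simp: eventually_at_filter flat_def divide_inverse mult_ac)
    qed
    have l: "((\<lambda>h. flat p h / h) \<longlongrightarrow> 0) (at_left 0)"
      by (rule Lim_transform_eventually[OF tendsto_const])
         (auto simp: eventually_at_filter flat_def)
    show ?thesis
      using filterlim_split_at_real[OF l r] 3
      by (simp add: DERIV_def flat_def)
  qed
qed

text \<open>The polynomial is arbitrary because each differentiation replaces it by another one; the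
  induction on \<open>k\<close> closes for all \<open>p\<close> at once.\<close>

lemma C_k_flat_affine: "C_k k (\<lambda>x. flat p (c + a * (x \<bullet> b)))"
proof (induction k arbitrary: p)
  case 0
  have "continuous_on UNIV (flat p)"
    using DERIV_flat DERIV_isCont by (metis continuous_at_imp_continuous_on)
  then show ?case
    by (auto intro!: continuous_on_compose2[of UNIV "flat p"] continuous_intros)
next
  case (Suc k)
  let ?q = "[:0, 0, 1:] * (p - pderiv p)"
  have "((\<lambda>x. flat p (c + a * (x \<bullet> b))) has_derivative
     (\<lambda>h. flat ?q (c + a * (x \<bullet> b)) * (a * (h \<bullet> b)))) (at x)" for x
  proof -
    have 1: "((\<lambda>x. c + a * (x \<bullet> b)) has_derivative (\<lambda>h. a * (h \<bullet> b))) (at x)"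
      by (auto intro!: derivative_eq_intros)
    show ?thesis
      using has_derivative_compose[OF 1 DERIV_flat[THEN has_field_derivative_imp_has_derivative]]
      by (simp add: mult_ac)
  qed
  then show ?case
    by (rule C_k_SucI) (intro C_k_mult Suc.IH C_k_const)
qed

text \<open>A product of flat functions of the distances to the faces is smooth and positive exactly
  inside the box. Then \<open>1 - exp (- n * \<phi>)\<close> is 0 where \<phi> vanishes and
  increases to 1 where \<phi> is positive.\<close>

lemma box_test_function:
  fixes l u :: "'b::euclidean_space"
  obtains \<psi> :: "nat \<Rightarrow> 'b \<Rightarrow> real"
  where "\<And>n. test_function UNIV (\<psi> n)" "\<And>n x. 0 \<le> \<psi> n x \<and> \<psi> n x \<le> 1"
    "\<And>x. (\<lambda>n. \<psi> n x) \<longlonglongrightarrow> indicator (box l u) x"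
proof -
  define \<phi> where "\<phi> x = (\<Prod>b\<in>Basis. flat 1 (- (l \<bullet> b) + 1 * (x \<bullet> b)) * flat 1 (u \<bullet> b + (-1) * (x \<bullet> b)))"
    for x :: 'b
  have smooth: "C_k k \<phi>" for k
    unfolding \<phi>_def by (intro C_k_prod C_k_mult C_k_flat_affine) auto
  have nonneg: "\<phi> x \<ge> 0" for x
    unfolding \<phi>_def by (intro prod_nonneg) (auto simp: flat_def)
  have pos: "\<phi> x > 0" if "x \<in> box l u" for x
    unfolding \<phi>_def using that by (intro prod_pos) (auto simp: flat_def mem_box)
  have zero: "\<phi> x = 0" if "x \<notin> box l u" for x
    unfolding \<phi>_def using that by (fastforce simp: flat_def mem_box prod_zero_iff)
  define \<psi> where "\<psi> n x = 1 + (-1) * exp (- real n * \<phi> x)" for n x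
  have "C_k k (\<psi> n)" for k n
    unfolding \<psi>_def by (intro C_k_add C_k_mult C_k_exp C_k_const smooth)
  moreover have "compact_support_in UNIV (\<psi> n)" for n
  proof -
    have "{x. \<psi> n x \<noteq> 0} \<subseteq> box l u"
      using zero by (auto simp: \<psi>_def)
    then have "bounded {x. \<psi> n x \<noteq> 0}"
      using bounded_box bounded_subset by blast
    then show ?thesis
      by (auto simp: compact_support_in_def compact_closure)
  qed
  ultimately have 1: "test_function UNIV (\<psi> n)" for n
    by (auto simp: test_function_def)
  have 2: "0 \<le> \<psi> n x \<and> \<psi> n x \<le> 1" for n x
    using nonneg[of x] by (auto simp: \<psi>_def)
  have 3: "(\<lambda>n. \<psi> n x) \<longlonglongrightarrow> indicator (box l u) x" for x
  proof (cases "x \<in> box l u")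
    case True
    have "(\<lambda>n. exp (- \<phi> x) ^ n) \<longlonglongrightarrow> 0"
      using LIMSEQ_power_zero[of "exp (- \<phi> x)"] pos[OF True] by simp
    then have "(\<lambda>n. 1 + (-1) * exp (- \<phi> x) ^ n) \<longlonglongrightarrow> 1 + (-1) * 0"
      by (intro tendsto_add tendsto_mult tendsto_const)
    then show ?thesis
      using True by (simp add: \<psi>_def exp_of_nat_mult[symmetric])
  next
    case False
    then show ?thesis by (simp add: \<psi>_def zero)
  qed
  show thesis using that[OF 1 2 3] .
qed

lemma test_function_continuous: "test_function \<Omega> f \<Longrightarrow> continuous_on UNIV f"
  unfolding test_function_def using C_k_imp_continuous by blast

text \<open>Boxes form an intersection-stable generator of the Borel sets, and by dominated
  convergence their measures are limits of integrals of test functions.\<close>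

lemma finite_borel_eqI:
  fixes M N :: "'b::euclidean_space measure"
  assumes M: "finite_borel M" and N: "finite_borel N"
    and eq: "\<And>\<phi>. test_function UNIV \<phi> \<Longrightarrow> (\<integral>x. \<phi> x \<partial>M) = (\<integral>x. \<phi> x \<partial>N)"
  shows "M = N"
proof (rule measure_eqI_generator_eq[where E="range (\<lambda>(a, b). box a b)" and \<Omega>=UNIV and A="\<lambda>n::nat. box (- (real n *\<^sub>R One)) (real n *\<^sub>R One)"])
  have fin: "finite_measure M" "finite_measure N" and sets: "sets M = sets borel" "sets N = sets borel"
    using M N by (auto simp: finite_borel_def)
  have *: "(\<lambda>n. \<integral>x. \<psi> n x \<partial>K) \<longlonglongrightarrow> measure K (box l u)"
    if "finite_measure K" "sets K = sets borel"
      "\<And>n::nat. test_function UNIV (\<psi> n)" "\<And>n x. 0 \<le> \<psi> n x \<and> \<psi> n x \<le> 1"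
    "\<And>x. (\<lambda>n. \<psi> n x) \<longlonglongrightarrow> indicator (box l u) x" for K \<psi> and l u :: 'b
  proof -
    interpret finite_measure K by fact
    have sp: "space K = UNIV" using sets_eq_imp_space_eq[OF that(2)] by simp
    have "(\<lambda>n. \<integral>x. \<psi> n x \<partial>K) \<longlonglongrightarrow> (\<integral>x. indicator (box l u) x \<partial>K)"
    proof (rule integral_dominated_convergence[where w="\<lambda>_. 1"])
      show "\<psi> n \<in> borel_measurable K" for n
        using test_function_continuous[OF that(3)] borel_measurable_continuous_onI
          measurable_cong_sets[OF that(2) refl] by blast
      show "indicator (box l u) \<in> borel_measurable K"
        by (simp add: that(2) borel_measurable_indicator)
    qed (use that sp in auto)
    then show ?thesis by (simp add: sp)
  qed
  show "emeasure M X = emeasure N X" if X: "X \<in> range (\<lambda>(a, b). box a b)" for X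
  proof -
    obtain l u where lu: "X = box l u" using X by auto
    obtain \<psi> :: "nat \<Rightarrow> 'b \<Rightarrow> real" where \<psi>: "\<And>n. test_function UNIV (\<psi> n)" "\<And>n x. 0 \<le> \<psi> n x \<and> \<psi> n x \<le> 1"
      "\<And>x. (\<lambda>n. \<psi> n x) \<longlonglongrightarrow> indicator (box l u) x"
      using box_test_function[of l u] by blast
    have "measure M (box l u) = measure N (box l u)"
      using LIMSEQ_unique[OF *[OF fin(1) sets(1) \<psi>]] *[OF fin(2) sets(2) \<psi>] eq[OF \<psi>(1)] by simp
    then show ?thesis
      using fin by (simp add: lu finite_measure.emeasure_eq_measure)
  qed
  show "emeasure M (box (- (real n *\<^sub>R One)) (real n *\<^sub>R One)) \<noteq> \<infinity>" for n
    using finite_measure.emeasure_finite[OF fin(1)] by simp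
  show "sets M = sigma_sets UNIV (range (\<lambda>(a, b). box a b))"
       "sets N = sigma_sets UNIV (range (\<lambda>(a, b). box a b))"
    using sets by (simp_all add: borel_eq_box)
  show "Int_stable (range (\<lambda>(a, b). box a b :: 'b set))"
    by (auto simp: Int_stable_def box_Int_box)
  show "(\<Union>n::nat. box (- (real n *\<^sub>R One)) (real n *\<^sub>R One :: 'b)) = UNIV"
    by (rule UN_box_eq_UNIV)
qed auto

section \<open>Vague compactness of sub-probability measures\<close>

text \<open>Schoenberg's plateau function: period 2, equal to 0 on [0, 1/3] and to 1 on [2/3, 1].
  Clipping a cosine gives continuity and periodicity for free, and the plateaus begin where the
  cosine takes the values 1/2 and -1/2.\<close>

definition tent :: "real \<Rightarrow> real" where
  "tent x = max 0 (min 1 (1/2 - cos (pi * x)))"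

lemma continuous_on_tent: "continuous_on S tent"
  unfolding tent_def by (intro continuous_intros)

lemma tent_bounds: "0 \<le> tent x" "tent x \<le> 1"
  by (auto simp: tent_def)

lemma tent_periodic: "tent (2 * of_int N + y) = tent y"
proof -
  have "cos (pi * (2 * of_int N + y)) = cos ((2 * pi) * of_int N + pi * y)"
    by (simp add: algebra_simps)
  also have "\<dots> = cos (pi * y)"
    by (simp only: cos_add cos_int_2pin sin_int_2pin)
  finally show ?thesis by (simp add: tent_def)
qed

lemma tent_low: assumes "0 \<le> y" "y \<le> 1/3" shows "tent y = 0"
proof -
  have "cos (pi / 3) \<le> cos (pi * y)"
    using assms by (intro cos_monotone_0_pi_le) (auto simp: field_simps)
  then show ?thesis by (simp add: tent_def cos_60)
qed

lemma tent_high: assumes "2/3 \<le> y" "y \<le> 1" shows "tent y = 1"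
proof -
  have "cos (pi * y) \<le> cos (2 * pi / 3)"
    using assms by (intro cos_monotone_0_pi_le) (auto simp: field_simps)
  moreover have "cos (2 * pi / 3) = - 1/2"
    using cos_double_cos[of "pi/3"] by (simp add: cos_60 power2_eq_square)
  ultimately show ?thesis by (simp add: tent_def)
qed

text \<open>The point of the Cantor set whose base-3 digits are 2 where \<open>A\<close> holds and 0
  elsewhere.\<close>

definition ternary :: "(nat \<Rightarrow> bool) \<Rightarrow> real" where
  "ternary A = (\<Sum>i. (if A i then 2 else 0) / 3 ^ Suc i)"

lemma sums_two_thirds: "(\<lambda>i. 2 / 3 ^ Suc i) sums (1::real)"
proof -
  have "(\<lambda>i. (2/3) * (1/3::real) ^ i) sums ((2/3) * (1 / (1 - 1/3)))"
    by (intro sums_mult geometric_sums) auto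
  then show ?thesis by (simp add: power_one_over field_simps)
qed

lemma summable_ternary: "summable (\<lambda>i. (if A i then 2 else 0) / 3 ^ Suc i :: real)"
  by (rule summable_comparison_test'[OF sums_summable[OF sums_two_thirds]]) auto

lemma ternary_bounds: "0 \<le> ternary A" "ternary A \<le> 1"
proof -
  show "0 \<le> ternary A"
    unfolding ternary_def by (intro suminf_nonneg summable_ternary) auto
  have "ternary A \<le> (\<Sum>i. 2 / 3 ^ Suc i)"
    unfolding ternary_def
    by (intro suminf_le summable_ternary sums_summable[OF sums_two_thirds]) auto
  then show "ternary A \<le> 1"
    using sums_unique[OF sums_two_thirds] by simp
qed

lemma ternary_unfold: "3 * ternary A = (if A 0 then 2 else 0) + ternary (\<lambda>i. A (Suc i))"
proof -
  have "ternary A = (if A 0 then 2 else 0) / 3 + (\<Sum>i. (if A (Suc i) then 2 else 0) / 3 ^ Suc (Suc i))"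
    unfolding ternary_def using suminf_split_head[OF summable_ternary[of A]] by simp
  also have "(\<Sum>i. (if A (Suc i) then 2 else 0) / 3 ^ Suc (Suc i)) = ternary (\<lambda>i. A (Suc i)) / 3"
    unfolding ternary_def
    by (subst suminf_divide[OF summable_ternary, symmetric]) (simp add: field_simps)
  finally show ?thesis by simp
qed

text \<open>Multiplication by \<open>3 ^ m\<close> moves \<open>m\<close> digits in front of the
  point; as all digits are 0 or 2, the integer so formed is even, that is, a multiple of the period
  of \<open>tent\<close>.\<close>

lemma ternary_shift: "\<exists>N::int. 3 ^ m * ternary A = 2 * of_int N + ternary (\<lambda>i. A (i + m))"
proof (induction m)
  case 0
  show ?case by (intro exI[of _ 0]) simp
next
  case (Suc m)
  then obtain N :: int where N: "3 ^ m * ternary A = 2 * of_int N + ternary (\<lambda>i. A (i + m))" by blast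
  have "3 ^ Suc m * ternary A = 3 * (2 * of_int N + ternary (\<lambda>i. A (i + m)))"
    using N by simp
  also have "\<dots> = 6 * of_int N + ((if A m then 2 else 0) + ternary (\<lambda>i. A (i + Suc m)))"
    using ternary_unfold[of "\<lambda>i. A (i + m)"] by simp
  finally show ?case
    by (intro exI[of _ "3 * N + (if A m then 1 else 0)"]) simp
qed

text \<open>Up to an even integer, the argument is a Cantor number with leading digit
  \<open>A m\<close>: it lies in [0, 1/3] or in [2/3, 1], where \<open>tent\<close> is
  constant.\<close>

lemma tent_ternary: "tent (3 ^ m * ternary A) = (if A m then 1 else 0)"
proof -
  obtain N :: int where N: "3 ^ m * ternary A = 2 * of_int N + ternary (\<lambda>i. A (i + m))"
    using ternary_shift by blast
  have "3 * ternary (\<lambda>i. A (i + m)) = (if A m then 2 else 0) + ternary (\<lambda>i. A (Suc i + m))"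
    using ternary_unfold[of "\<lambda>i. A (i + m)"] by simp
  then show ?thesis
    using ternary_bounds[of "\<lambda>i. A (Suc i + m)"] unfolding N tent_periodic
    by (auto intro!: tent_low tent_high)
qed

text \<open>The digits are the parities of the integer parts of \<open>2 ^ Suc k * c\<close>. The
  partial sums telescope to the integer part of \<open>2 ^ n * c\<close> divided by
  \<open>2 ^ n\<close>, which is within \<open>2 ^ - n\<close> of \<open>c\<close>;
  \<open>c < 1\<close> makes the first integer part vanish.\<close>

lemma binary_expansion:
  assumes "0 \<le> c" "c < (1::real)"
  shows "\<exists>a::nat \<Rightarrow> bool. (\<lambda>k. (if a k then 1 else 0) / 2 ^ Suc k) sums c"
proof
  define a where "a k = odd \<lfloor>2 ^ Suc k * c\<rfloor>" for k
  have fl: "\<lfloor>2 ^ Suc n * c\<rfloor> = 2 * \<lfloor>2 ^ n * c\<rfloor> + (if a n then 1 else 0)" for n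
  proof -
    have "\<lfloor>2 ^ Suc n * c\<rfloor> div 2 = \<lfloor>2 ^ n * c\<rfloor>"
      using floor_divide_real_eq_div[of 2 "2 ^ Suc n * c"] by simp
    then show ?thesis
      unfolding a_def by presburger
  qed
  have part: "(\<Sum>k<n. (if a k then 1 else 0) / 2 ^ Suc k) = ( of_int \<lfloor>2 ^ n * c\<rfloor> / 2 ^ n :: real)" for n
  proof (induction n)
    case 0
    have "\<lfloor>c\<rfloor> = 0" using assms by (simp add: floor_eq_iff)
    then show ?case by simp
  next
    case (Suc n)
    then show ?case unfolding sum.lessThan_Suc Suc fl by (simp add: field_simps)
  qed
  have "(\<lambda>n. of_int \<lfloor>2 ^ n * c\<rfloor> / 2 ^ n) \<longlonglongrightarrow> c"
  proof (rule Lim_transform_bound[OF _ _, THEN LIM_zero_cancel])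
    show "\<forall>\<^sub>F n in sequentially. norm (of_int \<lfloor>2 ^ n * c\<rfloor> / 2 ^ n - c) \<le> norm ((1/2::real) ^ n)"
    proof (intro always_eventually allI)
      fix n
      have "of_int \<lfloor>2 ^ n * c\<rfloor> \<le> 2 ^ n * c" "2 ^ n * c < of_int \<lfloor>2 ^ n * c\<rfloor> + 1" by linarith+
      then have "\<bar>of_int \<lfloor>2 ^ n * c\<rfloor> - 2 ^ n * c\<bar> \<le> 1" by linarith
      moreover have e: "of_int \<lfloor>2 ^ n * c\<rfloor> / 2 ^ n - c = (of_int \<lfloor>2 ^ n * c\<rfloor> - 2 ^ n * c) / 2 ^ n"
        by (simp add: field_simps)
      ultimately show "norm (of_int \<lfloor>2 ^ n * c\<rfloor> / 2 ^ n - c) \<le> norm ((1/2::real) ^ n)"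
        unfolding e by (simp add: power_one_over divide_right_mono)
    qed
    show "(\<lambda>n. (1/2::real) ^ n) \<longlonglongrightarrow> 0" by (intro LIMSEQ_power_zero) auto
  qed
  then show "(\<lambda>k. (if a k then 1 else 0) / 2 ^ Suc k) sums c"
    unfolding sums_def part .
qed

text \<open>Schoenberg's space-filling curve in dimension \<open>D\<close>: the coordinate \<open>j\<close> reads the ternary
  digits of \<open>t\<close> at the positions congruent to \<open>j\<close> modulo \<open>D\<close>.\<close>

definition scoord :: "nat \<Rightarrow> nat \<Rightarrow> real \<Rightarrow> real" where
  "scoord D j t = (\<Sum>k. tent (3 ^ (D * k + j) * t) / 2 ^ Suc k)"

lemma summable_half: "summable (\<lambda>k. 1 / 2 ^ Suc k :: real)"
  using sums_summable[OF power_half_series] by (simp add: power_one_over)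

lemma continuous_on_scoord: "continuous_on UNIV (scoord D j)"
proof -
  have "uniform_limit UNIV (\<lambda>n t. \<Sum>k<n. tent (3 ^ (D * k + j) * t) / 2 ^ Suc k)
          (\<lambda>t. \<Sum>k. tent (3 ^ (D * k + j) * t) / 2 ^ Suc k) sequentially"
    by (rule Weierstrass_m_test[OF _ summable_half])
       (use tent_bounds in \<open>auto simp: abs_mult divide_right_mono\<close>)
  then have "continuous_on UNIV (\<lambda>t. \<Sum>k. tent (3 ^ (D * k + j) * t) / 2 ^ Suc k)"
    by (rule uniform_limit_theorem[rotated])
       (auto intro!: always_eventually continuous_intros
          continuous_on_compose2[OF continuous_on_tent[of UNIV]])
  then show ?thesis by (simp add: scoord_def[abs_def])
qed

lemma scoord_bounds: "0 \<le> scoord D j t" "scoord D j t \<le> 1"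
proof -
  have s: "summable (\<lambda>k. tent (3 ^ (D * k + j) * t) / 2 ^ Suc k)"
    by (rule summable_comparison_test'[OF summable_half])
       (use tent_bounds in \<open>auto simp: abs_mult divide_right_mono\<close>)
  show "0 \<le> scoord D j t"
    unfolding scoord_def by (intro suminf_nonneg s) (auto simp: tent_bounds)
  have "scoord D j t \<le> (\<Sum>k. 1 / 2 ^ Suc k)"
    unfolding scoord_def
    by (intro suminf_le s summable_half) (auto simp: tent_bounds divide_right_mono)
  also have "\<dots> = 1"
    using sums_unique[OF power_half_series] by (simp add: power_one_over)
  finally show "scoord D j t \<le> 1" .
qed

text \<open>The binary digits of the \<open>D\<close> coordinates are interleaved: position
  \<open>D * k + j\<close> carries digit \<open>k\<close> of coordinate \<open>j\<close>. At the
  Cantor number with these digits every \<open>tent\<close> value in the series of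
  \<open>scoord\<close> is the wanted digit.\<close>

lemma scoord_surj:
  assumes "\<And>j. j < D \<Longrightarrow> 0 \<le> c j \<and> c j < 1"
  shows "\<exists>t\<in>{0..1}. \<forall>j<D. scoord D j t = c j"
proof -
  have "\<forall>j. \<exists>a::nat \<Rightarrow> bool. j < D \<longrightarrow> (\<lambda>k. (if a k then 1 else 0) / 2 ^ Suc k) sums c j"
    using binary_expansion assms by blast
  from choice[OF this] obtain a :: "nat \<Rightarrow> nat \<Rightarrow> bool"
    where a: "\<And>j. j < D \<Longrightarrow> (\<lambda>k. (if a j k then 1 else 0) / 2 ^ Suc k) sums c j"
    by blast
  define A where "A i = a (i mod D) (i div D)" for i
  have "scoord D j (ternary A) = c j" if "j < D" for j
  proof -
    have "A (D * k + j) = a j k" for k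
      using that by (simp add: A_def)
    then show ?thesis
      unfolding scoord_def tent_ternary using sums_unique[OF a[OF that]] by simp
  qed
  then show ?thesis using ternary_bounds by (intro bexI[of _ "ternary A"]) auto
qed

lemma space_filling_curve:
  "\<exists>c :: 'b::euclidean_space \<Rightarrow> real \<Rightarrow> real.
     (\<forall>b. continuous_on UNIV (c b)) \<and> (\<forall>b t. 0 \<le> c b t \<and> c b t \<le> 1) \<and>
     (\<forall>y. (\<forall>b\<in>Basis. 0 < y b \<and> y b < 1) \<longrightarrow> (\<exists>t\<in>{0..1}. \<forall>b\<in>Basis. c b t = y b))"
proof -
  obtain e :: "nat \<Rightarrow> 'b" where e: "bij_betw e {0..<DIM('b)} Basis"
    using ex_bij_betw_nat_finite[OF finite_Basis] by blast
  define i where "i = the_inv_into {0..<DIM('b)} e"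
  have ei: "e j \<in> Basis" "i (e j) = j" if "j < DIM('b)" for j
    using e that by (auto simp: i_def bij_betw_def the_inv_into_f_f)
  have ie: "i b < DIM('b)" "e (i b) = b" if "b \<in> Basis" for b
    using e that
    by (auto simp: i_def bij_betw_def f_the_inv_into_f)
       (metis atLeastLessThan_iff order_refl the_inv_into_into)
  have "\<exists>t\<in>{0..1}. \<forall>b\<in>Basis. scoord DIM('b) (i b) t = y b"
    if y: "\<forall>b\<in>Basis. 0 < y b \<and> y b < 1" for y :: "'b \<Rightarrow> real"
  proof -
    obtain t where t: "t \<in> {0..1}" "\<And>j. j < DIM('b) \<Longrightarrow> scoord DIM('b) j t = y (e j)"
      using scoord_surj[of "DIM('b)" "\<lambda>j. y (e j)"] y ei by (auto simp: less_imp_le)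
    then show ?thesis
      using ie by (intro bexI[of _ t]) auto
  qed
  then show ?thesis
    by (intro exI[of _ "\<lambda>b. scoord DIM('b) (i b)"]) (simp add: continuous_on_scoord scoord_bounds)
qed

text \<open>The curve followed by the coordinate map \<open>tan (pi * (c - 1/2))\<close> covers the whole space. The
  section \<open>\<sigma>\<close> takes the first parameter at which a point is hit; it is Borel because its sublevel
  sets are preimages of compact arcs of the curve.\<close>

lemma borel_chart:
  "\<exists>(U :: real set) (\<sigma> :: 'b::euclidean_space \<Rightarrow> real) (H :: real \<Rightarrow> 'b).
     open U \<and> \<sigma> \<in> borel_measurable borel \<and> H \<in> borel_measurable borel \<and>
     (\<forall>x. \<sigma> x \<in> {0..1} \<and> \<sigma> x \<in> U \<and> H (\<sigma> x) = x) \<and>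
     (\<forall>(\<phi>::'b \<Rightarrow> real) R. continuous_on UNIV \<phi> \<longrightarrow> (\<forall>x. norm x > R \<longrightarrow> \<phi> x = 0) \<longrightarrow>
        continuous_on UNIV (\<lambda>t. indicator U t * \<phi> (H t)))"
proof -
  obtain c :: "'b \<Rightarrow> real \<Rightarrow> real" where
    c': "\<forall>b. continuous_on UNIV (c b)" "\<forall>b t. 0 \<le> c b t \<and> c b t \<le> 1"
    and surj: "\<forall>y. (\<forall>b\<in>Basis. 0 < y b \<and> y b < 1) \<longrightarrow> (\<exists>t\<in>{0..1}. \<forall>b\<in>Basis. c b t = y b)"
    using space_filling_curve[where 'b='b] by (elim exE conjE) (rule that)
  have c: "continuous_on UNIV (c b)" "0 \<le> c b t \<and> c b t \<le> 1" for b t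
    using c' by blast+
  \<comment> \<open>The inverse of the chart \<open>tan (pi * (s - 1/2))\<close>, from the line onto
    the open unit interval.\<close>
  define h where "h y = arctan y / pi + 1/2" for y
  have h: "0 < h y" "h y < 1" "tan (pi * (h y - 1/2)) = y" for y
    using arctan_lbound[of y] arctan_ubound[of y] by (auto simp: h_def field_simps tan_arctan)
  have h_tan: "h (tan (pi * (s - 1/2))) = s" if "0 < s" "s < 1" for s
  proof -
    have "pi * (s - 1/2) < pi * (1/2)" "pi * (- 1/2) < pi * (s - 1/2)"
      by (intro mult_strict_left_mono; use that in simp)+
    then have "arctan (tan (pi * (s - 1/2))) = pi * (s - 1/2)"
      by (intro arctan_tan) simp_all
    then show ?thesis by (simp add: h_def)
  qed
  have h_mono: "mono h"
    by (auto intro!: monoI simp: h_def divide_right_mono arctan_le_iff)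
  have h_cont: "continuous_on S h" for S
    unfolding h_def[abs_def] by (intro continuous_intros) auto
  define U where "U = (\<Inter>b\<in>Basis. {t. 0 < c b t \<and> c b t < 1})"
  have U: "open U"
    unfolding U_def by (intro open_INT open_Collect_conj open_Collect_less c continuous_intros ballI) auto
  define H0 where "H0 t = (\<Sum>b\<in>Basis. tan (pi * (c b t - 1/2)) *\<^sub>R b)" for t
  define H where "H t = (if t \<in> U then H0 t else 0)" for t
  have H0: "continuous_on U H0"
    unfolding H0_def
  proof (intro continuous_intros continuous_on_subset[OF c(1)] ballI)
    fix b :: 'b and t assume b: "b \<in> Basis" and t: "t \<in> U"
    then have "0 < c b t" "c b t < 1" by (auto simp: U_def)
    then have "cos (pi * (c b t - 1/2)) > 0"
      by (intro cos_gt_zero_pi) (auto simp: field_simps)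
    then show "cos (pi * (c b t - 1/2)) \<noteq> 0" by simp
  qed auto
  define K where "K x = {t\<in>{0..1}. \<forall>b\<in>Basis. c b t = h (x \<bullet> b)}" for x :: 'b
  have K_ne: "K x \<noteq> {}" for x
    using surj[rule_format, of "\<lambda>b. h (x \<bullet> b)"] h by (auto simp: K_def)
  have K_closed: "closed (K x)" for x
  proof -
    have "K x = {0..1} \<inter> (\<Inter>b\<in>Basis. {t. c b t = h (x \<bullet> b)})" by (auto simp: K_def)
    then show ?thesis
      by (auto intro!: closed_Int closed_INT closed_Collect_eq c(1) continuous_intros)
  qed
  define \<sigma> where "\<sigma> x = Inf (K x)" for x
  have \<sigma>: "\<sigma> x \<in> K x" for x
    unfolding \<sigma>_def by (rule closed_contains_Inf[OF K_ne _ K_closed]) (auto simp: K_def bdd_below_def)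
  have \<sigma>_le: "\<sigma> x \<le> t" if "t \<in> K x" for x t
    unfolding \<sigma>_def by (rule cInf_lower[OF that]) (auto simp: K_def bdd_below_def)
  have \<sigma>U: "\<sigma> x \<in> U" for x
    using \<sigma>[of x] h by (auto simp: K_def U_def)
  have H\<sigma>: "H (\<sigma> x) = x" for x
    using \<sigma>[of x] \<sigma>U[of x] h by (auto simp: H_def H0_def K_def euclidean_representation)
  have \<sigma>_meas: "\<sigma> \<in> borel_measurable borel"
  proof (rule borel_measurableI_le)
    fix a
    define G where "G t = (\<Sum>b\<in>Basis. c b t *\<^sub>R b)" for t
    define g where "g x = (\<Sum>b\<in>Basis. h (x \<bullet> b) *\<^sub>R b)" for x :: 'b
    have Gg: "t \<in> K x \<longleftrightarrow> t \<in> {0..1} \<and> G t = g x" for t x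
      by (auto simp: K_def G_def g_def euclidean_eq_iff[of "sum _ _"])
    have "{x \<in> space borel. \<sigma> x \<le> a} = g -` (G ` ({0..1} \<inter> {..a}))"
    proof safe
      fix x assume "\<sigma> x \<le> a"
      then show "x \<in> g -` G ` ({0..1} \<inter> {..a})"
        using \<sigma>[of x] unfolding Gg by (auto intro!: image_eqI[of _ _ "\<sigma> x"])
    next
      fix x t assume "g x = G t" "t \<in> {0..1}" "t \<le> a"
      then show "\<sigma> x \<le> a" using \<sigma>_le[of t x] unfolding Gg by auto
    qed auto
    moreover have "compact (G ` ({0..1} \<inter> {..a}))"
      unfolding G_def
      by (intro compact_continuous_image compact_Int_closed continuous_intros continuous_on_subset[OF c(1)]) auto
    moreover have "continuous_on UNIV g"
      unfolding g_def by (intro continuous_intros continuous_on_compose2[OF h_cont[of UNIV]]) auto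
    ultimately show "{x \<in> space borel. \<sigma> x \<le> a} \<in> sets borel"
      by (simp add: closed_vimage compact_imp_closed)
  qed
  have H_meas: "H \<in> borel_measurable borel"
    unfolding H_def[abs_def]
    by (intro borel_measurable_continuous_on_if borel_open U H0 continuous_intros)
  have ext: "continuous_on UNIV (\<lambda>t. indicator U t * \<phi> (H t))"
    if \<phi>: "continuous_on UNIV \<phi>" "\<And>x. norm x > R \<Longrightarrow> \<phi> x = 0" for \<phi> :: "'b \<Rightarrow> real" and R
  proof -
    \<comment> \<open>On \<open>V\<close> some coordinate of the point lies outside [-R, R], or the
      curve is outside the open cube; the pulled-back function vanishes there. Since
      \<open>h\<close> takes values strictly between 0 and 1, the open sets \<open>U\<close> and
      \<open>V\<close> cover the line, and continuity can be checked on each.\<close>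
    define V where "V = - (\<Inter>b\<in>Basis. {t. h (- R) \<le> c b t \<and> c b t \<le> h R})"
    have V: "open V"
      unfolding V_def by (intro open_Compl closed_INT closed_Collect_conj closed_Collect_le c continuous_intros ballI)
    have UV: "U \<union> V = UNIV"
      using h by (auto simp: U_def V_def) (metis less_le_trans, metis le_less_trans)
    have zero: "indicator U t * \<phi> (H t) = 0" if t: "t \<in> V" for t
    proof (cases "t \<in> U")
      case True
      from t obtain b where b: "b \<in> Basis" "\<not> (h (- R) \<le> c b t \<and> c b t \<le> h R)"
        by (auto simp: V_def)
      have "H t \<bullet> b = tan (pi * (c b t - 1/2))"
        using b True by (simp add: H_def H0_def inner_sum_left_Basis)
      then have "h (H t \<bullet> b) = c b t"
        using h_tan[of "c b t"] True b by (auto simp: U_def)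
      then have "\<not> (- R \<le> H t \<bullet> b \<and> H t \<bullet> b \<le> R)"
        using b(2) monoD[OF h_mono] by metis
      then have "norm (H t) > R"
        using Basis_le_norm[OF b(1), of "H t"] by linarith
      then show ?thesis using \<phi>(2) by simp
    qed auto
    have "continuous_on U (\<lambda>t. \<phi> (H0 t))"
      by (rule continuous_on_compose2[OF \<phi>(1) H0]) auto
    then have "continuous_on U (\<lambda>t. indicator U t * \<phi> (H t))"
      by (rule continuous_on_cong[THEN iffD1, rotated -1]) (auto simp: H_def)
    moreover have "continuous_on V (\<lambda>t. indicator U t * \<phi> (H t))"
      by (rule continuous_on_cong[THEN iffD1, OF refl _ continuous_on_const[of _ 0]]) (auto simp: zero)
    ultimately show ?thesis
      using continuous_on_open_Un[OF U V] UV by metis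
  qed
  have "\<sigma> x \<in> {0..1}" for x using \<sigma>[of x] by (auto simp: K_def)
  moreover have "\<forall>(\<phi>::'b \<Rightarrow> real) R. continuous_on UNIV \<phi> \<longrightarrow> (\<forall>x. norm x > R \<longrightarrow> \<phi> x = 0) \<longrightarrow>
        continuous_on UNIV (\<lambda>t. indicator U t * \<phi> (H t))"
    using ext by blast
  ultimately show ?thesis
    using U \<sigma>_meas H_meas \<sigma>U H\<sigma> by blast
qed

section \<open>From probability measures on the line to vague limits in space\<close>

lemma integral_scaled_measure:
  fixes f :: "'b \<Rightarrow> real"
  assumes "r \<ge> 0" "sets N = sets M" "\<And>A. A \<in> sets M \<Longrightarrow> emeasure N A = ennreal r * emeasure M A"
  shows "(\<integral>x. f x \<partial>N) = r * (\<integral>x. f x \<partial>M)"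
proof -
  have "N = density M (\<lambda>_. ennreal r)"
    by (rule measure_eqI) (auto simp: assms emeasure_density_const)
  then show ?thesis
  proof (cases "f \<in> borel_measurable M")
    case True
    then show ?thesis
      unfolding \<open>N = _\<close> by (subst integral_density) (use assms in auto)
  next
    \<comment> \<open>Without measurability both integrals are 0 by convention.\<close>
    case False
    then have "\<not> integrable N f" "\<not> integrable M f"
      using borel_measurable_integrable measurable_cong_sets[OF assms(2) refl] by blast+
    then show ?thesis by (simp add: not_integrable_integral_eq)
  qed
qed

text \<open>Helly's theorem speaks of probability measures, so the mass is split off as a factor.
  For total mass 0 the factor annihilates the integral, and any probability measure serves; a Dirac
  measure is taken.\<close>

lemma normalise_subprob:
  fixes M :: "'b::euclidean_space measure"
  assumes "sets M = sets borel" "emeasure M UNIV \<le> 1"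
  obtains P where "prob_space P" "sets P = sets borel"
    "\<And>f. (\<integral>x. f x \<partial>M) = measure M UNIV * (\<integral>x. f x \<partial>P :: real)"
proof -
  have sp: "space M = UNIV" using sets_eq_imp_space_eq[OF assms(1)] by simp
  have lt: "emeasure M UNIV < top" using assms(2) by (rule order.strict_trans1) simp
  interpret finite_measure M
    by (rule finite_measureI) (use lt sp in simp)
  show thesis
  proof (cases "measure M UNIV = 0")
    case True
    have 1: "(\<integral>x. f x \<partial>M) = measure M UNIV * (\<integral>x. f x \<partial>return borel 0)" for f :: "'b \<Rightarrow> real"
    proof (rule integral_scaled_measure)
      fix A :: "'b set" assume "A \<in> sets (return borel 0)"
      then show "emeasure M A = ennreal (measure M UNIV) * emeasure (return borel 0) A"
        using True finite_measure_mono[of A UNIV] measure_nonneg[of M A] assms(1) \<open>A \<in> _\<close>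
        by (simp add: emeasure_eq_measure)
    qed (simp_all add: assms(1))
    show thesis
      using prob_space_return[of 0 "borel :: 'b measure"] 1 by (intro that[of "return borel 0"]) simp_all
  next
    case False
    then have pos: "measure M UNIV > 0" using measure_nonneg[of M UNIV] by linarith
    define P where "P = density M (\<lambda>_. ennreal (1 / measure M UNIV))"
    have eP: "emeasure P A = ennreal (1 / measure M UNIV) * emeasure M A" if "A \<in> sets M" for A
      using that by (simp add: P_def emeasure_density_const)
    have "emeasure P (space P) = 1"
      using pos eP[of UNIV] sp sets.top[of M]
      by (simp add: P_def emeasure_eq_measure ennreal_mult[symmetric])
    then have 1: "prob_space P" by (rule prob_spaceI)
    have 2: "(\<integral>x. f x \<partial>P) = (1 / measure M UNIV) * (\<integral>x. f x \<partial>M)" for f :: "'b \<Rightarrow> real"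
      by (rule integral_scaled_measure) (use eP pos in \<open>auto simp: P_def\<close>)
    show thesis
    proof (rule that[OF 1])
      show "sets P = sets borel" using assms by (simp add: P_def)
      show "(\<integral>x. f x \<partial>M) = measure M UNIV * (\<integral>x. f x \<partial>P :: real)" for f
        using pos by (simp add: 2)
    qed
  qed
qed

text \<open>Merely continuous test functions: unlike smooth ones, they form a class that can be
  pulled back along the space-filling curve and multiplied by Lipschitz cut-offs.\<close>

definition vague_conv :: "(nat \<Rightarrow> 'b::euclidean_space measure) \<Rightarrow> 'b measure \<Rightarrow> bool" where
  "vague_conv M N \<longleftrightarrow> (\<forall>(\<phi>::'b \<Rightarrow> real) R. continuous_on UNIV \<phi> \<longrightarrow> (\<forall>x. norm x > R \<longrightarrow> \<phi> x = 0) \<longrightarrow>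
     (\<lambda>n. \<integral>x. \<phi> x \<partial>M n) \<longlonglongrightarrow> (\<integral>x. \<phi> x \<partial>N))"

definition subprob :: "'b::euclidean_space measure \<Rightarrow> bool" where
  "subprob M \<longleftrightarrow> sets M = sets borel \<and> emeasure M UNIV \<le> 1"

text \<open>The normalised measures, lifted by \<sigma>, live on the unit interval and are tight.
  Along a subsequence the lifts converge weakly to \<open>Q\<close> and the masses to
  \<open>m\<close>; the limit is the image under \<open>H\<close> of \<open>Q\<close> restricted to
  \<open>U\<close>, multiplied by \<open>m\<close>.\<close>

theorem vague_compactness:
  fixes M :: "nat \<Rightarrow> 'b::euclidean_space measure"
  assumes M: "\<And>n. subprob (M n)"
  obtains r N where "strict_mono (r :: nat \<Rightarrow> nat)" "subprob N" "vague_conv (M \<circ> r) N"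
proof -
  have "\<forall>n. \<exists>P. prob_space P \<and> sets P = sets borel \<and>
      (\<forall>f. (\<integral>x. f x \<partial>M n) = measure (M n) UNIV * (\<integral>x. f x \<partial>P :: real))"
    using M normalise_subprob unfolding subprob_def by metis
  then obtain P where P: "\<And>n. prob_space (P n)" "\<And>n. sets (P n) = sets borel"
    "\<And>n f. (\<integral>x. f x \<partial>M n) = measure (M n) UNIV * (\<integral>x. f x \<partial>P n :: real)"
    by metis
  obtain U :: "real set" and \<sigma> :: "'b \<Rightarrow> real" and H :: "real \<Rightarrow> 'b" where U: "open U"
    and meas [measurable]: "\<sigma> \<in> borel_measurable borel" "H \<in> borel_measurable borel"
    and \<sigma>: "\<forall>x. \<sigma> x \<in> {0..1} \<and> \<sigma> x \<in> U \<and> H (\<sigma> x) = x"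
    and ext: "\<forall>(\<phi>::'b \<Rightarrow> real) R. continuous_on UNIV \<phi> \<longrightarrow> (\<forall>x. norm x > R \<longrightarrow> \<phi> x = 0) \<longrightarrow>
        continuous_on UNIV (\<lambda>t. indicator U t * \<phi> (H t))"
    using borel_chart[where 'b='b] by (elim exE conjE) (rule that)
  have \<sigma>P [measurable]: "\<sigma> \<in> measurable (P n) borel" for n
    using meas(1) measurable_cong_sets[OF P(2) refl] by blast
  define \<nu> where "\<nu> n = distr (P n) borel \<sigma>" for n
  have \<nu>: "real_distribution (\<nu> n)" for n
  proof -
    interpret P: prob_space "P n" by (rule P)
    show ?thesis
      unfolding \<nu>_def real_distribution_def real_distribution_axioms_def
      using P.prob_space_distr[OF \<sigma>P] by simp
  qed
  have "tight \<nu>"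
    unfolding tight_def
  \<comment> \<open>Tightness is tested on half-open intervals; the lower end -1 keeps the parameter
    0 inside.\<close>
  proof (intro conjI allI impI \<nu>, rule exI[of _ "-1"], rule exI[of _ 1], intro conjI allI)
    fix \<epsilon> :: real and n assume \<epsilon>: "\<epsilon> > 0"
    interpret P: prob_space "P n" by (rule P)
    have "\<sigma> -` {-1<..1} \<inter> space (P n) = space (P n)"
      using \<sigma> by (auto simp: less_le_trans[of "-1" 0])
    then have "measure (\<nu> n) {-1<..1} = 1"
      by (simp add: \<nu>_def measure_distr P.prob_space)
    then show "measure (\<nu> n) {-1<..1} > 1 - \<epsilon>" using \<epsilon> by simp
  qed auto
  moreover have "bounded (range (\<lambda>n. measure (M n) UNIV))"
  proof -
    have "measure (M n) UNIV \<le> 1" for n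
      using M[of n] by (simp add: subprob_def measure_def enn2real_leI)
    then show ?thesis by (auto intro!: boundedI[of _ 1])
  qed
  then obtain m s where s: "strict_mono (s :: nat \<Rightarrow> nat)" and m: "(\<lambda>n. measure (M (s n)) UNIV) \<longlonglongrightarrow> m"
    using bounded_imp_convergent_subsequence[of "\<lambda>n. measure (M n) UNIV"] by (auto simp: o_def)
  ultimately obtain r Q where r: "strict_mono (r :: nat \<Rightarrow> nat)" and Q: "real_distribution Q"
    and w: "weak_conv_m (\<nu> \<circ> s \<circ> r) Q"
    using tight_imp_convergent_subsubsequence by blast
  interpret Q: real_distribution Q by (rule Q)
  have m01: "0 \<le> m" "m \<le> 1"
  proof -
    have "measure (M n) UNIV \<le> 1" for n
      using M[of n] by (simp add: subprob_def measure_def enn2real_leI)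
    then show "0 \<le> m" "m \<le> 1"
      using m by (auto intro: LIMSEQ_le_const LIMSEQ_le_const2)
  qed
  \<comment> \<open>Outside \<open>U\<close> the curve runs on the boundary of the cube, which is
    infinity for the space. The restriction to \<open>U\<close> discards the mass that has
    escaped.\<close>
  define N where "N = distr (density Q (\<lambda>t. ennreal (m * indicator U t))) borel H"
  have Um [measurable]: "U \<in> sets borel" using U by simp
  have HQ: "H \<in> measurable (density Q (\<lambda>t. ennreal (m * indicator U t))) borel"
    by measurable
  have "subprob N"
  proof -
    have "emeasure N UNIV = (\<integral>\<^sup>+t. ennreal (m * indicator U t) \<partial>Q)"
      by (simp add: N_def emeasure_distr[OF HQ] emeasure_density)
    also have "\<dots> \<le> (\<integral>\<^sup>+t. 1 \<partial>Q)"
      using m01 by (intro nn_integral_mono) (auto simp: indicator_def)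
    also have "\<dots> = 1" using Q.emeasure_space_1 by simp
    finally show ?thesis by (simp add: subprob_def N_def)
  qed
  moreover have "vague_conv (M \<circ> (s \<circ> r)) N"
    unfolding vague_conv_def
  proof (intro allI impI)
    fix \<phi> :: "'b \<Rightarrow> real" and R
    assume \<phi>: "continuous_on UNIV \<phi>" "\<forall>x. norm x > R \<longrightarrow> \<phi> x = 0"
    have [measurable]: "\<phi> \<in> borel_measurable borel" using \<phi>(1) by (rule borel_measurable_continuous_onI)
    let ?f = "\<lambda>t. indicator U t * \<phi> (H t)"
    have cont: "continuous_on UNIV ?f" using ext \<phi> by blast
    obtain B where B: "\<And>x. norm (\<phi> x) \<le> B"
    proof -
      have "compact (\<phi> ` cball 0 R)"
        by (intro compact_continuous_image continuous_on_subset[OF \<phi>(1)]) auto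
      then obtain B where B: "\<And>x. x \<in> cball 0 R \<Longrightarrow> norm (\<phi> x) \<le> B"
        using compact_imp_bounded bounded_iff by (metis imageI)
      have "norm (\<phi> x) \<le> max B 0" for x
        using B[of x] \<phi>(2) by (cases "norm x > R") (auto simp: max_def split: if_splits)
      then show thesis by (rule that)
    qed
    have "(\<lambda>n. integral\<^sup>L ((\<nu> \<circ> s \<circ> r) n) ?f) \<longlonglongrightarrow> integral\<^sup>L Q ?f"
    proof (rule weak_conv_imp_integral_bdd_continuous_conv[OF _ Q w, where B=B])
      show "isCont ?f x" for x
        using cont by (simp add: continuous_on_eq_continuous_at)
      show "norm (?f x) \<le> B" for x
        using B[of "H x"] norm_ge_zero[of "\<phi> (H x)"] by (auto simp: indicator_def split: if_splits) 
    qed (auto simp: \<nu>)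
    \<comment> \<open>The section satisfies \<open>H (\<sigma> x) = x\<close> and takes values in
      \<open>U\<close>, so the lifted integrals are the original ones.\<close>
    moreover have "integral\<^sup>L (\<nu> n) ?f = (\<integral>x. \<phi> x \<partial>P n)" for n
      unfolding \<nu>_def by (subst integral_distr[OF \<sigma>P]) (use \<sigma> in auto)
    ultimately have "(\<lambda>n. \<integral>x. \<phi> x \<partial>P (s (r n))) \<longlonglongrightarrow> integral\<^sup>L Q ?f"
      by simp
    then have "(\<lambda>n. measure (M (s (r n))) UNIV * (\<integral>x. \<phi> x \<partial>P (s (r n)))) \<longlonglongrightarrow> m * integral\<^sup>L Q ?f"
      using LIMSEQ_subseq_LIMSEQ[OF m r] by (intro tendsto_mult) (auto simp: o_def)
    moreover have "(\<integral>x. \<phi> x \<partial>N) = m * integral\<^sup>L Q ?f"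
      unfolding N_def by (subst integral_distr[OF HQ], simp, subst integral_density) (use m01 in \<open>auto simp: mult.assoc\<close>)
    ultimately show "(\<lambda>n. \<integral>x. \<phi> x \<partial>(M \<circ> (s \<circ> r)) n) \<longlonglongrightarrow> (\<integral>x. \<phi> x \<partial>N)"
      by (simp add: P(3)[symmetric])
  qed
  ultimately show thesis
    using that strict_mono_o[OF s r] by blast
qed

section \<open>The flow of a locally Lipschitz field\<close>

text \<open>The infimum of the closed level set serves: a value above \<open>R\<close> before it
  would, by the intermediate value theorem, produce an earlier hit.\<close>

lemma first_hit:
  fixes n :: "real \<Rightarrow> real"
  assumes "a \<le> b" "continuous_on {a..b} n" "n a < R" "R \<le> n b"
  obtains \<tau> where "\<tau> \<in> {a..b}" "n \<tau> = R" "\<And>r. r \<in> {a..\<tau>} \<Longrightarrow> n r \<le> R"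
proof -
  define Z where "Z = {r\<in>{a..b}. n r = R}"
  have hit: "\<exists>r\<in>{a..c}. n r = R" if "R \<le> n c" "c \<in> {a..b}" for c
    using IVT'[of n a R c] that assms continuous_on_subset[OF assms(2), of "{a..c}"] by auto
  have ne: "Z \<noteq> {}" using hit[of b] assms by (auto simp: Z_def)
  have cl: "closed Z"
    unfolding Z_def using continuous_closed_preimage_constant[OF assms(2), of R] by simp
  have bd: "bdd_below Z" by (auto simp: Z_def bdd_below_def)
  have \<tau>: "Inf Z \<in> Z" by (rule closed_contains_Inf[OF ne bd cl])
  have "n r \<le> R" if r: "r \<in> {a..Inf Z}" for r
  proof (rule ccontr)
    assume a: "\<not> n r \<le> R"
    then obtain r' where r': "r' \<in> {a..r}" "n r' = R"
      using hit[of r] r \<tau> by (auto simp: Z_def)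
    then have "r' \<in> Z" using r \<tau> by (auto simp: Z_def)
    then have "Inf Z \<le> r'" using bd by (rule cInf_lower)
    then have "r' = r" using r r' by auto
    then show False using r' a by simp
  qed
  then show thesis using that[of "Inf Z"] \<tau> by (auto simp: Z_def)
qed

text \<open>Time reversal of \<open>first_hit\<close>.\<close>

lemma last_hit:
  fixes n :: "real \<Rightarrow> real"
  assumes "a \<le> b" "continuous_on {a..b} n" "n b < R" "R \<le> n a"
  obtains \<tau> where "\<tau> \<in> {a..b}" "n \<tau> = R" "\<And>r. r \<in> {\<tau>..b} \<Longrightarrow> n r \<le> R"
proof -
  have "continuous_on {-b..-a} (\<lambda>r. n (- r))"
    by (rule continuous_on_compose2[OF assms(2)]) (auto intro: continuous_intros)
  then obtain \<tau> where \<tau>: "\<tau> \<in> {-b..-a}" "n (- \<tau>) = R" "\<And>r. r \<in> {-b..\<tau>} \<Longrightarrow> n (- r) \<le> R"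
    using first_hit[of "-b" "-a" "\<lambda>r. n (- r)" R] assms by auto
  show thesis
  proof (rule that[of "- \<tau>"])
    show "n r \<le> R" if "r \<in> {- \<tau>..b}" for r
      using \<tau>(3)[of "- r"] that by auto
  qed (use \<tau> in auto)
qed

lemma solves_untilD:
  assumes "solves_until v x s y"
  shows "y 0 = x" "\<And>r. r \<in> {0..s} \<Longrightarrow> (y has_vector_derivative v (y r)) (at r within {0..s})"
  using assms by (auto simp: solves_until_def)

lemma solves_until_subset:
  assumes "solves_until v x s y" "s' \<le> s"
  shows "solves_until v x s' y"
  unfolding solves_until_def
proof (intro conjI ballI)
  fix r assume "r \<in> {0..s'}"
  then show "(y has_vector_derivative v (y r)) (at r within {0..s'})"
    using assms by (intro has_vector_derivative_within_subset[OF solves_untilD(2)[OF assms(1)]]) auto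
qed (rule solves_untilD[OF assms(1)])

lemma solves_until_cong:
  assumes "solves_until v x s y" "0 \<le> s" "\<And>r. r \<in> {0..s} \<Longrightarrow> z r = y r"
    "\<And>r. r \<in> {0..s} \<Longrightarrow> w (y r) = v (y r)"
  shows "solves_until w x s z"
  unfolding solves_until_def
proof (intro conjI ballI)
  show "z 0 = x" using assms(1-3) by (simp add: solves_until_def)
  fix r assume r: "r \<in> {0..s}"
  show "(z has_vector_derivative w (z r)) (at r within {0..s})"
    using has_vector_derivative_transform[OF r assms(3) solves_untilD(2)[OF assms(1) r]]
    by (simp add: assms(3)[OF r] assms(4)[OF r])
qed

lemma solves_until_continuous:
  assumes "solves_until v x s y"
  shows "continuous_on {0..s} y"
  using solves_untilD(2)[OF assms] has_vector_derivative_continuous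
  by (meson continuous_on_eq_continuous_within)

text \<open>Gronwall in differential form: \<open>exp (- 2 * L * t)\<close> times the squared
  distance of the two solutions is nonincreasing and starts at 0.\<close>

lemma solution_unique:
  fixes v :: "'b::euclidean_space \<Rightarrow> 'b"
  assumes y: "solves_until v x s y" and z: "solves_until v x s z"
    and L: "L-lipschitz_on UNIV v" and r: "r \<in> {0..s}"
  shows "y r = z r"
proof -
  define g where "g t = exp (- (2 * L * t)) * ((y t - z t) \<bullet> (y t - z t))" for t
  have "g 0 \<ge> g r"
  proof (rule DERIV_nonpos_imp_decreasing_open[where f=g])
    show "0 \<le> r" using r by simp
    show "continuous_on {0..r} g"
      unfolding g_def using r
      by (intro continuous_intros continuous_on_subset[OF solves_until_continuous[OF y]]
          continuous_on_subset[OF solves_until_continuous[OF z]]) auto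
    fix t assume t: "0 < t" "t < r"
    have at: "at t within {0..s} = at t"
      using t r by (intro at_within_Icc_at) auto
    have dy: "(y has_derivative (\<lambda>h. h *\<^sub>R v (y t))) (at t)"
      using solves_untilD(2)[OF y, of t] t r by (auto simp: at has_vector_derivative_def)
    have dz: "(z has_derivative (\<lambda>h. h *\<^sub>R v (z t))) (at t)"
      using solves_untilD(2)[OF z, of t] t r by (auto simp: at has_vector_derivative_def)
    let ?d = "exp (- (2 * L * t)) * (2 * ((y t - z t) \<bullet> (v (y t) - v (z t))) - 2 * L * ((y t - z t) \<bullet> (y t - z t)))"
    have "(g has_derivative (\<lambda>h. h * ?d)) (at t)"
      unfolding g_def
      by (rule derivative_eq_intros dy dz refl)+ (auto simp: algebra_simps inner_commute)
    then have "DERIV g t :> ?d"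
      by (rule has_derivative_imp_has_field_derivative) simp
    moreover have "(y t - z t) \<bullet> (v (y t) - v (z t)) \<le> L * ((y t - z t) \<bullet> (y t - z t))"
    proof -
      have "(y t - z t) \<bullet> (v (y t) - v (z t)) \<le> norm (y t - z t) * norm (v (y t) - v (z t))"
        by (rule norm_cauchy_schwarz)
      also have "\<dots> \<le> norm (y t - z t) * (L * norm (y t - z t))"
        using lipschitz_onD[OF L, of "y t" "z t"] by (intro mult_left_mono) (auto simp: dist_norm)
      finally show ?thesis by (simp add: dot_square_norm power2_eq_square mult_ac)
    qed
    then have "?d \<le> 0"
      by (simp add: mult_nonneg_nonpos)
    ultimately show "\<exists>d. DERIV g t :> d \<and> d \<le> 0" by blast
  qed
  moreover have "g 0 = 0"
    using solves_untilD(1)[OF y] solves_untilD(1)[OF z] by (simp add: g_def)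
  ultimately have "(y r - z r) \<bullet> (y r - z r) \<le> 0"
    by (simp add: g_def mult_le_0_iff)
  then show ?thesis by (metis eq_iff_diff_eq_0 inner_gt_zero_iff not_le)
qed

text \<open>The Picard operator is a contraction on bounded continuous functions of \<open>(t, x)\<close> after
  the substitution \<open>y t = x + exp (K * t) *\<^sub>R u (t, x)\<close>; its fixed point is the flow, jointly
  continuous by construction.\<close>

lemma lipschitz_flow_exists:
  fixes f :: "'b::euclidean_space \<Rightarrow> 'b"
  assumes L: "L-lipschitz_on UNIV f" and C: "\<And>x. norm (f x) \<le> C"
  shows "\<exists>F. continuous_on UNIV (\<lambda>z. F (fst z) (snd z)) \<and> (\<forall>x s. solves_until f x s (\<lambda>t. F t x))"
proof -
  have L0: "L \<ge> 0" using lipschitz_on_nonneg[OF L] .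
  have C0: "C \<ge> 0" using order_trans[OF norm_ge_zero C] .
  \<comment> \<open>The weight \<open>exp (K * t)\<close> gives the Picard operator the Lipschitz
    constant \<open>L / K\<close>, which is below 1/2 for this \<open>K\<close>; the summand 1 keeps
    \<open>K\<close> positive when \<open>L = 0\<close>.\<close>
  define K where "K = 2 * L + 1"
  have K: "K > 0" using L0 by (simp add: K_def)
  have fc: "continuous_on S f" for S
    using lipschitz_on_continuous_on[OF L] continuous_on_subset by blast
  define I where "I u t x = integral {0..t} (\<lambda>r. f (x + exp (K * r) *\<^sub>R u (r, x)))"
    for u :: "real \<times> 'b \<Rightarrow> 'b" and t x
  \<comment> \<open>Negative times are clamped to 0, because the fixed point is sought among bounded
    continuous functions on the whole of \<open>real \<times> 'b\<close>.\<close>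
  define G where "G u z = exp (- (K * max 0 (fst z))) *\<^sub>R I u (max 0 (fst z)) (snd z)"
    for u :: "real \<times> 'b \<Rightarrow> 'b" and z
  have cont_int: "continuous_on S (\<lambda>r. f (x + exp (K * r) *\<^sub>R u (r, x)))"
    if "continuous_on UNIV u" for u :: "real \<times> 'b \<Rightarrow> 'b" and x S
    by (intro continuous_on_compose2[OF fc[of UNIV]] continuous_on_compose2[OF that] continuous_intros) auto
  \<comment> \<open>Rescaling to the fixed interval [0, 1] turns the variable end point into a
    parameter, so that joint continuity in \<open>t\<close> and \<open>x\<close> follows from
    continuity of parameter integrals.\<close>
  have I_scaled: "I u t x = t *\<^sub>R integral (cbox 0 1) (\<lambda>\<theta>. f (x + exp (K * (t * \<theta>)) *\<^sub>R u (t * \<theta>, x)))"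
    if u: "continuous_on UNIV u" and t: "t \<ge> 0" for u :: "real \<times> 'b \<Rightarrow> 'b" and t x
  proof -
    have "((\<lambda>\<theta>. t *\<^sub>R f (x + exp (K * (t * \<theta>)) *\<^sub>R u (t * \<theta>, x))) has_integral
        (integral {t * 0..t * 1} (\<lambda>r. f (x + exp (K * r) *\<^sub>R u (r, x))))) {0..1}"
      using t by (intro has_integral_substitution[where c=0 and d=t] cont_int u)
         (auto intro!: derivative_eq_intros mult_left_le)
    from integral_unique[OF this] show ?thesis
      by (simp add: I_def)
  qed
  have G_cont: "continuous_on UNIV (G u)" if u: "continuous_on UNIV u" for u
  proof -
    have "continuous_on UNIV (\<lambda>z::real \<times> 'b. integral (cbox 0 1)
        (\<lambda>\<theta>. f (snd z + exp (K * (max 0 (fst z) * \<theta>)) *\<^sub>R u (max 0 (fst z) * \<theta>, snd z))))"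
      by (rule integral_continuous_on_param)
         (auto simp: split_beta intro!: continuous_on_compose2[OF fc[of UNIV]]
           continuous_on_compose2[OF u] continuous_intros)
    then show ?thesis
      unfolding G_def[abs_def]
      by (subst I_scaled[OF u]) (auto intro!: continuous_intros)
  qed
  have G_bound: "norm (G u z) \<le> C / K" if u: "continuous_on UNIV u" for u z
  proof -
    define t where "t = max 0 (fst z)"
    have t: "t \<ge> 0" by (simp add: t_def)
    have "norm (I u t (snd z)) \<le> C * (t - 0)"
      unfolding I_def by (rule integral_bound) (use t C cont_int[OF u] in auto)
    then have "norm (G u z) \<le> exp (- (K * t)) * (C * t)"
      by (simp add: G_def t_def[symmetric])
    also have "\<dots> \<le> C / K"
    proof -
      have "K * t \<le> exp (K * t)" using exp_ge_add_one_self[of "K * t"] by linarith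
      then have "K * t * exp (- (K * t)) \<le> 1"
        by (simp add: exp_minus field_simps)
      then have "C * (K * t * exp (- (K * t))) \<le> C * 1"
        using C0 by (intro mult_left_mono) auto
      then show ?thesis using K by (simp add: field_simps)
    qed
    finally show ?thesis .
  qed
  have G_mem: "G u \<in> bcontfun" if "continuous_on UNIV u" for u
    by (rule bcontfun_normI[OF G_cont[OF that] G_bound[OF that]])
  define A where "A u = Bcontfun (G (apply_bcontfun u))" for u
  have A: "apply_bcontfun (A u) = G (apply_bcontfun u)" for u
    unfolding A_def by (rule Bcontfun_inverse[OF G_mem]) (rule continuous_on_apply_bcontfun)
  have "\<exists>!u. A u = u"
  proof (rule banach_fix_type[of "1/2"], simp, simp, intro allI)
    fix u w
    show "dist (A u) (A w) \<le> 1/2 * dist u w"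
    proof (rule dist_bound)
      fix z :: "real \<times> 'b"
      define t where "t = max 0 (fst z)"
      define x where "x = snd z"
      have t: "t \<ge> 0" by (simp add: t_def)
      let ?u = "apply_bcontfun u" and ?w = "apply_bcontfun w"
      let ?i = "\<lambda>u r. f (x + exp (K * r) *\<^sub>R apply_bcontfun u (r, x))"
      have ii: "?i u integrable_on {0..t}" for u
        by (intro integrable_continuous_real cont_int continuous_on_apply_bcontfun)
      have 1: "((\<lambda>r. L * (exp (K * r) * dist u w)) has_integral
          L * (exp (K * t) / K * dist u w) - L * (exp (K * 0) / K * dist u w)) {0..t}"
        using t K by (intro fundamental_theorem_of_calculus)
           (auto intro!: derivative_eq_intros simp flip: has_real_derivative_iff_has_vector_derivative)
      have "norm (I ?u t x - I ?w t x) = norm (integral {0..t} (\<lambda>r. ?i u r - ?i w r))"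
        unfolding I_def by (subst integral_diff[OF ii ii]) simp
      also have "\<dots> \<le> integral {0..t} (\<lambda>r. L * (exp (K * r) * dist u w))"
      proof (rule integral_norm_bound_integral)
        show "(\<lambda>r. ?i u r - ?i w r) integrable_on {0..t}" by (intro integrable_diff ii)
        show "(\<lambda>r. L * (exp (K * r) * dist u w)) integrable_on {0..t}" using 1 by blast
        fix r
        have "norm (?i u r - ?i w r) \<le> L * norm (exp (K * r) *\<^sub>R ?u (r, x) - exp (K * r) *\<^sub>R ?w (r, x))"
          using lipschitz_onD[OF L, of "x + exp (K * r) *\<^sub>R ?u (r, x)" "x + exp (K * r) *\<^sub>R ?w (r, x)"]
          by (simp add: dist_norm)
        also have "\<dots> = L * (exp (K * r) * dist (?u (r, x)) (?w (r, x)))"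
          by (simp add: dist_norm flip: scaleR_diff_right)
        also have "\<dots> \<le> L * (exp (K * r) * dist u w)"
          using dist_bounded[of u "(r, x)" w] L0 by (intro mult_left_mono) auto
        finally show "norm (?i u r - ?i w r) \<le> L * (exp (K * r) * dist u w)" .
      qed
      also have "\<dots> = L * (exp (K * t) / K * dist u w) - L * (exp (K * 0) / K * dist u w)"
        using 1 by (rule integral_unique)
      also have "\<dots> \<le> L * (exp (K * t) / K * dist u w)"
        using L0 K by simp
      finally have le: "norm (I ?u t x - I ?w t x) \<le> L * (exp (K * t) / K * dist u w)" .
      have "dist (A u z) (A w z) = exp (- (K * t)) * norm (I ?u t x - I ?w t x)"
        by (simp add: A G_def dist_norm t_def[symmetric] x_def[symmetric] flip: scaleR_diff_right)
      also have "\<dots> \<le> exp (- (K * t)) * (L * (exp (K * t) / K * dist u w))"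
        using le by (intro mult_left_mono) auto
      also have "\<dots> = L / K * dist u w"
        by (simp add: exp_minus)
      also have "\<dots> \<le> 1/2 * dist u w"
        using L0 by (intro mult_right_mono) (auto simp: K_def field_simps)
      finally show "dist (A u z) (A w z) \<le> 1/2 * dist u w" .
    qed
  qed
  then obtain u where "A u = u" by blast
  then have u: "apply_bcontfun u z = G (apply_bcontfun u) z" for z
    by (metis A)
  define F where "F t x = x + exp (K * max 0 t) *\<^sub>R apply_bcontfun u (t, x)" for t x
  have F_I: "F t x = x + integral {0..t} (\<lambda>r. f (F r x))" if t: "t \<ge> 0" for t x
  proof -
    have "F t x = x + I (apply_bcontfun u) t x"
      using t by (simp add: F_def u[of "(t, x)"] G_def flip: exp_add)
    also have "I (apply_bcontfun u) t x = integral {0..t} (\<lambda>r. f (F r x))"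
      unfolding I_def by (rule integral_cong) (auto simp: F_def)
    finally show ?thesis .
  qed
  have F_cont: "continuous_on UNIV (\<lambda>z. F (fst z) (snd z))"
    unfolding F_def by (intro continuous_intros continuous_on_compose2[OF continuous_on_apply_bcontfun[of UNIV]]) auto
  have F_cont_t: "continuous_on S (\<lambda>t. F t x)" for S x
  proof -
    have "continuous_on S (\<lambda>t. (t, x))" by (intro continuous_intros)
    from continuous_on_compose2[OF F_cont this] show ?thesis by simp
  qed
  have "solves_until f x s (\<lambda>t. F t x)" for x s
    unfolding solves_until_def
  proof (intro conjI ballI)
    show "F 0 x = x" using F_I[of 0 x] by simp
    fix r assume r: "r \<in> {0..s}"
    have "((\<lambda>t. x + integral {0..t} (\<lambda>r. f (F r x))) has_vector_derivative 0 + f (F r x)) (at r within {0..s})"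
      by (intro has_vector_derivative_add has_vector_derivative_const integral_has_vector_derivative r
          continuous_on_compose2[OF fc[of UNIV] F_cont_t]) auto
    then have "((\<lambda>t. x + integral {0..t} (\<lambda>r. f (F r x))) has_vector_derivative f (F r x)) (at r within {0..s})"
      by simp
    then show "((\<lambda>t. F t x) has_vector_derivative f (F r x)) (at r within {0..s})"
      by (rule has_vector_derivative_transform[OF r, rotated]) (use F_I in auto)
  qed
  then show ?thesis using F_cont by blast
qed

section \<open>Truncated flows, lifetimes and measurability\<close>

locale locally_lipschitz_field =
  fixes v :: "'b::euclidean_space \<Rightarrow> 'b"
  assumes lipschitz: "\<exists>L. L-lipschitz_on (cball 0 N) v"
begin

text \<open>Projecting onto a ball before applying \<open>v\<close> gives a bounded, globally
  Lipschitz field that agrees with \<open>v\<close> on the ball.\<close>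

definition trunc :: "nat \<Rightarrow> 'b \<Rightarrow> 'b" where
  "trunc N x = v (closest_point (cball 0 (real N)) x)"

lemma trunc_eq: "norm x \<le> real N \<Longrightarrow> trunc N x = v x"
  by (simp add: trunc_def closest_point_self)

lemma trunc_lipschitz: "\<exists>L. L-lipschitz_on UNIV (trunc N)"
proof -
  obtain L where L: "L-lipschitz_on (cball 0 (real N)) v" using lipschitz by blast
  have cp: "1-lipschitz_on UNIV (closest_point (cball 0 (real N)) :: 'b \<Rightarrow> 'b)"
    using closest_point_lipschitz[of "cball (0::'b) (real N)"] by (auto intro!: lipschitz_onI)
  have "closest_point (cball 0 (real N)) ` UNIV \<subseteq> cball (0::'b) (real N)"
    using closest_point_in_set[of "cball (0::'b) (real N)"] by auto
  then have "(L * 1)-lipschitz_on UNIV (trunc N)"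
    unfolding trunc_def[abs_def]
    by (intro lipschitz_on_compose2[OF cp] lipschitz_on_subset[OF L])
  then show ?thesis by blast
qed

lemma trunc_bounded: "\<exists>C. \<forall>x. norm (trunc N x) \<le> C"
proof -
  obtain L where L: "L-lipschitz_on (cball 0 (real N)) v" using lipschitz by blast
  have "compact (v ` cball 0 (real N))"
    by (intro compact_continuous_image lipschitz_on_continuous_on[OF L]) auto
  then obtain C where "\<And>x. x \<in> cball 0 (real N) \<Longrightarrow> norm (v x) \<le> C"
    using compact_imp_bounded bounded_iff by (metis imageI)
  then show ?thesis
    unfolding trunc_def
    using closest_point_in_set[of "cball (0::'b) (real N)"] by (intro exI[of _ C]) auto
qed

lemma continuous: "continuous_on UNIV v"
proof (rule continuous_at_imp_continuous_on, rule ballI)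
  fix x :: 'b
  obtain L where L: "L-lipschitz_on (cball 0 (norm x + 1)) v" using lipschitz by blast
  have "continuous_on (cball 0 (norm x + 1)) v" by (rule lipschitz_on_continuous_on[OF L])
  then show "isCont v x"
    by (rule continuous_on_interior) (simp add: interior_cball)
qed

definition tflow :: "nat \<Rightarrow> real \<Rightarrow> 'b \<Rightarrow> 'b" where
  "tflow N = (SOME F. continuous_on UNIV (\<lambda>z. F (fst z) (snd z)) \<and>
      (\<forall>x s. solves_until (trunc N) x s (\<lambda>t. F t x)))"

lemma tflow:
  "continuous_on UNIV (\<lambda>z. tflow N (fst z) (snd z))"
  "solves_until (trunc N) x s (\<lambda>t. tflow N t x)"
proof -
  have "\<exists>F. continuous_on UNIV (\<lambda>z. F (fst z) (snd z)) \<and>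
      (\<forall>x s. solves_until (trunc N) x s (\<lambda>t. F t x))"
    using trunc_lipschitz trunc_bounded lipschitz_flow_exists by metis
  from someI_ex[OF this] show
    "continuous_on UNIV (\<lambda>z. tflow N (fst z) (snd z))"
    "solves_until (trunc N) x s (\<lambda>t. tflow N t x)"
    unfolding tflow_def by blast+
qed

lemma tflow_continuous_time: "continuous_on S (\<lambda>t. tflow N t x)"
proof -
  have "continuous_on S (\<lambda>t. (t, x))" by (intro continuous_intros)
  from continuous_on_compose2[OF tflow(1) this] show ?thesis by simp
qed

lemma tflow_continuous_space: "continuous_on S (\<lambda>x. tflow N t x)"
proof -
  have "continuous_on S (\<lambda>x. (t, x))" by (intro continuous_intros)
  from continuous_on_compose2[OF tflow(1) this] show ?thesis by simp
qed

lemma tflow_0: "tflow N 0 x = x"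
  using solves_untilD(1)[OF tflow(2)] .

lemma tflow_solves:
  assumes "0 \<le> s" "\<And>r. r \<in> {0..s} \<Longrightarrow> norm (tflow N r x) \<le> real N"
  shows "solves_until v x s (\<lambda>t. tflow N t x)"
  by (rule solves_until_cong[OF tflow(2)[of N x s]]) (use assms trunc_eq in auto)

lemma solution_eq_tflow:
  assumes "solves_until v x s y" "\<And>r. r \<in> {0..s} \<Longrightarrow> norm (y r) \<le> real N" "r \<in> {0..s}"
  shows "y r = tflow N r x"
proof -
  obtain L where "L-lipschitz_on UNIV (trunc N)" using trunc_lipschitz by blast
  moreover have "solves_until (trunc N) x s y"
    by (rule solves_until_cong[OF assms(1)]) (use assms trunc_eq in auto)
  ultimately show ?thesis using solution_unique tflow(2) assms(3) by blast
qed

lemma solution_bounded: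
  fixes y :: "real \<Rightarrow> 'b"
  assumes "solves_until w x s y"
  obtains N :: nat where "N \<ge> N0" "\<And>r. r \<in> {0..s} \<Longrightarrow> norm (y r) \<le> real N"
proof -
  have "compact (y ` {0..s})"
    by (intro compact_continuous_image solves_until_continuous[OF assms]) auto
  then obtain C where C: "\<And>r. r \<in> {0..s} \<Longrightarrow> norm (y r) \<le> C"
    using compact_imp_bounded bounded_iff by (metis imageI)
  obtain N :: nat where "C \<le> real N" using real_arch_simple by blast
  then have "norm (y r) \<le> real (max N N0)" if "r \<in> {0..s}" for r
    using C[OF that] by (simp add: of_nat_max)
  then show thesis by (intro that[of "max N N0"]) auto
qed

lemma solutions_agree:
  assumes "solves_until v x s y" "solves_until v x s z" "r \<in> {0..s}"
  shows "y r = z r"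
proof -
  obtain N where N: "\<And>r. r \<in> {0..s} \<Longrightarrow> norm (y r) \<le> real N"
    using solution_bounded[OF assms(1), of 0] by blast
  obtain M where M: "M \<ge> N" "\<And>r. r \<in> {0..s} \<Longrightarrow> norm (z r) \<le> real M"
    using solution_bounded[OF assms(2), of N] by blast
  have "norm (y r) \<le> real M" if "r \<in> {0..s}" for r
    using N[OF that] M(1) by linarith
  then show ?thesis
    using solution_eq_tflow[OF assms(1) _ assms(3)] solution_eq_tflow[OF assms(2) M(2) assms(3)] by metis
qed

text \<open>The choice in \<open>flow\<close> asks for one function that works for all times below
  the lifetime. It is glued pointwise: the value at \<open>r\<close> is that of any solution on
  [0, r], and solutions agree where they coexist.\<close>

lemma flow_solves:
  assumes "0 \<le> s" "ereal s < lifetime v x"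
  shows "solves_until v x s (flow v x)"
proof -
  define y where "y r = (SOME z. solves_until v x r z) r" for r
  have "solves_until v x s y" if s: "0 \<le> s" "ereal s < lifetime v x" for s
  proof -
    obtain s' z where s': "s < s'" "solves_until v x s' z"
      using s by (auto simp: lifetime_def less_SUP_iff)
    have "y r = z r" if r: "r \<in> {0..s}" for r
    proof -
      have z: "solves_until v x r z" using solves_until_subset[OF s'(2)] r s' by auto
      then have "solves_until v x r (SOME z. solves_until v x r z)"
        using someI[of "\<lambda>z. solves_until v x r z"] by blast
      then show ?thesis unfolding y_def using solutions_agree[OF _ z] r by auto
    qed
    then show ?thesis
      using s s' by (intro solves_until_cong[OF solves_until_subset[OF s'(2), of s]]) auto
  qed
  then have "\<exists>y. \<forall>s\<ge>0. ereal s < lifetime v x \<longrightarrow> solves_until v x s y" by blast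
  from someI_ex[OF this] show ?thesis
    using assms unfolding flow_def by blast
qed

text \<open>For fixed \<open>s\<close> these closed sets increase with \<open>N\<close> and exhaust
  the points whose lifetime exceeds \<open>s\<close>. On each of them the flow is a truncated flow,
  which is continuous in the initial point.\<close>

definition staying :: "nat \<Rightarrow> real \<Rightarrow> 'b set" where
  "staying N s = {x. \<forall>r\<in>{0..s}. norm (tflow N r x) \<le> real N}"

lemma less_lifetime_iff:
  assumes "0 \<le> s"
  shows "ereal s < lifetime v x \<longleftrightarrow> (\<exists>N. x \<in> staying N s)"
proof
  assume "ereal s < lifetime v x"
  note fl = flow_solves[OF assms this]
  obtain N where N: "\<And>r. r \<in> {0..s} \<Longrightarrow> norm (flow v x r) \<le> real N"
    using solution_bounded[OF fl, of 0] by blast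
  have "x \<in> staying N s"
    using solution_eq_tflow[OF fl N] N by (auto simp: staying_def)
  then show "\<exists>N. x \<in> staying N s" by blast
next
  assume "\<exists>N. x \<in> staying N s"
  then obtain N where N: "\<And>r. r \<in> {0..s} \<Longrightarrow> norm (tflow N r x) \<le> real N"
    unfolding staying_def by blast
  \<comment> \<open>The lifetime is a supremum, so the strict inequality requires existence slightly
    beyond \<open>s\<close>; the larger radius leaves room to continue.\<close>
  have N': "norm (tflow N r x) \<le> real (Suc N)" if "r \<in> {0..s}" for r
    using N[OF that] by simp
  have eq: "tflow (Suc N) r x = tflow N r x" if "r \<in> {0..s}" for r
    using solution_eq_tflow[OF tflow_solves[OF assms N] N' that] by simp
  have "continuous_on UNIV (\<lambda>r. norm (tflow (Suc N) r x))"
    by (intro continuous_intros tflow_continuous_time)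
  moreover have "norm (tflow (Suc N) s x) < real (Suc N)"
    using N[of s] eq[of s] assms by simp
  ultimately have "\<forall>\<^sub>F r in at s. norm (tflow (Suc N) r x) < real (Suc N)"
    by (auto simp: continuous_on_eq_continuous_at isCont_def intro: order_tendstoD)
  then obtain d where d: "d > 0" "\<And>r. r \<noteq> s \<Longrightarrow> dist r s < d \<Longrightarrow> norm (tflow (Suc N) r x) < real (Suc N)"
    by (auto simp: eventually_at)
  have "norm (tflow (Suc N) r x) \<le> real (Suc N)" if r: "r \<in> {0..s + d/2}" for r
  proof (cases "r \<le> s")
    case True
    then show ?thesis using N[of r] eq[of r] r by auto
  next
    case False
    then show ?thesis using d(2)[of r] r d(1) by (auto simp: dist_real_def)
  qed
  then have "solves_until v x (s + d/2) (\<lambda>t. tflow (Suc N) t x)"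
    using assms d by (intro tflow_solves) auto
  then have "ereal (s + d/2) \<le> lifetime v x"
    unfolding lifetime_def using assms d by (intro SUP_upper) auto
  moreover have "ereal s < ereal (s + d/2)" using d by simp
  ultimately show "ereal s < lifetime v x" by (rule less_le_trans[rotated])
qed

lemma staying_flow:
  assumes "0 \<le> s" "x \<in> staying N s" "r \<in> {0..s}"
  shows "flow v x r = tflow N r x"
proof -
  have lt: "ereal s < lifetime v x" using less_lifetime_iff[OF assms(1)] assms(2) by blast
  have "solves_until v x s (\<lambda>t. tflow N t x)"
    using assms by (intro tflow_solves) (auto simp: staying_def)
  then show ?thesis
    using solutions_agree[OF flow_solves[OF assms(1) lt] _ assms(3)] by simp
qed

lemma staying_mono:
  assumes "0 \<le> s" "N \<le> M" "x \<in> staying N s"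
  shows "x \<in> staying M s"
proof -
  have *: "norm (tflow N r x) \<le> real M" if "r \<in> {0..s}" for r
  proof -
    have "norm (tflow N r x) \<le> real N" using assms(3) that by (simp add: staying_def)
    then show ?thesis using of_nat_mono[OF assms(2), where 'a=real] by linarith
  qed
  have "solves_until v x s (\<lambda>t. tflow N t x)"
    using assms by (intro tflow_solves) (auto simp: staying_def)
  then have "tflow N r x = tflow M r x" if "r \<in> {0..s}" for r
    using solution_eq_tflow[of x s "\<lambda>t. tflow N t x" M r] * that by blast
  with * show ?thesis
    by (simp add: staying_def)
qed

text \<open>A trajectory that does not survive time \<open>s\<close> leaves every ball before: up to
  its first exit from a ball of radius \<open>N\<close> the truncated flow is the true one, and
  \<open>N\<close> may be taken larger than \<open>R\<close>.\<close>

lemma blow_up: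
  assumes "0 \<le> s" "\<not> ereal s < lifetime v x"
  obtains \<tau> where "\<tau> \<in> {0..s}" "ereal \<tau> < lifetime v x" "norm (flow v x \<tau>) \<ge> R"
proof -
  obtain N :: nat where N: "max R (norm x) < real N" using reals_Archimedean2 by blast
  let ?n = "\<lambda>r. norm (tflow N r x)"
  have cont: "continuous_on S ?n" for S by (intro continuous_intros tflow_continuous_time)
  obtain r1 where r1: "r1 \<in> {0..s}" "?n r1 > real N"
  proof -
    have "x \<notin> staying N s" using assms less_lifetime_iff by blast
    then show thesis using that by (auto simp: staying_def not_le)
  qed
  obtain \<tau> where \<tau>: "\<tau> \<in> {0..r1}" "?n \<tau> = real N" "\<And>r. r \<in> {0..\<tau>} \<Longrightarrow> ?n r \<le> real N"
    using first_hit[of 0 r1 ?n "real N"] cont[of "{0..r1}"] r1 N by (auto simp: tflow_0)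
  have st: "x \<in> staying N \<tau>" using \<tau>(3) by (auto simp: staying_def)
  have \<tau>0: "0 \<le> \<tau>" using \<tau> by auto
  show thesis
  proof (rule that)
    show "\<tau> \<in> {0..s}" using \<tau> r1 by auto
    show "ereal \<tau> < lifetime v x" using less_lifetime_iff[OF \<tau>0] st by blast
    show "norm (flow v x \<tau>) \<ge> R"
      using staying_flow[OF \<tau>0 st, of \<tau>] \<tau> \<tau>0 N by auto
  qed
qed

lemma closed_staying: "closed (staying N s)"
proof -
  have "staying N s = (\<Inter>r\<in>{0..s}. {x. norm (tflow N r x) \<le> real N})" by (auto simp: staying_def)
  then show ?thesis
    by (auto intro!: closed_INT closed_Collect_le continuous_intros tflow_continuous_space)
qed

text \<open>At every point the function is the eventually constant limit of continuous functions,
  built from truncated flows, times indicators of the closed sets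
  \<open>staying N s\<close>.\<close>

lemma transport_measurable:
  fixes \<psi> :: "'b \<Rightarrow> real"
  assumes s: "0 \<le> s" and \<psi>: "continuous_on UNIV \<psi>"
  shows "(\<lambda>x. indicator {x. ereal s < lifetime v x} x *
    (\<psi> (flow v x s) * exp (- \<epsilon> * integral {0..s} (\<lambda>r. norm (v (flow v x r)))))) \<in> borel_measurable borel"
proof -
  let ?g = "\<lambda>N x. \<psi> (tflow N s x) * exp (- \<epsilon> * integral {0..s} (\<lambda>r. norm (trunc N (tflow N r x))))"
  let ?h = "\<lambda>x. \<psi> (flow v x s) * exp (- \<epsilon> * integral {0..s} (\<lambda>r. norm (v (flow v x r))))"
  have tc: "continuous_on UNIV (trunc N)" for N
    using trunc_lipschitz lipschitz_on_continuous_on by blast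
  have "continuous_on UNIV (\<lambda>x. integral (cbox 0 s) (\<lambda>r. norm (trunc N (tflow N r x))))" for N
    by (rule integral_continuous_on_param)
       (auto simp: split_beta intro!: continuous_intros continuous_on_compose2[OF tc]
          continuous_on_compose2[OF tflow(1), of _ "\<lambda>z. (snd z, fst z)", simplified])
  then have "continuous_on UNIV (?g N)" for N
    by (intro continuous_intros continuous_on_compose2[OF \<psi> tflow_continuous_space]) auto
  then have "?g N \<in> borel_measurable borel" for N
    by (rule borel_measurable_continuous_onI)
  then have m: "(\<lambda>x. indicator (staying N s) x * ?g N x) \<in> borel_measurable borel" for N
    by (rule borel_measurable_times[rotated]) (simp add: closed_staying)
  show ?thesis
  proof (rule borel_measurable_LIMSEQ_real[OF _ m])
    fix x
    show "(\<lambda>N. indicator (staying N s) x * ?g N x) \<longlonglongrightarrow> indicator {x. ereal s < lifetime v x} x * ?h x"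
    proof (cases "ereal s < lifetime v x")
      case True
      then obtain N0 where N0: "x \<in> staying N0 s" using less_lifetime_iff[OF s] by blast
      have "indicator (staying N s) x * ?g N x = ?h x" if "N \<ge> N0" for N
      proof -
        have st: "x \<in> staying N s" using staying_mono[OF s that N0] .
        have "integral {0..s} (\<lambda>r. norm (trunc N (tflow N r x))) = integral {0..s} (\<lambda>r. norm (v (flow v x r)))"
          using st by (intro integral_cong) (simp add: staying_flow[OF s st] trunc_eq staying_def)
        then show ?thesis using st staying_flow[OF s st, of s] s by simp
      qed
      then have "\<forall>\<^sub>F N in sequentially. ?h x = indicator (staying N s) x * ?g N x"
        by (auto simp: eventually_sequentially intro!: exI[of _ N0])
      then show ?thesis
        using True by (auto intro: Lim_transform_eventually[OF tendsto_const])
    next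
      case False
      then show ?thesis using less_lifetime_iff[OF s] by auto
    qed
  qed
qed

end

section \<open>Transport along a flow with killing\<close>

lemma compact_support_bound:
  fixes f :: "'b::euclidean_space \<Rightarrow> real"
  assumes "compact_support_in \<Omega> f"
  shows "\<exists>R>0. \<forall>x. norm x \<ge> R \<longrightarrow> f x = 0 \<and> (f has_derivative (\<lambda>h. 0)) (at x)"
proof -
  let ?S = "closure {x. f x \<noteq> 0}"
  have "bounded ?S"
    using assms by (auto simp: compact_support_in_def intro: compact_imp_bounded)
  then obtain R where R: "R > 0" "\<And>x. x \<in> ?S \<Longrightarrow> norm x \<le> R"
    by (auto simp: bounded_pos)
  have z: "f x = 0" if "x \<in> - ?S" for x
    using that closure_subset[of "{x. f x \<noteq> 0}"] by auto
  have "f x = 0 \<and> (f has_derivative (\<lambda>h. 0)) (at x)" if "norm x \<ge> R + 1" for x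
  proof
    have out: "x \<in> - ?S" using R(2)[of x] that by auto
    then show "f x = 0" by (rule z)
    have op: "open (- ?S)" by (intro open_Compl closed_closure)
    show "(f has_derivative (\<lambda>h. 0)) (at x)"
      using has_derivative_const[of "0::real"] op out
      by (rule has_derivative_transform_within_open) (simp only: z)
  qed
  then show ?thesis using R(1) by (intro exI[of _ "R + 1"]) auto
qed

lemma subprob_finite:
  assumes "subprob M"
  shows "finite_measure M" "sets M = sets borel" "space M = UNIV" "measure M UNIV \<le> 1" "finite_borel M"
proof -
  show s: "sets M = sets borel" using assms by (simp add: subprob_def)
  show sp: "space M = UNIV" using sets_eq_imp_space_eq[OF s] by simp
  have lt: "emeasure M UNIV < top"
    using assms unfolding subprob_def by (intro order.strict_trans1[of "emeasure M UNIV" 1]) auto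
  show f: "finite_measure M"
    by (rule finite_measureI) (use lt sp in simp)
  show "measure M UNIV \<le> 1"
    using assms by (simp add: subprob_def measure_def enn2real_leI)
  show "finite_borel M" using s f by (simp add: finite_borel_def)
qed

lemma subprob_measurable: "subprob M \<Longrightarrow> f \<in> borel_measurable borel \<Longrightarrow> f \<in> borel_measurable M"
  using measurable_cong_sets[OF subprob_finite(2) refl] by blast

lemma subprob_integrable:
  fixes f :: "'b::euclidean_space \<Rightarrow> 'c::euclidean_space"
  assumes "subprob M" "f \<in> borel_measurable borel" "\<And>x. norm (f x) \<le> C"
  shows "integrable M f"
proof -
  interpret finite_measure M using subprob_finite assms(1) by blast
  show ?thesis
    by (rule integrable_const_bound[of _ C]) (use assms subprob_measurable in auto)
qed

lemma subprob_integral_bound: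
  fixes f :: "'b::euclidean_space \<Rightarrow> 'c::euclidean_space"
  assumes "subprob M" "\<And>x. norm (f x) \<le> C"
  shows "norm (\<integral>x. f x \<partial>M) \<le> C"
proof (cases "integrable M f")
  case True
  interpret finite_measure M using subprob_finite assms(1) by blast
  have C: "0 \<le> C" using order_trans[OF norm_ge_zero assms(2)] .
  have "norm (\<integral>x. f x \<partial>M) \<le> (\<integral>x. norm (f x) \<partial>M)" by (rule integral_norm_bound)
  also have "\<dots> \<le> (\<integral>x. C \<partial>M)"
    using assms(2) True by (intro integral_mono) auto
  also have "\<dots> = C * measure M UNIV" by (simp add: subprob_finite(3)[OF assms(1)])
  also have "\<dots> \<le> C"
    using C subprob_finite(4)[OF assms(1)] by (simp add: mult_left_le)
  finally show ?thesis .
next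
  \<comment> \<open>A non-integrable function has integral 0, and \<open>C\<close> is nonnegative as
    a bound for norms.\<close>
  case False
  then show ?thesis
    using order_trans[OF norm_ge_zero assms(2)] by (simp add: not_integrable_integral_eq)
qed

text \<open>The distance to \<open>S\<close>, multiplied by \<open>j\<close> and cut off at 1, is
  positive exactly off \<open>S\<close>. For the empty set \<open>infdist\<close> is 0 by
  convention, so \<open>S\<close> must have a point.\<close>

lemma continuous_open_indicator:
  fixes S :: "'b::euclidean_space set"
  assumes "closed S" "S \<noteq> {}"
  obtains \<psi> :: "nat \<Rightarrow> 'b \<Rightarrow> real"
  where "\<And>j. continuous_on UNIV (\<psi> j)" "\<And>j x. 0 \<le> \<psi> j x \<and> \<psi> j x \<le> 1"
    "\<And>j x. x \<in> S \<Longrightarrow> \<psi> j x = 0" "\<And>x. (\<lambda>j. \<psi> j x) \<longlonglongrightarrow> indicator (- S) x"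
proof -
  define \<psi> where "\<psi> j x = min 1 (real j * infdist x S)" for j x
  have 1: "continuous_on UNIV (\<psi> j)" for j
    unfolding \<psi>_def by (intro continuous_intros)
  have 2: "0 \<le> \<psi> j x \<and> \<psi> j x \<le> 1" for j x
    by (simp add: \<psi>_def infdist_nonneg)
  have 3: "\<psi> j x = 0" if "x \<in> S" for j x
    using that by (simp add: \<psi>_def)
  have 4: "(\<lambda>j. \<psi> j x) \<longlonglongrightarrow> indicator (- S) x" for x
  proof (cases "x \<in> S")
    case False
    then have pos: "infdist x S > 0" using infdist_pos_not_in_closed assms by blast
    obtain j0 :: nat where j0: "1 < real j0 * infdist x S"
      using reals_Archimedean3[OF pos] by blast
    have "\<psi> j x = 1" if "j \<ge> j0" for j
    proof -
      have "real j0 * infdist x S \<le> real j * infdist x S"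
        using that pos by (intro mult_right_mono) auto
      then show ?thesis using j0 by (simp add: \<psi>_def)
    qed
    then have "\<forall>\<^sub>F j in sequentially. indicator (- S) x = \<psi> j x"
      using False by (auto simp: eventually_sequentially intro!: exI[of _ j0])
    then show ?thesis by (rule Lim_transform_eventually[OF tendsto_const])
  qed (simp add: 3)
  show thesis by (rule that[OF 1 2 3 4])
qed

lemma open_measure_approx:
  fixes S :: "'b::euclidean_space set"
  assumes M: "finite_borel M" and \<psi>: "\<And>j. continuous_on UNIV (\<psi> j)" "\<And>j x. 0 \<le> \<psi> j x \<and> \<psi> j x \<le> (1::real)"
    and lim: "\<And>x. (\<lambda>j::nat. \<psi> j x) \<longlonglongrightarrow> indicator A x" and A: "A \<in> sets borel"
  shows "(\<lambda>j. \<integral>x. \<psi> j x \<partial>M) \<longlonglongrightarrow> measure M A"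
proof -
  have M': "finite_measure M" "sets M = sets borel" using M by (auto simp: finite_borel_def)
  interpret finite_measure M by fact
  have sp: "space M = UNIV" using sets_eq_imp_space_eq[OF M'(2)] by simp
  have "(\<lambda>j. \<integral>x. \<psi> j x \<partial>M) \<longlonglongrightarrow> (\<integral>x. indicator A x \<partial>M)"
  proof (rule integral_dominated_convergence[where w="\<lambda>_. 1"])
    show "\<psi> n \<in> borel_measurable M" for n
      using borel_measurable_continuous_onI[OF \<psi>(1)] measurable_cong_sets[OF M'(2) refl] by blast
    show "indicator A \<in> borel_measurable M"
      by (simp add: M'(2) borel_measurable_indicator A)
  qed (use \<psi>(2) lim sp in auto)
  then show ?thesis by (simp add: sp)
qed

text \<open>The open half of the portmanteau theorem: the indicator of \<open>A\<close> is an
  increasing limit of continuous functions. Intersecting \<open>A\<close> with balls gives these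
  functions bounded support; the radius tends to infinity afterwards.\<close>

lemma vague_limit_open:
  fixes M :: "nat \<Rightarrow> 'b::euclidean_space measure"
  assumes M: "\<And>n. subprob (M n)" and N: "subprob N" and conv: "vague_conv M N"
    and A: "open A" "\<And>n. measure (M n) A \<le> c" and c: "0 \<le> c"
  shows "measure N A \<le> c"
proof (cases "A = {}")
  case False
  have bound: "measure N (A \<inter> ball 0 (real R)) \<le> c" for R
  proof (cases "A \<inter> ball 0 (real R) = {}")
    case False
    have "closed (- (A \<inter> ball 0 (real R)))" using A(1) by (auto intro: closed_Compl)
    moreover have "- (A \<inter> ball 0 (real R)) \<noteq> {}"
    proof -
      obtain b :: 'b where b: "norm b = real R + 1" using vector_choose_size[of "real R + 1"] by auto
      then have "b \<notin> ball 0 (real R)" by simp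
      then show ?thesis by blast
    qed
    ultimately obtain \<psi> :: "nat \<Rightarrow> 'b \<Rightarrow> real" where
      \<psi>: "\<And>j. continuous_on UNIV (\<psi> j)" "\<And>j x. 0 \<le> \<psi> j x \<and> \<psi> j x \<le> 1"
      "\<And>j x. x \<in> - (A \<inter> ball 0 (real R)) \<Longrightarrow> \<psi> j x = 0"
      "\<And>x. (\<lambda>j. \<psi> j x) \<longlonglongrightarrow> indicator (- (- (A \<inter> ball 0 (real R)))) x"
      by (rule continuous_open_indicator) blast
    have le: "(\<integral>x. \<psi> j x \<partial>N) \<le> c" for j
    proof (rule LIMSEQ_le_const2)
      show "(\<lambda>n. \<integral>x. \<psi> j x \<partial>M n) \<longlonglongrightarrow> (\<integral>x. \<psi> j x \<partial>N)"
        using conv \<psi>(1)[of j] \<psi>(3)[of _ j] unfolding vague_conv_def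
        by (elim allE[of _ "\<psi> j"] allE[of _ "real R"]) auto
      have "(\<integral>x. \<psi> j x \<partial>M n) \<le> c" for n
      proof -
        interpret finite_measure "M n" using subprob_finite M by blast
        have "(\<integral>x. \<psi> j x \<partial>M n) \<le> (\<integral>x. indicator A x \<partial>M n)"
        proof (rule integral_mono')
          show "integrable (M n) (indicator A :: 'b \<Rightarrow> real)"
            using A(1) subprob_finite(2)[OF M] by (intro integrable_real_indicator) (auto simp: less_top[symmetric])
          show "\<psi> j x \<le> indicator A x" for x
            using \<psi>(2)[of j x] \<psi>(3)[of x j] by (cases "x \<in> A") auto
        qed auto
        also have "\<dots> = measure (M n) A" using subprob_finite(3)[OF M] by simp
        finally show ?thesis using A(2) order_trans by blast
      qed
      then show "\<exists>K. \<forall>n\<ge>K. (\<integral>x. \<psi> j x \<partial>M n) \<le> c" by blast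
    qed
    have "(\<lambda>j. \<integral>x. \<psi> j x \<partial>N) \<longlonglongrightarrow> measure N (A \<inter> ball 0 (real R))"
      using open_measure_approx[OF subprob_finite(5)[OF N] \<psi>(1,2), where A="A \<inter> ball 0 (real R)"] \<psi>(4) A(1) by simp
    then show ?thesis by (rule LIMSEQ_le_const2) (use le in blast)
  qed (simp add: c)
  interpret finite_measure N using subprob_finite N by blast
  have "(\<lambda>R. measure N (A \<inter> ball 0 (real R))) \<longlonglongrightarrow> measure N (\<Union>R. A \<inter> ball 0 (real R))"
  proof (rule finite_Lim_measure_incseq)
    show "range (\<lambda>R. A \<inter> ball 0 (real R)) \<subseteq> sets N"
    proof (rule image_subsetI)
      show "A \<inter> ball 0 (real R) \<in> sets N" for R
        unfolding subprob_finite(2)[OF N] using A(1) by (intro borel_open open_Int open_ball)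
    qed
    show "incseq (\<lambda>R. A \<inter> ball 0 (real R))"
      unfolding incseq_def by (intro allI impI Int_mono subset_ball) auto
  qed
  moreover have "(\<Union>R. A \<inter> ball 0 (real R)) = A"
    using reals_Archimedean2 by (auto simp: set_eq_iff)
  ultimately have "(\<lambda>R. measure N (A \<inter> ball 0 (real R))) \<longlonglongrightarrow> measure N A" by simp
  then show ?thesis by (rule LIMSEQ_le_const2) (use bound in blast)
qed (simp add: c)

text \<open>If \<open>X\<close> did not converge to \<open>l\<close>, the indices of the terms at
  distance at least \<open>e\<close> would enumerate a subsequence without any further subsequence
  tending to \<open>l\<close>.\<close>

lemma LIMSEQ_by_subsequences:
  fixes X :: "nat \<Rightarrow> 'b::metric_space"
  assumes "\<And>s. strict_mono (s :: nat \<Rightarrow> nat) \<Longrightarrow> \<exists>r. strict_mono (r :: nat \<Rightarrow> nat) \<and> (\<lambda>n. X (s (r n))) \<longlonglongrightarrow> l"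
  shows "X \<longlonglongrightarrow> l"
proof (rule tendstoI, rule ccontr)
  fix e :: real assume e: "0 < e" "\<not> (\<forall>\<^sub>F n in sequentially. dist (X n) l < e)"
  then have "infinite {n. \<not> dist (X n) l < e}"
    by (simp add: not_eventually frequently_cofinite flip: cofinite_eq_sequentially)
  then obtain s where s: "strict_mono (s :: nat \<Rightarrow> nat)" "\<And>n. \<not> dist (X (s n)) l < e"
    using infinite_enumerate by blast
  obtain r where "(\<lambda>n. X (s (r n))) \<longlonglongrightarrow> l" using assms[OF s(1)] by blast
  then have "\<forall>\<^sub>F n in sequentially. dist (X (s (r n))) l < e" using e(1) by (rule tendstoD)
  then show False using s(2) by simp
qed

text \<open>Testing against \<open>C\<^sub>c\<^sup>\<infinity>\<close> functions suffices: by compactness every subsequence has a further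
  subsequence converging against all of \<open>C\<^sub>c\<close>, and its limit is identified by smooth functions.\<close>

lemma dist_conv_vague:
  fixes M :: "nat \<Rightarrow> 'b::euclidean_space measure"
  assumes M: "\<And>n. subprob (M n)" and N: "finite_borel N" and conv: "dist_conv M N"
  shows "subprob N \<and> vague_conv M N"
proof -
  have sub: "\<exists>r. strict_mono r \<and> subprob N \<and> vague_conv (M \<circ> s \<circ> r) N" if s: "strict_mono s" for s :: "nat \<Rightarrow> nat"
  proof -
    obtain r P where r: "strict_mono (r :: nat \<Rightarrow> nat)" "subprob P" "vague_conv ((M \<circ> s) \<circ> r) P"
      using vague_compactness[of "M \<circ> s"] M by auto
    have "P = N"
    proof (rule finite_borel_eqI[OF subprob_finite(5)[OF r(2)] N])
      fix \<phi> :: "'b \<Rightarrow> real" assume \<phi>: "test_function UNIV \<phi>"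
      have "compact_support_in UNIV \<phi>" using \<phi> by (simp add: test_function_def)
      from compact_support_bound[OF this]
      obtain R where R': "\<forall>x. norm x > R \<longrightarrow> \<phi> x = 0" by (meson less_imp_le)
      have "(\<lambda>n. \<integral>x. \<phi> x \<partial>((M \<circ> s) \<circ> r) n) \<longlonglongrightarrow> (\<integral>x. \<phi> x \<partial>P)"
        using r(3)[unfolded vague_conv_def, rule_format, OF test_function_continuous[OF \<phi>]] R' by blast
      moreover have "(\<lambda>n. \<integral>x. \<phi> x \<partial>((M \<circ> s) \<circ> r) n) \<longlonglongrightarrow> (\<integral>x. \<phi> x \<partial>N)"
        using LIMSEQ_subseq_LIMSEQ[OF conv[unfolded dist_conv_def, rule_format, OF \<phi>] strict_mono_o[OF s r(1)]]
        by (simp add: o_def)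
      ultimately show "(\<integral>x. \<phi> x \<partial>P) = (\<integral>x. \<phi> x \<partial>N)" by (rule LIMSEQ_unique)
    qed
    then show ?thesis using r by blast
  qed
  have "subprob N" using sub[of id] by (auto simp: strict_mono_def)
  moreover have "vague_conv M N"
    unfolding vague_conv_def
  proof (intro allI impI)
    fix \<phi> :: "'b \<Rightarrow> real" and R assume \<phi>: "continuous_on UNIV \<phi>" "\<forall>x. norm x > R \<longrightarrow> \<phi> x = 0"
    show "(\<lambda>n. \<integral>x. \<phi> x \<partial>M n) \<longlonglongrightarrow> (\<integral>x. \<phi> x \<partial>N)"
    proof (rule LIMSEQ_by_subsequences)
      fix s :: "nat \<Rightarrow> nat" assume "strict_mono s"
      then obtain r where "strict_mono r" "vague_conv (M \<circ> s \<circ> r) N" using sub by blast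
      moreover from this(2) have "(\<lambda>n. \<integral>x. \<phi> x \<partial>(M \<circ> s \<circ> r) n) \<longlonglongrightarrow> (\<integral>x. \<phi> x \<partial>N)"
        using \<phi> unfolding vague_conv_def by blast
      ultimately show "\<exists>r. strict_mono r \<and> (\<lambda>n. \<integral>x. \<phi> x \<partial>M (s (r n))) \<longlonglongrightarrow> (\<integral>x. \<phi> x \<partial>N)"
        by (auto simp: o_def)
    qed
  qed
  ultimately show ?thesis by blast
qed

section \<open>Effect of one step of killed transport\<close>

text \<open>While the speed is at most \<open>V\<close>, the value of \<phi> along the trajectory
  changes at rate at most \<open>L * V\<close> and the killing factor at rate at most
  \<open>\<epsilon> * V\<close>. The past enters only through \<open>E a\<close>, which is at most
  1, so the trajectory may have been arbitrarily fast before \<open>a\<close>.\<close>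

lemma segment_estimate:
  fixes v :: "'b::euclidean_space \<Rightarrow> 'b" and \<phi> :: "'b \<Rightarrow> real"
  assumes y: "solves_until v x s y" and ab: "0 \<le> a" "a \<le> b" "b \<le> s"
    and vc: "continuous_on UNIV v" and V: "\<And>r. r \<in> {a..b} \<Longrightarrow> norm (v (y r)) \<le> V"
    and L: "L-lipschitz_on UNIV \<phi>" and M: "\<And>z. \<bar>\<phi> z\<bar> \<le> M" and \<epsilon>: "0 \<le> \<epsilon>"
  defines "E \<equiv> \<lambda>t. exp (- \<epsilon> * integral {0..t} (\<lambda>r. norm (v (y r))))"
  shows "\<bar>\<phi> (y b) * E b - \<phi> (y a) * E a\<bar> \<le> (L + \<epsilon> * M) * V * (b - a)"
proof -
  have yc: "continuous_on {0..s} y" by (rule solves_until_continuous[OF y])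
  have c: "continuous_on S (\<lambda>r. v (y r))" if "S \<subseteq> {0..s}" for S
    using that by (intro continuous_on_compose2[OF vc] continuous_on_subset[OF yc]) auto
  have V0: "0 \<le> V" using order_trans[OF norm_ge_zero V[of a]] ab by simp
  have M0: "0 \<le> M" using order_trans[OF abs_ge_zero M] .
  have L0: "0 \<le> L" using lipschitz_on_nonneg[OF L] .
  have i: "(\<lambda>r. norm (v (y r))) integrable_on {c..d}" if "0 \<le> c" "d \<le> s" for c d
    using that by (intro integrable_continuous_real continuous_intros c) auto
  have E01: "0 \<le> E t" "E t \<le> 1" if "t \<in> {0..s}" for t
  proof -
    have "0 \<le> integral {0..t} (\<lambda>r. norm (v (y r)))"
      using that by (intro integral_nonneg i) auto
    then show "E t \<le> 1" using \<epsilon> by (simp add: E_def)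
  qed (simp add: E_def)
  have "((\<lambda>r. v (y r)) has_integral (y b - y a)) {a..b}"
    using ab by (intro fundamental_theorem_of_calculus
        has_vector_derivative_within_subset[OF solves_untilD(2)[OF y]]) auto
  then have "y b - y a = integral {a..b} (\<lambda>r. v (y r))" by (simp add: integral_unique)
  also have "norm \<dots> \<le> V * (b - a)"
    using ab V by (intro integral_bound c) auto
  finally have dy: "norm (y b - y a) \<le> V * (b - a)" .
  have "\<bar>\<phi> (y b) - \<phi> (y a)\<bar> \<le> L * norm (y b - y a)"
    using lipschitz_onD[OF L, of "y b" "y a"] by (simp add: dist_norm)
  also have "\<dots> \<le> L * (V * (b - a))" using dy L0 by (rule mult_left_mono)
  finally have d1: "\<bar>\<phi> (y b) - \<phi> (y a)\<bar> \<le> L * (V * (b - a))" .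
  define I where "I = integral {a..b} (\<lambda>r. norm (v (y r)))"
  have I0: "0 \<le> I" unfolding I_def using ab by (intro integral_nonneg i) auto
  have I1: "I \<le> V * (b - a)"
  proof -
    have "norm I \<le> V * (b - a)"
      unfolding I_def using ab V by (intro integral_bound continuous_intros c) auto
    then show ?thesis using I0 by simp
  qed
  have "integral {0..b} (\<lambda>r. norm (v (y r))) = integral {0..a} (\<lambda>r. norm (v (y r))) + I"
    unfolding I_def using Henstock_Kurzweil_Integration.integral_combine[OF ab(1,2) i[of 0 b]] ab by simp
  then have Eb: "E b = E a * exp (- (\<epsilon> * I))"
    by (simp add: E_def algebra_simps flip: exp_add)
  have "\<bar>E b - E a\<bar> = E a * (1 - exp (- (\<epsilon> * I)))"
  proof -
    have "E a * exp (- (\<epsilon> * I)) \<le> E a * 1"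
      using E01(1)[of a] ab I0 \<epsilon> by (intro mult_left_mono) auto
    then show ?thesis unfolding Eb by (simp add: right_diff_distrib)
  qed
  also have "\<dots> \<le> 1 * (\<epsilon> * I)"
    using E01[of a] ab exp_ge_add_one_self[of "- (\<epsilon> * I)"] I0 \<epsilon> by (intro mult_mono) auto
  also have "\<dots> \<le> \<epsilon> * (V * (b - a))" using I1 \<epsilon> by (simp add: mult_left_mono)
  finally have d2: "\<bar>E b - E a\<bar> \<le> \<epsilon> * (V * (b - a))" .
  have "\<phi> (y b) * E b - \<phi> (y a) * E a = (\<phi> (y b) - \<phi> (y a)) * E b + \<phi> (y a) * (E b - E a)"
    by (simp add: algebra_simps)
  then have "\<bar>\<phi> (y b) * E b - \<phi> (y a) * E a\<bar> \<le> \<bar>\<phi> (y b) - \<phi> (y a)\<bar> * E b + \<bar>\<phi> (y a)\<bar> * \<bar>E b - E a\<bar>"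
    using E01(1)[of b] ab abs_triangle_ineq[of "(\<phi> (y b) - \<phi> (y a)) * E b" "\<phi> (y a) * (E b - E a)"]
    by (simp add: abs_mult)
  also have "\<dots> \<le> L * (V * (b - a)) * 1 + M * (\<epsilon> * (V * (b - a)))"
    using d1 d2 E01[of b] ab M V0 L0 M0 by (intro add_mono mult_mono) auto
  also have "\<dots> = (L + \<epsilon> * M) * V * (b - a)" by (simp add: algebra_simps)
  finally show ?thesis .
qed

context locally_lipschitz_field
begin

text \<open>Killed or exploding trajectories only lose mass: the weight is at most 1, and points
  whose lifetime has run out contribute nothing.\<close>

lemma transported_le:
  fixes \<psi> g :: "'b \<Rightarrow> real"
  assumes tr: "transported \<epsilon> v s \<mu> \<nu>" and s: "0 \<le> s" and \<epsilon>: "0 \<le> \<epsilon>"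
    and \<psi>: "continuous_on UNIV \<psi>" "bounded (range \<psi>)" "\<And>x. 0 \<le> \<psi> x"
    and g: "integrable \<mu> g" "\<And>x. 0 \<le> g x" "\<And>x. ereal s < lifetime v x \<Longrightarrow> \<psi> (flow v x s) \<le> g x"
  shows "(\<integral>x. \<psi> x \<partial>\<nu>) \<le> (\<integral>x. g x \<partial>\<mu>)"
proof -
  have "(\<integral>x. \<psi> x \<partial>\<nu>) = (LINT x:{x. ereal s < lifetime v x}|\<mu>.
           \<psi> (flow v x s) * exp (- \<epsilon> * integral {0..s} (\<lambda>r. norm (v (flow v x r)))))"
    using tr \<psi> by (simp add: transported_def)
  also have "\<dots> \<le> (\<integral>x. g x \<partial>\<mu>)"
    unfolding set_lebesgue_integral_def
  \<comment> \<open>Only the majorant has to be integrable; a non-integrable integrand on the left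
    has integral 0.\<close>
  proof (rule integral_mono'[OF g(1)])
    fix x
    have "0 \<le> integral {0..s} (\<lambda>r. norm (v (flow v x r)))"
      by (cases "(\<lambda>r. norm (v (flow v x r))) integrable_on {0..s}")
         (auto intro: integral_nonneg simp: not_integrable_integral)
    then have "exp (- \<epsilon> * integral {0..s} (\<lambda>r. norm (v (flow v x r)))) \<le> 1"
      using \<epsilon> by simp
    then have "\<psi> (flow v x s) * exp (- \<epsilon> * integral {0..s} (\<lambda>r. norm (v (flow v x r)))) \<le> \<psi> (flow v x s)"
      using \<psi>(3) by (intro mult_right_le_one_le) auto
    then show "indicator {x. ereal s < lifetime v x} x *\<^sub>R
        (\<psi> (flow v x s) * exp (- \<epsilon> * integral {0..s} (\<lambda>r. norm (v (flow v x r))))) \<le> g x"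
      using g(2,3)[of x] by (auto simp: indicator_def intro: order_trans)
  qed (use g in auto)
  finally show ?thesis .
qed

lemma transported_subprob:
  assumes "transported \<epsilon> v s \<mu> \<nu>" "0 \<le> s" "0 \<le> \<epsilon>" "subprob \<mu>" "finite_borel \<nu>"
  shows "subprob \<nu>"
proof -
  interpret \<mu>: finite_measure \<mu> using subprob_finite assms by blast
  interpret \<nu>: finite_measure \<nu> using assms by (auto simp: finite_borel_def)
  have sp: "space \<nu> = UNIV" using assms(5) sets_eq_imp_space_eq[of \<nu> borel] by (auto simp: finite_borel_def)
  have "(\<integral>x. (1::real) \<partial>\<nu>) \<le> (\<integral>x. 1 \<partial>\<mu>)"
    by (rule transported_le[OF assms(1-3)]) auto
  then have "measure \<nu> UNIV \<le> 1"
    using subprob_finite(3,4)[OF assms(4)] sp by simp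
  then show ?thesis
    using assms(5) by (auto simp: subprob_def finite_borel_def \<nu>.emeasure_eq_measure)
qed

text \<open>A surviving trajectory that ends outside \<open>S'\<close> started outside
  \<open>S\<close>. As \<open>transported\<close> speaks of continuous functions only, the open set
  \<open>- S'\<close> is approximated from inside.\<close>

lemma transported_closed:
  assumes tr: "transported \<epsilon> v s \<mu> \<nu>" and s: "0 \<le> s" "0 \<le> \<epsilon>" and \<mu>: "subprob \<mu>" and \<nu>: "finite_borel \<nu>"
    and S: "closed S" "closed S'" "S' \<noteq> {}"
    and inv: "\<And>x. x \<in> S \<Longrightarrow> ereal s < lifetime v x \<Longrightarrow> flow v x s \<in> S'"
  shows "measure \<nu> (- S') \<le> measure \<mu> (- S)"
proof -
  interpret \<mu>: finite_measure \<mu> using subprob_finite \<mu> by blast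
  obtain \<psi> :: "nat \<Rightarrow> 'b \<Rightarrow> real" where
    \<psi>: "\<And>j. continuous_on UNIV (\<psi> j)" "\<And>j x. 0 \<le> \<psi> j x \<and> \<psi> j x \<le> 1"
      "\<And>j x. x \<in> S' \<Longrightarrow> \<psi> j x = 0" "\<And>x. (\<lambda>j. \<psi> j x) \<longlonglongrightarrow> indicator (- S') x"
    using continuous_open_indicator[OF S(2,3)] by blast
  have mS: "- S \<in> sets \<mu>" using S(1) subprob_finite(2)[OF \<mu>] by auto
  have "(\<integral>x. \<psi> j x \<partial>\<nu>) \<le> (\<integral>x. indicator (- S) x \<partial>\<mu>)" for j
  proof (rule transported_le[OF tr s \<psi>(1)])
    show "bounded (range (\<psi> j))"
      using \<psi>(2)[of j] by (intro boundedI[of _ 1]) auto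
    show "integrable \<mu> (indicator (- S) :: 'b \<Rightarrow> real)"
      using mS by (intro integrable_real_indicator) (auto simp: less_top[symmetric])
    fix x assume "ereal s < lifetime v x"
    then show "\<psi> j (flow v x s) \<le> indicator (- S) x"
      using \<psi>(2)[of j "flow v x s"] \<psi>(3)[of "flow v x s" j] inv[of x] by (cases "x \<in> S") auto
  qed (use \<psi>(2) in auto)
  then have "(\<integral>x. \<psi> j x \<partial>\<nu>) \<le> measure \<mu> (- S)" for j
    using subprob_finite(3)[OF \<mu>] by simp
  then show ?thesis
    by (intro LIMSEQ_le_const2[OF open_measure_approx[OF \<nu> \<psi>(1,2,4)]]) (use S in auto)
qed

text \<open>Outside the ball of radius \<open>R\<close> the function \<phi> vanishes, and no speed
  bound is available. A trajectory that reaches radius \<open>R\<close> is therefore compared with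
  the value 0 twice: from the start to the first visit and from the last visit to the end. This is
  the origin of the factor 2.\<close>

lemma transport_pointwise:
  fixes \<phi> :: "'b \<Rightarrow> real"
  assumes s: "0 \<le> s" and \<epsilon>: "0 \<le> \<epsilon>" and L: "L-lipschitz_on UNIV \<phi>" and M: "\<And>z. \<bar>\<phi> z\<bar> \<le> M"
    and R: "\<And>z. norm z \<ge> R \<Longrightarrow> \<phi> z = 0" and V: "\<And>z. norm z \<le> R \<Longrightarrow> norm (v z) \<le> V" and V0: "0 \<le> V"
  shows "\<bar>indicator {x. ereal s < lifetime v x} x *
       (\<phi> (flow v x s) * exp (- \<epsilon> * integral {0..s} (\<lambda>r. norm (v (flow v x r))))) - \<phi> x\<bar>
     \<le> 2 * (L + \<epsilon> * M) * V * s"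
proof -
  define K where "K = (L + \<epsilon> * M) * V"
  have M0: "0 \<le> M" using order_trans[OF abs_ge_zero M] .
  have L0: "0 \<le> L" using lipschitz_on_nonneg[OF L] .
  have K0: "0 \<le> K" unfolding K_def using L0 M0 \<epsilon> V0 by simp
  define y where "y = flow v x"
  define E where "E t = exp (- \<epsilon> * integral {0..t} (\<lambda>r. norm (v (y r))))" for t
  have E0: "E 0 = 1" by (simp add: E_def)
  have seg: "\<bar>\<phi> (y b) * E b - \<phi> (y a) * E a\<bar> \<le> K * (b - a)"
    if "0 \<le> a" "a \<le> b" "ereal b < lifetime v x" "\<And>r. r \<in> {a..b} \<Longrightarrow> norm (y r) \<le> R" for a b
    unfolding K_def E_def
    by (rule segment_estimate[OF flow_solves[of b x, folded y_def] _ _ order_refl continuous _ L M \<epsilon>])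
       (use that V in auto)
  have y0: "y 0 = x" if "0 \<le> b" "ereal b < lifetime v x" for b
    using solves_untilD(1)[OF flow_solves[OF that]] by (simp add: y_def)
  have init: "\<bar>\<phi> x\<bar> \<le> K * s"
    if r: "r \<in> {0..s}" "ereal r < lifetime v x" "norm (y r) \<ge> R" for r
  proof (cases "norm x \<ge> R")
    case True
    then show ?thesis using R K0 s by simp
  next
    case False
    have yc: "continuous_on {0..r} (\<lambda>r. norm (y r))"
      using solves_until_continuous[OF flow_solves[of r x]] r by (auto simp: y_def intro: continuous_intros)
    obtain \<tau> where \<tau>: "\<tau> \<in> {0..r}" "norm (y \<tau>) = R" "\<And>q. q \<in> {0..\<tau>} \<Longrightarrow> norm (y q) \<le> R"
      by (rule first_hit[of 0 r "\<lambda>r. norm (y r)" R]) (use r yc False y0[of r] in auto)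
    have "ereal \<tau> < lifetime v x" using \<tau>(1) r(2) by (auto intro: le_less_trans[of _ "ereal r"])
    then have "\<bar>\<phi> (y \<tau>) * E \<tau> - \<phi> (y 0) * E 0\<bar> \<le> K * (\<tau> - 0)"
      using \<tau> by (intro seg) auto
    then have "\<bar>\<phi> x\<bar> \<le> K * \<tau>" using y0[of r] r R[of "y \<tau>"] \<tau>(2) E0 by simp
    also have "\<dots> \<le> K * s" using \<tau> r K0 by (intro mult_left_mono) auto
    finally show ?thesis .
  qed
  have "\<bar>indicator {x. ereal s < lifetime v x} x * (\<phi> (y s) * E s) - \<phi> x\<bar> \<le> 2 * (K * s)"
  proof (cases "ereal s < lifetime v x")
    case False
    \<comment> \<open>A trajectory that dies by time \<open>s\<close> has visited radius
      \<open>R\<close>, so the missing final value is 0 and the initial value is small.\<close>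
    obtain r where "r \<in> {0..s}" "ereal r < lifetime v x" "norm (y r) \<ge> R"
      using blow_up[OF s False, of R] unfolding y_def by blast
    from init[OF this] False K0 s show ?thesis by simp
  next
    case True
    note y0' = y0[OF s True]
    show ?thesis
    proof (cases "\<exists>r\<in>{0..s}. norm (y r) \<ge> R")
      case False
      then have "\<bar>\<phi> (y s) * E s - \<phi> (y 0) * E 0\<bar> \<le> K * (s - 0)"
        using s True by (intro seg) (auto simp: not_le less_imp_le)
      then show ?thesis using True y0' E0 K0 s by simp
    next
      case True': True
      then obtain r where r: "r \<in> {0..s}" "norm (y r) \<ge> R" by blast
      have rl: "ereal r < lifetime v x" using r(1) True by (auto intro: le_less_trans[of _ "ereal s"])
      have "\<bar>\<phi> (y s) * E s\<bar> \<le> K * s"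
      proof (cases "norm (y s) \<ge> R")
        case True
        then show ?thesis using R K0 s by simp
      next
        case False
        have yc: "continuous_on {r..s} (\<lambda>r. norm (y r))"
          using continuous_on_subset[OF solves_until_continuous[OF flow_solves[OF s True]], of "{r..s}"] r
          by (auto simp: y_def intro: continuous_intros)
        obtain \<tau> where \<tau>: "\<tau> \<in> {r..s}" "norm (y \<tau>) = R" "\<And>q. q \<in> {\<tau>..s} \<Longrightarrow> norm (y q) \<le> R"
          by (rule last_hit[of r s "\<lambda>r. norm (y r)" R]) (use r yc False in auto)
        have "\<bar>\<phi> (y s) * E s - \<phi> (y \<tau>) * E \<tau>\<bar> \<le> K * (s - \<tau>)"
          using \<tau> r True by (intro seg) auto
        then have "\<bar>\<phi> (y s) * E s\<bar> \<le> K * (s - \<tau>)" using R[of "y \<tau>"] \<tau>(2) by simp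
        also have "\<dots> \<le> K * s" using \<tau> r K0 by (intro mult_left_mono) auto
        finally show ?thesis .
      qed
      then show ?thesis using init[OF r(1) rl r(2)] True by simp
    qed
  qed
  then show ?thesis unfolding K_def y_def E_def by (simp only: mult.assoc)
qed

lemma transported_lipschitz:
  fixes \<phi> :: "'b \<Rightarrow> real"
  assumes tr: "transported \<epsilon> v s \<mu> \<nu>" and \<mu>: "subprob \<mu>"
    and s: "0 \<le> s" and \<epsilon>: "0 \<le> \<epsilon>" and L: "L-lipschitz_on UNIV \<phi>" and M: "\<And>z. \<bar>\<phi> z\<bar> \<le> M"
    and R: "\<And>z. norm z \<ge> R \<Longrightarrow> \<phi> z = 0" and V: "\<And>z. norm z \<le> R \<Longrightarrow> norm (v z) \<le> V" and V0: "0 \<le> V"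
  shows "\<bar>(\<integral>x. \<phi> x \<partial>\<nu>) - (\<integral>x. \<phi> x \<partial>\<mu>)\<bar> \<le> 2 * (L + \<epsilon> * M) * V * s"
proof -
  let ?w = "\<lambda>x. exp (- \<epsilon> * integral {0..s} (\<lambda>r. norm (v (flow v x r))))"
  let ?g = "\<lambda>x. indicator {x. ereal s < lifetime v x} x * (\<phi> (flow v x s) * ?w x)"
  have c: "continuous_on UNIV \<phi>" by (rule lipschitz_on_continuous_on[OF L])
  have b: "bounded (range \<phi>)" using M by (intro boundedI[of _ M]) auto
  have "(\<integral>x. \<phi> x \<partial>\<nu>) = (\<integral>x. ?g x \<partial>\<mu>)"
    using tr c b by (simp add: transported_def set_lebesgue_integral_def)
  moreover have i1: "integrable \<mu> \<phi>"
    using M by (intro subprob_integrable[OF \<mu> borel_measurable_continuous_onI[OF c], of M]) auto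
  moreover have "integrable \<mu> ?g"
  proof (rule subprob_integrable[OF \<mu> transport_measurable[OF s c, of \<epsilon>], where C="2 * (L + \<epsilon> * M) * V * s + M"])
    fix x
    show "norm (?g x) \<le> 2 * (L + \<epsilon> * M) * V * s + M"
      using transport_pointwise[where R=R and x=x, OF s \<epsilon> L M R V V0] M[of x]
      unfolding real_norm_def by linarith
  qed
  ultimately have "(\<integral>x. \<phi> x \<partial>\<nu>) - (\<integral>x. \<phi> x \<partial>\<mu>) = (\<integral>x. ?g x - \<phi> x \<partial>\<mu>)"
    by (simp add: Bochner_Integration.integral_diff)
  also have "norm \<dots> \<le> 2 * (L + \<epsilon> * M) * V * s"
    by (rule subprob_integral_bound[OF \<mu>])
       (use transport_pointwise[where R=R, OF s \<epsilon> L M R V V0] in simp)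
  finally show ?thesis by simp
qed

end

section \<open>Regularity of the Hamiltonian field\<close>

lemma C_k_1D:
  assumes "C_k 1 f"
  shows "(f has_derivative frechet_derivative f (at x)) (at x)"
    "continuous_on UNIV (\<lambda>x. frechet_derivative f (at x) h)"
  using assms C_k_SucD[of 0 f] by (auto simp: numeral_eq_Suc)

lemma linear_norm_le_Basis:
  fixes D :: "'b::euclidean_space \<Rightarrow> real"
  assumes "linear D"
  shows "\<bar>D h\<bar> \<le> (\<Sum>b\<in>Basis. \<bar>D b\<bar>) * norm h"
proof -
  have "D h = D (\<Sum>b\<in>Basis. (h \<bullet> b) *\<^sub>R b)" by (simp add: euclidean_representation)
  also have "\<dots> = (\<Sum>b\<in>Basis. (h \<bullet> b) * D b)"
    by (simp add: linear_sum[OF assms] linear_scale[OF assms])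
  also have "\<bar>\<dots>\<bar> \<le> (\<Sum>b\<in>Basis. \<bar>(h \<bullet> b) * D b\<bar>)" by (rule sum_abs)
  also have "\<dots> \<le> (\<Sum>b\<in>Basis. norm h * \<bar>D b\<bar>)"
    using Basis_le_norm by (intro sum_mono) (auto simp: abs_mult intro!: mult_right_mono)
  finally show ?thesis by (simp add: sum_distrib_left mult.commute)
qed

text \<open>\<open>C_k\<close> gives continuity of each directional derivative separately. Their
  absolute values summed over the basis dominate the operator norm and are bounded on the compact
  convex ball, where the mean value inequality applies.\<close>

lemma C_k_1_lipschitz:
  fixes f :: "'b::euclidean_space \<Rightarrow> real"
  assumes "C_k 1 f"
  shows "\<exists>L. L-lipschitz_on (cball 0 N) f"
proof -
  have cont: "continuous_on (cball 0 N) (\<lambda>x. \<Sum>b\<in>Basis. \<bar>frechet_derivative f (at x) b\<bar>)"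
    by (intro continuous_intros continuous_on_subset[OF C_k_1D(2)[OF assms]]) auto
  have "bounded ((\<lambda>x. \<Sum>b\<in>Basis. \<bar>frechet_derivative f (at x) b\<bar>) ` cball 0 N)"
    by (rule compact_imp_bounded[OF compact_continuous_image[OF cont]]) simp
  then obtain C where C: "\<forall>x\<in>cball 0 N. (\<Sum>b\<in>Basis. \<bar>frechet_derivative f (at x) b\<bar>) \<le> C"
    by (auto simp: bounded_iff)
  have "onorm (frechet_derivative f (at x)) \<le> max C 0" if "x \<in> cball 0 N" for x
  proof (rule onorm_le)
    fix h
    have "\<bar>frechet_derivative f (at x) h\<bar> \<le> (\<Sum>b\<in>Basis. \<bar>frechet_derivative f (at x) b\<bar>) * norm h"
      by (rule linear_norm_le_Basis[OF has_derivative_linear[OF C_k_1D(1)[OF assms]]])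
    also have "\<dots> \<le> max C 0 * norm h"
      using bspec[OF C that] by (intro mult_right_mono) auto
    finally show "norm (frechet_derivative f (at x) h) \<le> max C 0 * norm h" by simp
  qed
  then have "norm (f x - f y) \<le> max C 0 * norm (x - y)" if "x \<in> cball 0 N" "y \<in> cball 0 N" for x y
    using that
    by (intro differentiable_bound[of "cball 0 N" f "\<lambda>x. frechet_derivative f (at x)"])
       (auto intro: has_derivative_at_withinI[OF C_k_1D(1)[OF assms]])
  then show ?thesis
    by (intro exI[of _ "max C 0"] lipschitz_onI) (auto simp: dist_norm)
qed

text \<open>For one point inside and one outside, the segment between them meets the sphere, where
  \<open>g\<close> is already 0; the outer point can be replaced by this nearer one.\<close>

lemma lipschitz_extend_zero:
  fixes g :: "'b::euclidean_space \<Rightarrow> 'c::real_normed_vector"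
  assumes L: "L-lipschitz_on (cball 0 R) g" and zero: "\<And>x. norm x \<ge> R \<Longrightarrow> g x = 0"
  shows "L-lipschitz_on UNIV g"
proof -
  have L0: "L \<ge> 0" using lipschitz_on_nonneg[OF L] .
  have *: "dist (g x) (g y) \<le> L * dist x y" if x: "norm x < R" and y: "norm y \<ge> R" for x y
  proof -
    obtain \<tau> where \<tau>: "\<tau> \<in> {0..1}" "norm (x + \<tau> *\<^sub>R (y - x)) = R"
      by (rule first_hit[of 0 1 "\<lambda>t. norm (x + t *\<^sub>R (y - x))" R])
         (use x y in \<open>auto intro!: continuous_intros\<close>)
    let ?z = "x + \<tau> *\<^sub>R (y - x)"
    have "dist (g x) (g y) = dist (g x) (g ?z)" using zero y \<tau> by simp
    also have "\<dots> \<le> L * dist x ?z"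
      using x \<tau> by (intro lipschitz_onD[OF L]) auto
    also have "dist x ?z = \<tau> * dist x y"
      using \<tau> by (simp add: dist_norm norm_minus_commute)
    also have "L * (\<tau> * dist x y) \<le> L * dist x y"
      using \<tau> L0 by (intro mult_left_mono mult_left_le_one_le) auto
    finally show ?thesis .
  qed
  show ?thesis
  proof (rule lipschitz_onI[OF _ L0])
    fix x y :: 'b
    consider "norm x < R" "norm y < R" | "norm x < R" "norm y \<ge> R" | "norm x \<ge> R" "norm y < R"
      | "norm x \<ge> R" "norm y \<ge> R" by linarith
    then show "dist (g x) (g y) \<le> L * dist x y"
    proof cases
      case 1
      then show ?thesis by (intro lipschitz_onD[OF L]) auto
    next
      case 3
      then show ?thesis using *[of y x] by (simp add: dist_commute)
    qed (use * zero L0 in auto)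
  qed
qed

lemma grad_eqI: "GDERIV f x :> D \<Longrightarrow> grad f x = D"
  unfolding grad_def
proof (rule the_equality)
  fix g assume "GDERIV f x :> D" "GDERIV f x :> g"
  then have "(\<lambda>h. h \<bullet> g) = (\<lambda>h. h \<bullet> D)"
    unfolding gderiv_def by (rule has_derivative_unique[rotated])
  from fun_cong[OF this, of "g - D"] have "(g - D) \<bullet> (g - D) = 0"
    by (simp add: inner_diff_right)
  then show "g = D" by simp
qed

text \<open>Riesz representation: the linear form \<open>D\<close> is the inner product with the sum
  of \<open>D b *\<^sub>R b\<close> over the basis.\<close>

lemma grad_frechet:
  assumes "(f has_derivative D) (at x)"
  shows "GDERIV f x :> grad f x" "grad f x \<bullet> h = D h"
proof -
  have "D = (\<lambda>h. h \<bullet> (\<Sum>b\<in>Basis. D b *\<^sub>R b))"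
  proof
    fix h
    have lin: "linear D" using has_derivative_linear[OF assms] .
    have "D h = D (\<Sum>b\<in>Basis. (h \<bullet> b) *\<^sub>R b)" by (simp add: euclidean_representation)
    also have "\<dots> = (\<Sum>b\<in>Basis. (h \<bullet> b) * D b)"
      by (simp add: linear_sum[OF lin] linear_scale[OF lin])
    also have "\<dots> = h \<bullet> (\<Sum>b\<in>Basis. D b *\<^sub>R b)"
      by (simp add: inner_sum_right mult.commute)
    finally show "D h = h \<bullet> (\<Sum>b\<in>Basis. D b *\<^sub>R b)" .
  qed
  then have 1: "GDERIV f x :> (\<Sum>b\<in>Basis. D b *\<^sub>R b)"
    using assms by (simp add: gderiv_def)
  then show g: "GDERIV f x :> grad f x" using grad_eqI by metis
  then have "(\<lambda>h. h \<bullet> grad f x) = D"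
    using assms unfolding gderiv_def by (rule has_derivative_unique)
  then show "grad f x \<bullet> h = D h" by (metis inner_commute)
qed

lemma C_k_2D:
  assumes "C_k 2 f"
  shows "GDERIV f x :> grad f x" "C_k 1 (\<lambda>x. grad f x \<bullet> h)"
proof -
  have 2: "C_k (Suc 1) f" using assms by (simp add: numeral_2_eq_2)
  show "GDERIV f x :> grad f x" by (rule grad_frechet[OF C_k_SucD(1)[OF 2]])
  have "(\<lambda>x. grad f x \<bullet> h) = (\<lambda>x. frechet_derivative f (at x) h)"
    using grad_frechet(2)[OF C_k_SucD(1)[OF 2]] by blast
  then show "C_k 1 (\<lambda>x. grad f x \<bullet> h)" using C_k_SucD(2)[OF 2] by metis
qed

lemma grad_lipschitz:
  fixes f :: "'b::euclidean_space \<Rightarrow> real"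
  assumes "C_k 2 f"
  shows "\<exists>L. L-lipschitz_on (cball 0 N) (grad f)"
proof -
  have "\<forall>b. \<exists>L. L-lipschitz_on (cball 0 N) (\<lambda>x. grad f x \<bullet> b)"
    using C_k_1_lipschitz[OF C_k_2D(2)[OF assms]] by blast
  from choice[OF this] obtain L where L: "\<And>b. (L b)-lipschitz_on (cball 0 N) (\<lambda>x. grad f x \<bullet> b)"
    by blast
  show ?thesis
  proof (intro exI lipschitz_onI)
    fix x y :: 'b assume xy: "x \<in> cball 0 N" "y \<in> cball 0 N"
    have "dist (grad f x) (grad f y) \<le> (\<Sum>b\<in>Basis. \<bar>(grad f x - grad f y) \<bullet> b\<bar>)"
      unfolding dist_norm by (rule norm_le_l1)
    also have "\<dots> \<le> (\<Sum>b\<in>Basis. L b * dist x y)"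
      using lipschitz_onD[OF L xy] by (intro sum_mono) (auto simp: inner_diff_left dist_real_def)
    finally show "dist (grad f x) (grad f y) \<le> sum L Basis * dist x y"
      by (simp add: sum_distrib_right)
  qed (intro sum_nonneg lipschitz_on_nonneg[OF L])
qed

lemma grad_continuous:
  fixes f :: "'b::euclidean_space \<Rightarrow> real"
  assumes "C_k 2 f"
  shows "continuous_on UNIV (grad f)"
proof -
  have "continuous_on UNIV (\<lambda>x. \<Sum>b\<in>Basis. (grad f x \<bullet> b) *\<^sub>R b)"
    by (intro continuous_intros C_k_imp_continuous[OF C_k_2D(2)[OF assms]])
  then show ?thesis by (simp add: euclidean_representation)
qed

lemma zero_derivative_grad: "(f has_derivative (\<lambda>h. 0)) (at x) \<Longrightarrow> grad f x = 0"
  by (rule grad_eqI) (simp add: gderiv_def)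

section \<open>The mean-field force, with bounds uniform in the measure\<close>

text \<open>The gradient of \<open>conv W \<mu>\<close>, with the differentiation carried out under
  the integral.\<close>

definition force :: "('a::euclidean_space \<Rightarrow> real) \<Rightarrow> ('a \<times> 'a) measure \<Rightarrow> 'a \<Rightarrow> 'a" where
  "force W \<mu> q = (\<integral>y. grad W (q - snd y) \<partial>\<mu>)"

lemma norm_components_le: "norm (fst x) \<le> norm x" "norm (snd x) \<le> norm x"
  using dist_fst_le[of x 0] dist_snd_le[of x 0] by simp_all

locale interaction =
  fixes W \<Phi> :: "'a::euclidean_space \<Rightarrow> real" and B L R :: real
  assumes W_C2: "C_k 2 W" and Phi_C2: "C_k 2 \<Phi>"
    and W_bound: "\<bar>W q\<bar> \<le> B" and gradW_bound: "norm (grad W q) \<le> B"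
    and gradW_lipschitz: "L-lipschitz_on UNIV (grad W)"
    and gradW_zero: "R \<le> norm q \<Longrightarrow> grad W q = 0"
begin

lemma B_nonneg: "0 \<le> B" using order_trans[OF norm_ge_zero gradW_bound] .

lemma L_nonneg: "0 \<le> L" using lipschitz_on_nonneg[OF gradW_lipschitz] .

lemma W_continuous: "continuous_on UNIV W"
  using C_k_imp_continuous[OF W_C2] .

lemma gradW_integrable:
  assumes "subprob \<mu>"
  shows "integrable \<mu> (\<lambda>y. grad W (q - snd y))"
  by (rule subprob_integrable[OF assms borel_measurable_continuous_onI gradW_bound])
     (intro continuous_on_compose2[OF grad_continuous[OF W_C2]] continuous_intros, auto)

lemma W_integrable:
  assumes "subprob \<mu>"
  shows "integrable \<mu> (\<lambda>y. W (q - snd y))"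
  by (rule subprob_integrable[OF assms borel_measurable_continuous_onI, where C=B])
     (auto intro!: continuous_on_compose2[OF W_continuous] continuous_intros W_bound)

lemma force_bound: "subprob \<mu> \<Longrightarrow> norm (force W \<mu> q) \<le> B"
  unfolding force_def by (rule subprob_integral_bound[OF _ gradW_bound])

lemma force_lipschitz:
  assumes \<mu>: "subprob \<mu>"
  shows "L-lipschitz_on UNIV (force W \<mu>)"
proof (rule lipschitz_onI[OF _ L_nonneg])
  fix x y
  have "force W \<mu> x - force W \<mu> y = (\<integral>z. grad W (x - snd z) - grad W (y - snd z) \<partial>\<mu>)"
    unfolding force_def by (simp add: Bochner_Integration.integral_diff gradW_integrable[OF \<mu>])
  also have "norm \<dots> \<le> L * dist x y"
  proof (rule subprob_integral_bound[OF \<mu>])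
    show "norm (grad W (x - snd z) - grad W (y - snd z)) \<le> L * dist x y" for z
      using lipschitz_onD[OF gradW_lipschitz, of "x - snd z" "y - snd z"] by (simp add: dist_norm)
  qed
  finally show "dist (force W \<mu> x) (force W \<mu> y) \<le> L * dist x y" by (simp add: dist_norm)
qed

text \<open>The mean value inequality for the remainder on the ball of radius \<open>norm h\<close>,
  where its gradient is at most \<open>L * norm h\<close>. The bound is uniform in \<open>z\<close>,
  hence survives integration.\<close>

lemma W_taylor: "\<bar>W (z + h) - W z - h \<bullet> grad W z\<bar> \<le> L * norm h * norm h"
proof -
  define g where "g w = W (z + w) - w \<bullet> grad W z" for w
  have d: "(g has_derivative (\<lambda>k. k \<bullet> (grad W (z + w) - grad W z))) (at w)" for w
  proof -
    have 1: "((\<lambda>w. z + w) has_derivative (\<lambda>k. k)) (at w)"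
      by (rule has_derivative_eq_rhs[OF has_derivative_add[OF has_derivative_const has_derivative_ident]]) simp
    have "((\<lambda>w. W (z + w)) has_derivative (\<lambda>k. k \<bullet> grad W (z + w))) (at w)"
      using has_derivative_compose[OF 1 C_k_2D(1)[OF W_C2, unfolded gderiv_def]] by simp
    then show ?thesis
      unfolding g_def inner_diff_right by (intro has_derivative_diff bounded_linear.has_derivative[OF bounded_linear_inner_left has_derivative_ident])
  qed
  have "norm (g h - g 0) \<le> (L * norm h) * norm (h - 0)"
  proof (rule differentiable_bound[of "cball 0 (norm h)" g "\<lambda>w k. k \<bullet> (grad W (z + w) - grad W z)"])
    fix w :: 'a assume w: "w \<in> cball 0 (norm h)"
    show "(g has_derivative (\<lambda>k. k \<bullet> (grad W (z + w) - grad W z))) (at w within cball 0 (norm h))"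
      using d by (rule has_derivative_at_withinI)
    show "onorm (\<lambda>k. k \<bullet> (grad W (z + w) - grad W z)) \<le> L * norm h"
    proof (rule onorm_le)
      fix k :: 'a
      have "norm (grad W (z + w) - grad W z) \<le> L * norm w"
        using lipschitz_onD[OF gradW_lipschitz, of "z + w" z] by (simp add: dist_norm)
      also have "\<dots> \<le> L * norm h" using w L_nonneg by (intro mult_left_mono) auto
      finally have "norm k * norm (grad W (z + w) - grad W z) \<le> norm k * (L * norm h)"
        by (intro mult_left_mono) auto
      then show "norm (k \<bullet> (grad W (z + w) - grad W z)) \<le> L * norm h * norm k"
        using Cauchy_Schwarz_ineq2[of k "grad W (z + w) - grad W z"] by (simp add: mult_ac)
    qed
  qed auto
  then show ?thesis by (simp add: g_def algebra_simps)
qed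

lemma GDERIV_conv:
  assumes \<mu>: "subprob \<mu>"
  shows "GDERIV (conv W \<mu>) q :> force W \<mu> q"
  unfolding gderiv_def has_derivative_at_alt
proof (intro conjI allI impI)
  show "bounded_linear (\<lambda>h. h \<bullet> force W \<mu> q)" by (rule bounded_linear_inner_left)
  fix e :: real assume e: "0 < e"
  have est: "norm (conv W \<mu> y - conv W \<mu> q - (y - q) \<bullet> force W \<mu> q) \<le> L * norm (y - q) * norm (y - q)" for y
  proof -
    have i: "integrable \<mu> (\<lambda>z. (y - q) \<bullet> grad W (q - snd z))"
      by (rule integrable_inner_right[OF gradW_integrable[OF \<mu>]])
    have "conv W \<mu> y - conv W \<mu> q - (y - q) \<bullet> force W \<mu> q =
        (\<integral>z. W (y - snd z) - W (q - snd z) - (y - q) \<bullet> grad W (q - snd z) \<partial>\<mu>)"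
      unfolding conv_def force_def
      by (simp add: Bochner_Integration.integral_diff W_integrable[OF \<mu>] gradW_integrable[OF \<mu>] i)
    also have "norm \<dots> \<le> L * norm (y - q) * norm (y - q)"
    proof (rule subprob_integral_bound[OF \<mu>])
      show "norm (W (y - snd z) - W (q - snd z) - (y - q) \<bullet> grad W (q - snd z)) \<le> L * norm (y - q) * norm (y - q)" for z
        using W_taylor[of "q - snd z" "y - q"] by (simp add: algebra_simps)
    qed
    finally show ?thesis .
  qed
  show "\<exists>d>0. \<forall>y. norm (y - q) < d \<longrightarrow>
     norm (conv W \<mu> y - conv W \<mu> q - (y - q) \<bullet> force W \<mu> q) \<le> e * norm (y - q)"
  \<comment> \<open>The denominator \<open>L + 1\<close> keeps the quotient meaningful when
    \<open>L = 0\<close>.\<close>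
  proof (intro exI[of _ "e / (L + 1)"] conjI allI impI)
    show "0 < e / (L + 1)" using e L_nonneg by simp
    fix y assume y: "norm (y - q) < e / (L + 1)"
    have "L * norm (y - q) \<le> (L + 1) * norm (y - q)" by (intro mult_right_mono) auto
    also have "\<dots> \<le> e" using y L_nonneg by (simp add: field_simps)
    finally have "L * norm (y - q) * norm (y - q) \<le> e * norm (y - q)" by (intro mult_right_mono) auto
    then show "norm (conv W \<mu> y - conv W \<mu> q - (y - q) \<bullet> force W \<mu> q) \<le> e * norm (y - q)"
      using est[of y] by linarith
  qed
qed

lemma ham_field_eq:
  assumes "subprob \<mu>"
  shows "ham_field W \<Phi> \<mu> x = (- (force W \<mu> (snd x) + grad \<Phi> (snd x)), fst x)"
proof -
  have "grad (\<lambda>q. conv W \<mu> q + \<Phi> q) (snd x) = force W \<mu> (snd x) + grad \<Phi> (snd x)"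
    by (intro grad_eqI GDERIV_add GDERIV_conv assms C_k_2D(1) Phi_C2)
  then show ?thesis by (simp add: ham_field_def J_def gradW_H_def)
qed

lemma ham_field_locally_lipschitz:
  assumes \<mu>: "subprob \<mu>"
  shows "locally_lipschitz_field (ham_field W \<Phi> \<mu>)"
proof
  fix N
  obtain K where K: "K-lipschitz_on (cball 0 N) (grad \<Phi>)" using grad_lipschitz[OF Phi_C2] by blast
  have K0: "0 \<le> K" using lipschitz_on_nonneg[OF K] .
  show "\<exists>L. L-lipschitz_on (cball 0 N) (ham_field W \<Phi> \<mu>)"
  proof (intro exI lipschitz_onI)
    show "0 \<le> L + K + 1" using L_nonneg K0 by simp
    fix x y :: "'a \<times> 'a" assume xy: "x \<in> cball 0 N" "y \<in> cball 0 N"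
    have s: "dist (snd x) (snd y) \<le> dist x y" "dist (fst x) (fst y) \<le> dist x y"
      by (rule dist_snd_le, rule dist_fst_le)
    have "dist (ham_field W \<Phi> \<mu> x) (ham_field W \<Phi> \<mu> y) \<le>
        dist (force W \<mu> (snd x) + grad \<Phi> (snd x)) (force W \<mu> (snd y) + grad \<Phi> (snd y)) + dist (fst x) (fst y)"
      unfolding ham_field_eq[OF \<mu>] dist_Pair_Pair
      using sqrt_sum_squares_le_sum_abs by (metis abs_of_nonneg dist_minus zero_le_dist)
    also have "\<dots> \<le> dist (force W \<mu> (snd x)) (force W \<mu> (snd y)) + dist (grad \<Phi> (snd x)) (grad \<Phi> (snd y)) + dist (fst x) (fst y)"
      by (intro add_right_mono dist_triangle_add)
    also have "\<dots> \<le> L * dist (snd x) (snd y) + K * dist (snd x) (snd y) + dist (fst x) (fst y)"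
      using xy norm_components_le(2)[of x] norm_components_le(2)[of y]
      by (intro add_mono order_refl lipschitz_onD[OF force_lipschitz[OF \<mu>]] lipschitz_onD[OF K]) auto
    also have "\<dots> \<le> L * dist x y + K * dist x y + dist x y"
      using s L_nonneg K0 by (intro add_mono mult_left_mono) auto
    finally show "dist (ham_field W \<Phi> \<mu> x) (ham_field W \<Phi> \<mu> y) \<le> (L + K + 1) * dist x y"
      by (simp add: algebra_simps)
  qed
qed

text \<open>The bound is chosen before the measure: \<open>force_bound\<close> holds for all
  sub-probability measures alike. All later constants that are independent of \<epsilon> and of the
  step size rest on this.\<close>

lemma ham_field_bound:
  "\<exists>V\<ge>0. \<forall>\<mu> x. subprob \<mu> \<longrightarrow> norm x \<le> N \<longrightarrow> norm (ham_field W \<Phi> \<mu> x) \<le> V"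
proof -
  have "compact (grad \<Phi> ` cball 0 N)"
    by (intro compact_continuous_image continuous_on_subset[OF grad_continuous[OF Phi_C2]]) auto
  then obtain C where C: "\<And>q. q \<in> cball 0 N \<Longrightarrow> norm (grad \<Phi> q) \<le> C"
    using compact_imp_bounded bounded_iff by (metis imageI)
  have "norm (ham_field W \<Phi> \<mu> x) \<le> B + C + N" if \<mu>: "subprob \<mu>" and x: "norm x \<le> N" for \<mu> x
  proof -
    have "norm (ham_field W \<Phi> \<mu> x) \<le> norm (force W \<mu> (snd x) + grad \<Phi> (snd x)) + norm (fst x)"
      unfolding ham_field_eq[OF \<mu>] norm_Pair
      using sqrt_sum_squares_le_sum_abs by (metis abs_norm_cancel norm_minus_cancel)
    also have "\<dots> \<le> (B + C) + N"
    proof -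
      have "norm (grad \<Phi> (snd x)) \<le> C" using C[of "snd x"] x norm_components_le(2)[of x] by simp
      moreover have "norm (fst x) \<le> N" using x norm_components_le(1)[of x] by simp
      ultimately show ?thesis
        using norm_triangle_ineq[of "force W \<mu> (snd x)" "grad \<Phi> (snd x)"] force_bound[OF \<mu>, of "snd x"]
        by linarith
    qed
    finally show ?thesis .
  qed
  then show ?thesis
    by (intro exI[of _ "max 0 (B + C + N)"]) (auto intro: max.coboundedI2)
qed

end

section \<open>No return from the escape region\<close>

text \<open>Continuous induction: let \<open>t\<close> be the supremum of the times up to which
  \<open>P\<close> holds throughout. Closedness gives \<open>P t\<close>, and the step pushes beyond
  \<open>t\<close> unless \<open>t = b\<close>.\<close>

lemma interval_induct:
  fixes a b :: real
  assumes base: "P a" and closed: "closed {t\<in>{a..b}. P t}"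
    and step: "\<And>t. a \<le> t \<Longrightarrow> t < b \<Longrightarrow> P t \<Longrightarrow> \<exists>\<eta>>0. \<forall>\<tau>\<in>{t..t+\<eta>}. \<tau> \<le> b \<longrightarrow> P \<tau>"
    and c: "c \<in> {a..b}"
  shows "P c"
proof (rule ccontr)
  assume nc: "\<not> P c"
  define Z where "Z = {t\<in>{a..b}. \<forall>\<tau>\<in>{a..t}. P \<tau>}"
  have aZ: "a \<in> Z" using base c by (auto simp: Z_def)
  have bd: "bdd_above Z" by (auto simp: Z_def bdd_above_def)
  define t where "t = Sup Z"
  have at: "a \<le> t" unfolding t_def by (rule cSup_upper[OF aZ bd])
  have Zc: "z < c" if "z \<in> Z" for z
    using that nc c by (auto simp: Z_def not_le[symmetric])
  have tc: "t \<le> c" unfolding t_def using aZ Zc by (intro cSup_least) (auto intro: less_imp_le)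
  have below: "P \<tau>" if \<tau>: "a \<le> \<tau>" "\<tau> < t" for \<tau>
  proof -
    obtain z where "z \<in> Z" "\<tau> < z"
      using \<tau>(2) less_cSup_iff[of Z \<tau>] aZ bd unfolding t_def by blast
    then show ?thesis using \<tau>(1) by (auto simp: Z_def)
  qed
  have Pt: "P t"
  proof (cases "t = a")
    case False
    have "t \<in> closure {a..<t}" using at False by (simp add: closure_atLeastLessThan)
    also have "closure {a..<t} \<subseteq> {t\<in>{a..b}. P t}"
      using below tc c by (intro closure_minimal closed) auto
    finally show ?thesis by simp
  qed (simp add: base)
  have "t < b" using tc c Pt nc by (cases "t = c") auto
  then obtain \<eta> where \<eta>: "\<eta> > 0" "\<And>\<tau>. \<tau> \<in> {t..t+\<eta>} \<Longrightarrow> \<tau> \<le> b \<Longrightarrow> P \<tau>"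
    using step[OF at _ Pt] by blast
  define t' where "t' = min b (t + \<eta>)"
  have "t' \<in> Z"
    unfolding Z_def
  proof (intro CollectI conjI ballI)
    show "t' \<in> {a..b}" using at \<open>t < b\<close> \<eta> by (auto simp: t'_def)
    fix \<tau> assume "\<tau> \<in> {a..t'}"
    then show "P \<tau>" using below[of \<tau>] \<eta>(2)[of \<tau>] by (cases "\<tau> < t") (auto simp: t'_def)
  qed
  then have "t' \<le> t" unfolding t_def using bd by (rule cSup_upper)
  then show False using \<open>t < b\<close> \<eta>(1) by (auto simp: t'_def)
qed

lemma right_neighbourhood_pos:
  fixes f :: "real \<Rightarrow> real"
  assumes "continuous_on {a..b} f" "t \<in> {a..<b}" "f t > 0"
  shows "\<exists>\<eta>>0. \<forall>\<tau>\<in>{t..t+\<eta>}. \<tau> \<le> b \<longrightarrow> f \<tau> > 0"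
proof -
  obtain d where d: "d > 0" "\<And>x. x \<in> {a..b} \<Longrightarrow> dist x t < d \<Longrightarrow> dist (f x) (f t) < f t"
    using assms unfolding continuous_on_iff by (metis atLeastAtMost_iff atLeastLessThan_iff less_imp_le)
  show ?thesis
  proof (intro exI[of _ "d/2"] conjI ballI impI)
    fix \<tau> assume "\<tau> \<in> {t..t+d/2}" "\<tau> \<le> b"
    then have "dist (f \<tau>) (f t) < f t"
      using d assms(2) by (intro d(2)) (auto simp: dist_real_def)
    then show "f \<tau> > 0" by (auto simp: dist_real_def)
  qed (use d in auto)
qed

section \<open>Radial dynamics at a sphere of the dynamical hypothesis\<close>

text \<open>One radius \<open>norm (qs L)\<close> is fixed as \<open>r\<^sub>0\<close>, and the
  conditions on vectors become conditions on radii. The bound \<open>B\<^sub>1\<close> records that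
  \<open>norm (grad W)\<close> stays below \<open>B\<close> by a fixed margin, which integration
  against a measure preserves.\<close>

locale barrier = interaction +
  fixes u :: "real \<Rightarrow> real" and B\<^sub>1 r\<^sub>0 :: real
  assumes u_deriv: "DERIV u r :> deriv u r"
    and gradW_strict: "norm (grad W q) \<le> B\<^sub>1" "B\<^sub>1 < B"
    and u_radial: "q \<noteq> 0 \<Longrightarrow> B + grad \<Phi> q \<bullet> sgn q \<le> deriv u (norm q)"
    and r0_pos: "0 < r\<^sub>0" and u_below: "r\<^sub>0 < r \<Longrightarrow> u r < u r\<^sub>0"
begin

text \<open>A particle in the escape region moves outwards and has enough radial energy
  \<open>\<rho>\<^sup>2 / 2 + u r\<close>, where \<open>\<rho> = p \<bullet> q / r\<close>, never to return to the ball of radius \<open>r\<^sub>0\<close>.\<close>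

definition escape :: "('a \<times> 'a) set" where
  "escape = {x. r\<^sub>0 \<le> norm (snd x) \<and> 0 \<le> fst x \<bullet> snd x \<and>
     2 * (u r\<^sub>0 - u (norm (snd x))) * (norm (snd x))\<^sup>2 \<le> (fst x \<bullet> snd x)\<^sup>2}"

lemma u_continuous: "continuous_on S u"
  using u_deriv by (intro DERIV_continuous_on) (auto intro: has_field_derivative_at_within)

lemma closed_escape: "closed escape"
  unfolding escape_def
  by (intro closed_Collect_conj closed_Collect_le continuous_intros continuous_on_compose2[OF u_continuous[of UNIV]]) auto

text \<open>The definition of \<open>escape\<close> is the energy inequality multiplied by twice the
  squared radius, which avoids the discontinuity of \<open>sgn\<close> at 0 and makes closedness
  immediate. On and outside the sphere the two forms agree.\<close>

lemma escape_iff: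
  assumes "r\<^sub>0 \<le> norm (snd x)"
  shows "x \<in> escape \<longleftrightarrow> 0 \<le> fst x \<bullet> sgn (snd x) \<and>
    u r\<^sub>0 \<le> (fst x \<bullet> sgn (snd x))\<^sup>2 / 2 + u (norm (snd x))"
proof -
  have pos: "norm (snd x) > 0" using assms r0_pos by linarith
  have eq: "fst x \<bullet> sgn (snd x) = (fst x \<bullet> snd x) / norm (snd x)"
    by (simp add: sgn_div_norm divide_inverse mult.commute)
  show ?thesis
    using assms pos unfolding escape_def eq
    by (simp add: power_divide field_simps)
qed

lemma force_strict: "subprob \<mu> \<Longrightarrow> norm (force W \<mu> q) \<le> B\<^sub>1"
  unfolding force_def by (rule subprob_integral_bound[OF _ gradW_strict(1)])

text \<open>A positive derivative would make \<open>u\<close> exceed \<open>u r\<^sub>0\<close> just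
  outside the sphere. The sign provides outward acceleration for a particle that is radially at rest
  on the sphere.\<close>

lemma deriv_u_r0: "deriv u r\<^sub>0 \<le> 0"
proof (rule ccontr)
  assume "\<not> deriv u r\<^sub>0 \<le> 0"
  then obtain d where d: "d > 0" "\<And>h. h > 0 \<Longrightarrow> h < d \<Longrightarrow> u r\<^sub>0 < u (r\<^sub>0 + h)"
    using DERIV_pos_inc_right[OF u_deriv, of r\<^sub>0] by auto
  have "u r\<^sub>0 < u (r\<^sub>0 + d/2)" by (rule d(2)) (use d(1) in auto)
  moreover have "u (r\<^sub>0 + d/2) < u r\<^sub>0" by (rule u_below) (use d(1) in simp)
  ultimately show False by simp
qed

context
  fixes \<mu> :: "('a \<times> 'a) measure" and x :: "'a \<times> 'a" and s :: real and y :: "real \<Rightarrow> 'a \<times> 'a"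
  assumes \<mu>: "subprob \<mu>" and y: "solves_until (ham_field W \<Phi> \<mu>) x s y"
begin

abbreviation (input) "p t \<equiv> fst (y t)"
abbreviation (input) "q t \<equiv> snd (y t)"

lemma p_deriv: "t \<in> {0..s} \<Longrightarrow>
    (p has_vector_derivative - (force W \<mu> (q t) + grad \<Phi> (q t))) (at t within {0..s})"
  using bounded_linear.has_vector_derivative[OF bounded_linear_fst solves_untilD(2)[OF y]]
  by (simp add: ham_field_eq[OF \<mu>])

lemma q_deriv: "t \<in> {0..s} \<Longrightarrow> (q has_vector_derivative p t) (at t within {0..s})"
  using bounded_linear.has_vector_derivative[OF bounded_linear_snd solves_untilD(2)[OF y]]
  by (simp add: ham_field_eq[OF \<mu>])

lemma y_continuous: "S \<subseteq> {0..s} \<Longrightarrow> continuous_on S y"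
  using solves_until_continuous[OF y] by (rule continuous_on_subset)

definition rad :: "real \<Rightarrow> real" where "rad t = norm (q t)"
definition vel :: "real \<Rightarrow> real" where "vel t = p t \<bullet> sgn (q t)"

lemma rad_deriv:
  assumes "t \<in> {0..s}" "0 < rad t"
  shows "(rad has_real_derivative vel t) (at t within {0..s})"
proof -
  have "(norm has_derivative (\<lambda>h. h \<bullet> sgn (q t))) (at (q t))"
    using assms by (intro has_derivative_norm) (auto simp: rad_def)
  from has_derivative_compose[OF q_deriv[OF assms(1), unfolded has_vector_derivative_def] this]
  show ?thesis
    unfolding rad_def[abs_def] vel_def has_field_derivative_def by (simp add: mult.commute[of _ "p t \<bullet> sgn (q t)"])
qed

text \<open>The derivative of the radial velocity is the radial force plus the centrifugal term,
  (|p|^2 - \<rho>^2) / r, which is nonnegative by Cauchy-Schwarz. The interaction contributes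
  strictly more than \<open>- B\<close>, whence the strict inequality.\<close>

lemma vel_deriv:
  assumes "t \<in> {0..s}" "0 < rad t"
  shows "\<exists>l. (vel has_real_derivative l) (at t within {0..s}) \<and> - deriv u (rad t) < l"
proof -
  let ?F = "- (force W \<mu> (q t) + grad \<Phi> (q t))"
  have pq: "((\<lambda>t. p t \<bullet> q t) has_real_derivative p t \<bullet> p t + ?F \<bullet> q t) (at t within {0..s})"
  proof -
    have "((\<lambda>t. p t \<bullet> q t) has_derivative (\<lambda>h. p t \<bullet> (h *\<^sub>R p t) + (h *\<^sub>R ?F) \<bullet> q t)) (at t within {0..s})"
      by (rule has_derivative_inner[OF p_deriv[OF assms(1), unfolded has_vector_derivative_def]
            q_deriv[OF assms(1), unfolded has_vector_derivative_def]])
    then show ?thesis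
      unfolding has_field_derivative_def by (rule has_derivative_eq_rhs) (auto simp: fun_eq_iff algebra_simps)
  qed
  define l where "l = ((p t \<bullet> p t + ?F \<bullet> q t) * rad t - (p t \<bullet> q t) * vel t) / (rad t * rad t)"
  have "((\<lambda>t. (p t \<bullet> q t) / rad t) has_real_derivative l) (at t within {0..s})"
    unfolding l_def using assms by (intro DERIV_divide pq rad_deriv) auto
  then have 1: "(vel has_real_derivative l) (at t within {0..s})"
    by (simp add: vel_def[abs_def] rad_def sgn_div_norm divide_inverse mult.commute)
  have qv: "p t \<bullet> q t = vel t * rad t"
    using assms(2) by (simp add: vel_def rad_def sgn_div_norm)
  have qs: "q t = rad t *\<^sub>R sgn (q t)"
    using assms(2) by (simp add: rad_def sgn_div_norm)
  have "l = ?F \<bullet> sgn (q t) + ((p t \<bullet> p t) - (vel t)\<^sup>2) / rad t"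
  proof -
    have "?F \<bullet> q t = rad t * (?F \<bullet> sgn (q t))" by (subst qs) simp
    then show ?thesis using assms(2) unfolding l_def qv by (simp add: field_simps power2_eq_square)
  qed
  moreover have "(vel t)\<^sup>2 \<le> p t \<bullet> p t"
  proof -
    have "norm (sgn (q t)) = 1" using assms(2) by (auto simp: norm_sgn rad_def)
    then have "\<bar>vel t\<bar> \<le> norm (p t)"
      using Cauchy_Schwarz_ineq2[of "p t" "sgn (q t)"] by (simp add: vel_def)
    then show ?thesis
      by (metis abs_le_square_iff abs_norm_cancel power2_norm_eq_inner)
  qed
  moreover have "- deriv u (rad t) < ?F \<bullet> sgn (q t)"
  proof -
    have q0: "q t \<noteq> 0" using assms(2) by (auto simp: rad_def)
    have "force W \<mu> (q t) \<bullet> sgn (q t) \<le> norm (force W \<mu> (q t)) * norm (sgn (q t))"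
      by (rule norm_cauchy_schwarz)
    also have "\<dots> < B" using force_strict[OF \<mu>, of "q t"] gradW_strict(2) q0 by (simp add: norm_sgn)
    finally have "force W \<mu> (q t) \<bullet> sgn (q t) < B" .
    then show ?thesis using u_radial[OF q0] by (simp add: inner_add_left inner_diff_left rad_def)
  qed
  ultimately have "- deriv u (rad t) < l"
    using assms(2) by (smt (verit) divide_nonneg_pos)
  then show ?thesis using 1 by blast
qed

text \<open>Once the radial velocity is known to be positive on a short interval after
  \<open>t\<close>, both the radius and the radial energy are nondecreasing there, so all three
  conditions of \<open>escape\<close> persist.\<close>

lemma escape_step:
  assumes t: "0 \<le> t" "t < s" and G: "y t \<in> escape"
  shows "\<exists>\<eta>>0. \<forall>\<tau>\<in>{t..t+\<eta>}. \<tau> \<le> s \<longrightarrow> y \<tau> \<in> escape"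
proof -
  have r: "r\<^sub>0 \<le> rad t" using G by (simp add: escape_def rad_def)
  then have rp: "0 < rad t" using r0_pos by linarith
  have v0: "0 \<le> vel t" and e0: "u r\<^sub>0 \<le> (vel t)\<^sup>2 / 2 + u (rad t)"
    using G escape_iff[of "y t"] r by (auto simp: rad_def vel_def)
  have radc: "continuous_on {0..s} rad"
    unfolding rad_def by (intro continuous_intros y_continuous) auto
  obtain \<eta>1 where \<eta>1: "\<eta>1 > 0" "\<And>\<tau>. \<tau> \<in> {t..t+\<eta>1} \<Longrightarrow> \<tau> \<le> s \<Longrightarrow> rad \<tau> > 0"
    using right_neighbourhood_pos[OF radc, of t] t rp by auto
  define s' where "s' = min s (t + \<eta>1)"
  have s': "t < s'" "s' \<le> s" "\<And>\<tau>. \<tau> \<in> {t..s'} \<Longrightarrow> rad \<tau> > 0"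
    using t \<eta>1 by (auto simp: s'_def)
  have velc: "continuous_on {t..s'} vel"
  proof -
    have nz: "\<forall>\<tau>\<in>{t..s'}. rad \<tau> \<noteq> 0" using s'(3) by (metis less_irrefl)
    have "continuous_on {t..s'} (\<lambda>\<tau>. (p \<tau> \<bullet> q \<tau>) / rad \<tau>)"
      using s' t by (intro continuous_on_divide nz continuous_intros y_continuous continuous_on_subset[OF radc]) auto
    then show ?thesis by (simp add: vel_def[abs_def] rad_def sgn_div_norm divide_inverse mult.commute)
  qed
  have "\<exists>\<eta>>0. \<forall>\<tau>\<in>{t<..t+\<eta>}. \<tau> \<le> s' \<longrightarrow> vel \<tau> > 0"
  proof (cases "vel t > 0")
    case True
    then show ?thesis
      using right_neighbourhood_pos[OF velc, of t] s' by fastforce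
  next
    case False
    \<comment> \<open>With zero radial velocity the energy is just \<open>u (rad t)\<close>. Outside
      the sphere this is below \<open>u r\<^sub>0\<close>, so the particle is on the sphere, where
      its radial acceleration is strictly positive.\<close>
    then have vt: "vel t = 0" using v0 by simp
    then have "u r\<^sub>0 \<le> u (rad t)" using e0 by simp
    then have rt: "rad t = r\<^sub>0" using r u_below[of "rad t"] by (cases "r\<^sub>0 < rad t") auto
    obtain l where l: "(vel has_real_derivative l) (at t within {0..s})" "- deriv u (rad t) < l"
      using vel_deriv[of t] t rp by auto
    then have "0 < l" using deriv_u_r0 rt by simp
    then obtain d where d: "d > 0" "\<And>h. 0 < h \<Longrightarrow> t + h \<in> {0..s} \<Longrightarrow> h < d \<Longrightarrow> vel t < vel (t + h)"
      using has_real_derivative_pos_inc_right[OF l(1)] by blast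
    show ?thesis
    proof (intro exI[of _ "d/2"] conjI ballI impI)
      fix \<tau> assume "\<tau> \<in> {t<..t + d/2}" "\<tau> \<le> s'"
      then show "vel \<tau> > 0" using d(2)[of "\<tau> - t"] vt t s' d(1) by auto
    qed (use d in auto)
  qed
  then obtain \<eta>2 where \<eta>2: "\<eta>2 > 0" "\<And>\<tau>. \<tau> \<in> {t<..t+\<eta>2} \<Longrightarrow> \<tau> \<le> s' \<Longrightarrow> vel \<tau> > 0" by blast
  show ?thesis
  proof (intro exI[of _ "min \<eta>1 \<eta>2"] conjI ballI impI)
    fix \<tau> assume \<tau>: "\<tau> \<in> {t..t + min \<eta>1 \<eta>2}" "\<tau> \<le> s"
    have \<tau>s': "\<tau> \<le> s'" using \<tau> by (auto simp: s'_def)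
    have at: "at \<sigma> within {0..s} = at \<sigma>" if "t < \<sigma>" "\<sigma> < \<tau>" for \<sigma>
      using that t \<tau> by (intro at_within_Icc_at) auto
    have rad_mono: "rad t \<le> rad \<sigma>" if \<sigma>: "\<sigma> \<in> {t..\<tau>}" for \<sigma>
    proof (rule DERIV_nonneg_imp_increasing_open[where f=rad])
      show "t \<le> \<sigma>" using \<sigma> by simp
      show "continuous_on {t..\<sigma>} rad" using t \<tau> \<sigma> by (intro continuous_on_subset[OF radc]) auto
      fix w assume w: "t < w" "w < \<sigma>"
      then have "DERIV rad w :> vel w"
        using rad_deriv[of w] at[of w] t \<tau> \<sigma> s'(3)[of w] \<tau>s' by auto
      then show "\<exists>l. DERIV rad w :> l \<and> 0 \<le> l"
        using \<eta>2(2)[of w] w \<tau> \<tau>s' \<sigma> by (auto intro!: exI[of _ "vel w"] less_imp_le)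
    qed
    define E where "E w = (vel w)\<^sup>2 / 2 + u (rad w)" for w
    have "E t \<le> E \<tau>"
    proof (rule DERIV_nonneg_imp_increasing_open[where f=E])
      show "t \<le> \<tau>" using \<tau> by simp
      show "continuous_on {t..\<tau>} E"
        unfolding E_def using t \<tau> \<tau>s'
        by (intro continuous_intros continuous_on_subset[OF velc] continuous_on_compose2[OF u_continuous[of UNIV]]
            continuous_on_subset[OF radc]) auto
      fix w assume w: "t < w" "w < \<tau>"
      have wp: "0 < rad w" "w \<in> {0..s}" using s'(3)[of w] w \<tau>s' t \<tau> by auto
      obtain l where l: "DERIV vel w :> l" "- deriv u (rad w) < l"
        using vel_deriv[OF wp(2,1)] at[of w] w by auto
      have dr: "DERIV rad w :> vel w" using rad_deriv[OF wp(2,1)] at[of w] w by auto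
      have "DERIV E w :> vel w * (l + deriv u (rad w))"
        unfolding E_def using l(1) dr
        by (auto intro!: derivative_eq_intros DERIV_chain2[OF u_deriv] simp: algebra_simps)
      moreover have "0 \<le> vel w * (l + deriv u (rad w))"
        using \<eta>2(2)[of w] w \<tau> \<tau>s' l(2)
        by (intro mult_nonneg_nonneg) (auto simp: min_def split: if_splits)
      ultimately show "\<exists>l. DERIV E w :> l \<and> 0 \<le> l" by blast
    qed
    moreover have "0 \<le> vel \<tau>"
      using \<eta>2(2)[of \<tau>] \<tau> \<tau>s' v0 by (cases "\<tau> = t") (auto intro: less_imp_le)
    moreover have "r\<^sub>0 \<le> rad \<tau>" using rad_mono[of \<tau>] r \<tau> by auto
    ultimately show "y \<tau> \<in> escape"
      using escape_iff[of "y \<tau>"] e0 by (auto simp: rad_def vel_def E_def)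
  qed (use \<eta>1 \<eta>2 in auto)
qed

lemma escape_invariant:
  assumes "0 \<le> a" "y a \<in> escape" "t \<in> {a..s}"
  shows "y t \<in> escape"
proof (rule interval_induct[where P="\<lambda>t. y t \<in> escape" and a=a and b=s])
  have "closed ({a..s} \<inter> y -` escape)"
    using assms by (intro continuous_closed_preimage y_continuous closed_escape) auto
  moreover have "{t \<in> {a..s}. y t \<in> escape} = {a..s} \<inter> y -` escape" by blast
  ultimately show "closed {t \<in> {a..s}. y t \<in> escape}" by simp
qed (use assms escape_step in auto)

text \<open>At the last visit to the sphere the radial velocity cannot be negative, as the radius
  does not fall below \<open>r\<^sub>0\<close> afterwards. On the sphere the energy condition of
  \<open>escape\<close> is automatic, so this moment lies in \<open>escape\<close>.\<close>

lemma leave_ball: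
  assumes "a \<in> {0..s}" "rad 0 \<le> r\<^sub>0" "r\<^sub>0 < rad a"
  obtains \<tau> where "\<tau> \<in> {0..a}" "y \<tau> \<in> escape"
proof -
  have radc: "continuous_on {0..a} (\<lambda>t. - rad t)"
    unfolding rad_def using assms(1) by (intro continuous_intros y_continuous) auto
  \<comment> \<open>The sign is reversed because \<open>last_hit\<close> treats functions that come
    down to a level and stay below it.\<close>
  obtain \<tau> where \<tau>: "\<tau> \<in> {0..a}" "- rad \<tau> = - r\<^sub>0" "\<And>r. r \<in> {\<tau>..a} \<Longrightarrow> - rad r \<le> - r\<^sub>0"
    by (rule last_hit[of 0 a "\<lambda>t. - rad t" "- r\<^sub>0"]) (use radc assms in auto)
  have ta: "\<tau> < a" using \<tau> assms(3) by (cases "\<tau> = a") auto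
  have "0 \<le> vel \<tau>"
  proof (rule ccontr)
    assume "\<not> 0 \<le> vel \<tau>"
    moreover have "(rad has_real_derivative vel \<tau>) (at \<tau> within {0..s})"
      using \<tau> assms r0_pos by (intro rad_deriv) auto
    ultimately obtain d where d: "d > 0" "\<And>h. 0 < h \<Longrightarrow> \<tau> + h \<in> {0..s} \<Longrightarrow> h < d \<Longrightarrow> rad (\<tau> + h) < rad \<tau>"
      using has_real_derivative_neg_dec_right[of rad "vel \<tau>" \<tau> "{0..s}"] by (auto simp: not_le)
    define h where "h = min (d/2) (a - \<tau>)"
    have "0 < h" "h < d" "\<tau> + h \<in> {\<tau>..a}" using d ta by (auto simp: h_def)
    then show False using d(2)[of h] \<tau>(1,2) \<tau>(3)[of "\<tau> + h"] assms(1) by auto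
  qed
  then have "y \<tau> \<in> escape"
    using escape_iff[of "y \<tau>"] \<tau>(2) by (auto simp: rad_def vel_def)
  then show thesis using that \<tau>(1) by blast
qed

lemma momentum_bound:
  assumes t: "t \<in> {0..s}" and ball: "\<And>r. r \<in> {0..t} \<Longrightarrow> rad r \<le> r\<^sub>0"
    and C: "\<And>q. norm q \<le> r\<^sub>0 \<Longrightarrow> norm (grad \<Phi> q) \<le> C"
  shows "norm (p t) \<le> norm (p 0) + (B + C) * t"
proof -
  have "((\<lambda>r. - (force W \<mu> (q r) + grad \<Phi> (q r))) has_integral (p t - p 0)) {0..t}"
    using t by (intro fundamental_theorem_of_calculus has_vector_derivative_within_subset[OF p_deriv]) auto
  moreover have "norm (- (force W \<mu> (q r) + grad \<Phi> (q r))) \<le> B + C" if r: "r \<in> {0..t}" for r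
  proof -
    have "norm (grad \<Phi> (q r)) \<le> C" using C ball[OF r] by (simp add: rad_def)
    then show ?thesis
    using norm_triangle_ineq[of "force W \<mu> (q r)" "grad \<Phi> (q r)"] force_bound[OF \<mu>, of "q r"]
      unfolding norm_minus_cancel by linarith
  qed
  moreover have "0 \<le> B + C" using B_nonneg order_trans[OF norm_ge_zero C[of 0]] r0_pos by simp
  ultimately have "norm (p t - p 0) \<le> (B + C) * measure lborel {0..t}"
    by (intro has_integral_bound_real[where f="\<lambda>r. - (force W \<mu> (q r) + grad \<Phi> (q r))"]) auto
  then have "norm (p t - p 0) \<le> (B + C) * t" using t by simp
  then show ?thesis using norm_triangle_sub[of "p t" "p 0"] by linarith
qed

end

text \<open>Nothing here depends on the measure behind the field, so the set can be propagated
  through steps with different fields; only \<open>P\<close> has to grow.\<close>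

definition confined :: "real \<Rightarrow> ('a \<times> 'a) set" where
  "confined P = {x. norm (snd x) \<le> r\<^sub>0 \<and> norm (fst x) \<le> P} \<union> escape"

lemma closed_confined: "closed (confined P)"
  unfolding confined_def
  by (intro closed_Un closed_escape closed_Collect_conj closed_Collect_le continuous_intros)

lemma confined_ne: "0 \<le> P \<Longrightarrow> confined P \<noteq> {}"
  using r0_pos by (auto simp: confined_def intro!: exI[of _ 0])

text \<open>Three cases: a particle in \<open>escape\<close> remains there; a particle that leaves
  the ball passes through \<open>escape\<close> and remains there; a particle that stays in the ball
  gains momentum at rate at most \<open>B + C\<close>.\<close>

lemma confined_flow:
  assumes \<mu>: "subprob \<mu>" and C: "\<And>q. norm q \<le> r\<^sub>0 \<Longrightarrow> norm (grad \<Phi> q) \<le> C"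
    and x: "x \<in> confined P" and s: "0 \<le> s" "ereal s < lifetime (ham_field W \<Phi> \<mu>) x"
  shows "flow (ham_field W \<Phi> \<mu>) x s \<in> confined (P + (B + C) * s)"
proof -
  interpret locally_lipschitz_field "ham_field W \<Phi> \<mu>" by (rule ham_field_locally_lipschitz[OF \<mu>])
  let ?y = "flow (ham_field W \<Phi> \<mu>) x"
  have y: "solves_until (ham_field W \<Phi> \<mu>) x s ?y" by (rule flow_solves[OF s])
  have y0: "?y 0 = x" by (rule solves_untilD(1)[OF y])
  show ?thesis
  proof (cases "x \<in> escape")
    case True
    then have "?y s \<in> escape" using escape_invariant[OF \<mu> y order_refl] y0 s(1) by simp
    then show ?thesis by (simp add: confined_def)
  next
    case False
    then have x': "norm (snd x) \<le> r\<^sub>0" "norm (fst x) \<le> P" using x by (auto simp: confined_def)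
    show ?thesis
    proof (cases "\<exists>a\<in>{0..s}. r\<^sub>0 < norm (snd (?y a))")
      case True
      then obtain a where a: "a \<in> {0..s}" "r\<^sub>0 < norm (snd (?y a))" by blast
      obtain \<tau> where "\<tau> \<in> {0..a}" "?y \<tau> \<in> escape"
        by (rule leave_ball[OF \<mu> y a(1)]) (use a x' y0 in \<open>auto simp: rad_def[OF \<mu> y]\<close>)
      then have "?y s \<in> escape" using escape_invariant[OF \<mu> y, of \<tau> s] a s by auto
      then show ?thesis by (simp add: confined_def)
    next
      case False
      then have b: "norm (snd (?y r)) \<le> r\<^sub>0" if "r \<in> {0..s}" for r using that by force
      have "norm (fst (?y s)) \<le> norm (fst (?y 0)) + (B + C) * s"
        by (rule momentum_bound[OF \<mu> y]) (use s b C in \<open>auto simp: rad_def[OF \<mu> y]\<close>)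
      then show ?thesis using b[of s] s x' y0 by (auto simp: confined_def)
    qed
  qed
qed

end

section \<open>Estimates for the time discretization\<close>

lemma grid_decomp:
  fixes T t :: real
  assumes "0 < T" "1 \<le> (n::nat)" "t \<in> {0..T}"
  obtains k s where "k < n" "s \<in> {0..T / real n}" "t = real k * (T / real n) + s"
proof (cases "t = T")
  case True
  \<comment> \<open>The final time belongs to the last step, with the full step length, because step
    indices are below \<open>n\<close>.\<close>
  have "T = real (n - 1) * (T / real n) + T / real n"
    using assms(2) by (simp add: of_nat_diff field_simps)
  then show thesis
    using that[of "n - 1" "T / real n"] True assms by auto
next
  case False
  define h where "h = T / real n"
  have h: "0 < h" "real n * h = T" using assms by (auto simp: h_def)
  define k where "k = nat \<lfloor>t / h\<rfloor>"
  have k: "real k \<le> t / h" "t / h < real k + 1"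
    using assms(3) h(1) by (auto simp: k_def)
  have "t < T" using False assms(3) by auto
  then have "t / h < real n" using h by (simp add: field_simps)
  then have "real k < real n" using k by linarith
  moreover have "real k * h \<le> t" "t < real k * h + h"
    using k h(1) by (auto simp: field_simps)
  ultimately show thesis
    using that[of k "t - real k * h"] by (auto simp: h_def)
qed

lemma grid_induct:
  fixes T t :: real
  assumes "0 < T" "1 \<le> (n::nat)" "t \<in> {0..T}" "P 0"
    and step: "\<And>k s. k < n \<Longrightarrow> s \<in> {0..T / real n} \<Longrightarrow> P (real k * (T / real n)) \<Longrightarrow> P (real k * (T / real n) + s)"
  shows "P t"
proof -
  have grid: "P (real k * (T / real n))" if "k \<le> n" for k
    using that
  proof (induction k)
    case (Suc k)
    then have "P (real k * (T / real n) + T / real n)"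
      using assms(1) by (intro step) auto
    then show ?case by (simp only: of_nat_Suc distrib_right mult_1 add.commute)
  qed (simp add: assms)
  obtain k s where "k < n" "s \<in> {0..T / real n}" "t = real k * (T / real n) + s"
    using grid_decomp[OF assms(1-3)] by metis
  then show ?thesis using grid[of k] step by auto
qed

lemma grid_point:
  fixes T :: real
  assumes "0 < T" "k < (n::nat)" "s \<in> {0..T / real n}"
  shows "real k * (T / real n) \<in> {0..T}" "real k * (T / real n) + s \<in> {0..T}"
proof -
  have "real k * (T / real n) + T / real n = real (Suc k) * (T / real n)"
    by (simp only: of_nat_Suc distrib_right mult_1 add.commute)
  also have "\<dots> \<le> real n * (T / real n)" using assms by (intro mult_right_mono) auto
  also have "\<dots> = T" using assms by simp
  finally have "real k * (T / real n) + T / real n \<le> T" .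
  moreover have "0 \<le> real k * (T / real n)" "0 \<le> T / real n" using assms by auto
  ultimately show "real k * (T / real n) \<in> {0..T}" "real k * (T / real n) + s \<in> {0..T}"
    using assms(3) by auto
qed

lemma discretizationD:
  assumes "discretization W \<Phi> T \<epsilon> \<mu>\<^sub>0 n m" "0 < T"
  shows "t \<in> {0..T} \<Longrightarrow> finite_borel (m t)" "m 0 = \<mu>\<^sub>0"
    "k < n \<Longrightarrow> s \<in> {0..T / real n} \<Longrightarrow> transported \<epsilon> (ham_field W \<Phi> (m (real k * (T / real n)))) s
        (m (real k * (T / real n))) (m (real k * (T / real n) + s))"
  using assms unfolding discretization_def Let_def by blast+

lemma test_function_lipschitz:
  fixes \<phi> :: "'b::euclidean_space \<Rightarrow> real"
  assumes "test_function UNIV \<phi>"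
  shows "\<exists>L M R. 0 \<le> M \<and> L-lipschitz_on UNIV \<phi> \<and> (\<forall>z. \<bar>\<phi> z\<bar> \<le> M) \<and> (\<forall>z. norm z \<ge> R \<longrightarrow> \<phi> z = 0)"
proof -
  have C: "C_k 1 \<phi>" and "compact_support_in UNIV \<phi>" using assms by (auto simp: test_function_def)
  then obtain R where R: "R > 0" "\<And>x. norm x \<ge> R \<Longrightarrow> \<phi> x = 0"
    using compact_support_bound[of UNIV \<phi>] by blast
  obtain L where "L-lipschitz_on (cball 0 R) \<phi>" using C_k_1_lipschitz[OF C] by blast
  then have L: "L-lipschitz_on UNIV \<phi>" by (rule lipschitz_extend_zero) (rule R)
  have "\<bar>\<phi> z\<bar> \<le> L * (2 * R)" for z
  proof (cases "norm z \<ge> R")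
    case True
    then show ?thesis using R lipschitz_on_nonneg[OF L] by simp
  next
    case False
    \<comment> \<open>A point on the sphere of radius \<open>R\<close>, where \<phi> is 0, lies
      within \<open>2 * R\<close> of any point of the ball; the Lipschitz constant thus also bounds
      \<phi>.\<close>
    obtain b :: 'b where b: "norm b = R" using vector_choose_size[of R] R by auto
    have "\<bar>\<phi> z\<bar> = dist (\<phi> z) (\<phi> b)" using R(2)[of b] b by simp
    also have "\<dots> \<le> L * dist z b" by (rule lipschitz_onD[OF L]) auto
    also have "dist z b \<le> 2 * R"
      using False b norm_triangle_ineq4[of z b] by (simp add: dist_norm)
    finally show ?thesis using lipschitz_on_nonneg[OF L] by (simp add: mult_left_mono)
  qed
  moreover have "0 \<le> L * (2 * R)" using R lipschitz_on_nonneg[OF L] by simp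
  ultimately show ?thesis using L R by blast
qed

section \<open>Lipschitz continuity in time, for the discretization and its limit\<close>

context interaction
begin

lemma discretization_subprob:
  assumes d: "discretization W \<Phi> T \<epsilon> \<mu>\<^sub>0 n m" and T: "0 < T" and n: "1 \<le> n" and \<epsilon>: "0 \<le> \<epsilon>"
    and \<mu>0: "subprob \<mu>\<^sub>0" and t: "t \<in> {0..T}"
  shows "subprob (m t)"
proof (rule grid_induct[OF T n t, of "\<lambda>t. subprob (m t)"])
  show "subprob (m 0)" using discretizationD(2)[OF d T] \<mu>0 by simp
  fix k s assume k: "k < n" "s \<in> {0..T / real n}" "subprob (m (real k * (T / real n)))"
  interpret locally_lipschitz_field "ham_field W \<Phi> (m (real k * (T / real n)))"
    by (rule ham_field_locally_lipschitz[OF k(3)])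
  show "subprob (m (real k * (T / real n) + s))"
    by (rule transported_subprob[OF discretizationD(3)[OF d T k(1,2)] _ \<epsilon> k(3)
          discretizationD(1)[OF d T grid_point(2)[OF T k(1,2)]]]) (use k in auto)
qed

text \<open>Transport steps start at grid points only, so two times are compared through the grid
  points below them. Each time costs one step length, and the distance of the grid points exceeds
  \<open>\<bar>t - t'\<bar>\<close> by at most two more: hence the 4, which disappears as
  \<open>n\<close> grows.\<close>

lemma discretization_lipschitz:
  fixes \<phi> :: "'a \<times> 'a \<Rightarrow> real"
  assumes d: "discretization W \<Phi> T \<epsilon> \<mu>\<^sub>0 n m" and T: "0 < T" and n: "1 \<le> n" and \<epsilon>: "0 \<le> \<epsilon>"
    and \<mu>0: "subprob \<mu>\<^sub>0"
    and L: "l-lipschitz_on UNIV \<phi>" and M: "\<And>z. \<bar>\<phi> z\<bar> \<le> M"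
    and R: "\<And>z. norm z \<ge> \<rho> \<Longrightarrow> \<phi> z = 0"
    and V: "\<And>\<mu> z. subprob \<mu> \<Longrightarrow> norm z \<le> \<rho> \<Longrightarrow> norm (ham_field W \<Phi> \<mu> z) \<le> V" and V0: "0 \<le> V"
    and t: "t \<in> {0..T}" "t' \<in> {0..T}"
  shows "\<bar>(\<integral>x. \<phi> x \<partial>m t) - (\<integral>x. \<phi> x \<partial>m t')\<bar> \<le> 2 * (l + \<epsilon> * M) * V * (\<bar>t - t'\<bar> + 4 * (T / real n))"
proof -
  define h where "h = T / real n"
  have h: "0 < h" using T n by (simp add: h_def)
  define K where "K = 2 * (l + \<epsilon> * M) * V"
  have K0: "0 \<le> K"
    unfolding K_def using lipschitz_on_nonneg[OF L] order_trans[OF abs_ge_zero M] \<epsilon> V0 by simp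
  define a where "a t = (\<integral>x. \<phi> x \<partial>m t)" for t
  have step: "\<bar>a (real k * h + s) - a (real k * h)\<bar> \<le> K * s" if k: "k < n" "s \<in> {0..h}" for k s
  proof -
    have sp: "subprob (m (real k * h))"
      using grid_point(1)[OF T k(1), of 0] h
      by (intro discretization_subprob[OF d T n \<epsilon> \<mu>0]) (simp add: h_def)
    interpret locally_lipschitz_field "ham_field W \<Phi> (m (real k * h))"
      by (rule ham_field_locally_lipschitz[OF sp])
    show ?thesis
      unfolding a_def K_def
      by (rule transported_lipschitz[OF discretizationD(3)[OF d T, folded h_def, OF k] sp _ \<epsilon> L M R V[OF sp] V0])
         (use k in auto)
  qed
  have grid: "\<bar>a (real (k + i) * h) - a (real k * h)\<bar> \<le> K * (real i * h)" if "k + i \<le> n" for k i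
    using that
  proof (induction i)
    case (Suc i)
    have "\<bar>a (real (k + i) * h + h) - a (real (k + i) * h)\<bar> \<le> K * h"
      using Suc.prems h by (intro step) auto
    moreover have "real (k + i) * h + h = real (k + Suc i) * h" by (simp add: algebra_simps)
    ultimately have "\<bar>a (real (k + Suc i) * h) - a (real (k + i) * h)\<bar> \<le> K * h" by simp
    then have "\<bar>a (real (k + Suc i) * h) - a (real k * h)\<bar> \<le> K * h + K * (real i * h)"
      using Suc by linarith
    then show ?case by (simp add: algebra_simps)
  qed simp
  have main: "\<bar>a t - a t'\<bar> \<le> K * ((t' - t) + 4 * h)" if t: "t \<in> {0..T}" "t' \<in> {0..T}" "t \<le> t'" for t t'
  proof -
    obtain k s where k: "k < n" "s \<in> {0..h}" "t = real k * h + s"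
      using grid_decomp[OF T n t(1)] unfolding h_def by metis
    obtain k' s' where k': "k' < n" "s' \<in> {0..h}" "t' = real k' * h + s'"
      using grid_decomp[OF T n t(2)] unfolding h_def by metis
    have "\<bar>a (real k' * h) - a (real k * h)\<bar> \<le> K * ((t' - t) + 2 * h)"
    proof (cases "k \<le> k'")
      case True
      then obtain i where i: "k' = k + i" using le_Suc_ex by blast
      have "\<bar>a (real k' * h) - a (real k * h)\<bar> \<le> K * (real i * h)"
        unfolding i using k' i by (intro grid) auto
      also have "real i * h \<le> (t' - t) + 2 * h"
        using k k' h unfolding i by (auto simp: algebra_simps)
      finally show ?thesis using K0 by (simp add: mult_left_mono)
    next
      case False
      then obtain i where i: "k = k' + i" using le_Suc_ex nat_le_linear by blast
      have "\<bar>a (real k * h) - a (real k' * h)\<bar> \<le> K * (real i * h)"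
        unfolding i using k i by (intro grid) auto
      also have "real i * h \<le> (t' - t) + 2 * h"
        using k k' h t(3) unfolding i by (auto simp: algebra_simps)
      finally show ?thesis using K0 by (simp add: mult_left_mono abs_minus_commute)
    qed
    moreover have "\<bar>a t - a (real k * h)\<bar> \<le> K * h"
      using step[OF k(1,2)] k(2,3) K0 by (auto intro: order_trans mult_left_mono)
    moreover have "\<bar>a t' - a (real k' * h)\<bar> \<le> K * h"
      using step[OF k'(1,2)] k'(2,3) K0 by (auto intro: order_trans mult_left_mono)
    ultimately have "\<bar>a t - a t'\<bar> \<le> K * ((t' - t) + 2 * h) + K * h + K * h" by linarith
    then show ?thesis by (simp add: algebra_simps)
  qed
  show ?thesis
    using main[OF t] main[OF t(2,1)] by (cases "t \<le> t'") (auto simp: a_def K_def h_def abs_minus_commute)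
qed

text \<open>As the discretizations are sub-probability measures, their distributional limits are
  limits against all continuous functions of bounded support, and are sub-probability measures
  themselves.\<close>

lemma constructedD:
  assumes c: "constructed_deficient_solution W \<Phi> T \<epsilon> \<mu>\<^sub>0 \<mu>" and T: "0 < T" and \<epsilon>: "0 < \<epsilon>"
    and \<mu>0: "subprob \<mu>\<^sub>0"
  obtains m and ns :: "nat \<Rightarrow> nat" where
    "\<And>j. discretization W \<Phi> T \<epsilon> \<mu>\<^sub>0 (ns j) (m j)" "\<And>j. 1 \<le> ns j" "strict_mono ns"
    "\<And>j t. t \<in> {0..T} \<Longrightarrow> subprob (m j t)"
    "\<And>t. t \<in> {0..T} \<Longrightarrow> dist_conv (\<lambda>j. m j t) (\<mu> t)"
    "\<And>t. t \<in> {0..T} \<Longrightarrow> subprob (\<mu> t)"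
    "\<And>t. t \<in> {0..T} \<Longrightarrow> vague_conv (\<lambda>j. m j t) (\<mu> t)"
proof -
  obtain m and ns :: "nat \<Rightarrow> nat" where
    d: "\<forall>n\<ge>1. discretization W \<Phi> T \<epsilon> \<mu>\<^sub>0 n (m n)" and ns: "strict_mono ns" "\<forall>j. 1 \<le> ns j"
    and lim: "\<forall>t\<in>{0..T}. dist_conv (\<lambda>j. m (ns j) t) (\<mu> t)"
    using c unfolding constructed_deficient_solution_def by blast
  have fb: "finite_borel (\<mu> t)" if "t \<in> {0..T}" for t
    using c that unfolding constructed_deficient_solution_def by blast
  have d': "discretization W \<Phi> T \<epsilon> \<mu>\<^sub>0 (ns j) (m (ns j))" for j using d ns by blast
  have sp: "subprob (m (ns j) t)" if "t \<in> {0..T}" for j t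
    using ns(2) \<epsilon> that by (intro discretization_subprob[OF d' T _ _ \<mu>0]) auto
  have "subprob (\<mu> t) \<and> vague_conv (\<lambda>j. m (ns j) t) (\<mu> t)" if t: "t \<in> {0..T}" for t
    using dist_conv_vague[of "\<lambda>j. m (ns j) t" "\<mu> t"] sp[OF t] fb[OF t] lim t by blast
  then show thesis
    using ns lim by (intro that[of ns "\<lambda>j. m (ns j)"] d' sp) auto
qed

lemma constructed_subprob:
  assumes "constructed_deficient_solution W \<Phi> T \<epsilon> \<mu>\<^sub>0 \<mu>" "0 < T" "0 < \<epsilon>" "subprob \<mu>\<^sub>0" "t \<in> {0..T}"
  shows "subprob (\<mu> t)"
  by (rule constructedD[OF assms(1-4)]) (use assms(5) in blast)

lemma constructed_initial:
  assumes "constructed_deficient_solution W \<Phi> T \<epsilon> \<mu>\<^sub>0 \<mu>" "0 < T" "0 < \<epsilon>" "subprob \<mu>\<^sub>0"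
  shows "\<mu> 0 = \<mu>\<^sub>0"
proof (rule constructedD[OF assms])
  fix m and ns :: "nat \<Rightarrow> nat"
  assume d: "\<And>j. discretization W \<Phi> T \<epsilon> \<mu>\<^sub>0 (ns j) (m j)"
    and lim: "\<And>t. t \<in> {0..T} \<Longrightarrow> dist_conv (\<lambda>j. m j t) (\<mu> t)"
    and sp: "\<And>t. t \<in> {0..T} \<Longrightarrow> subprob (\<mu> t)"
  have 0: "0 \<in> {0..T}" using assms(2) by simp
  show "\<mu> 0 = \<mu>\<^sub>0"
  proof (rule finite_borel_eqI[OF subprob_finite(5)[OF sp[OF 0]] subprob_finite(5)[OF assms(4)]])
    fix \<phi> :: "'a \<times> 'a \<Rightarrow> real" assume "test_function UNIV \<phi>"
    then have "(\<lambda>j. \<integral>x. \<phi> x \<partial>m j 0) \<longlonglongrightarrow> (\<integral>x. \<phi> x \<partial>\<mu> 0)"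
      using lim[OF 0] by (simp add: dist_conv_def)
    then show "(\<integral>x. \<phi> x \<partial>\<mu> 0) = (\<integral>x. \<phi> x \<partial>\<mu>\<^sub>0)"
      using discretizationD(2)[OF d assms(2)] by (simp add: LIMSEQ_const_iff)
  qed
qed

text \<open>The constant precedes \<epsilon> and the solution: it depends on the slope, size and
  support of \<phi> and on the uniform bound of the field there, while
  \<open>\<epsilon> \<le> 1\<close> absorbs the killing. The grid error vanishes along the
  subsequence.\<close>

lemma constructed_lipschitz:
  fixes \<phi> :: "'a \<times> 'a \<Rightarrow> real"
  assumes T: "0 < T" and \<mu>0: "subprob \<mu>\<^sub>0" and \<phi>: "test_function UNIV \<phi>"
  shows "\<exists>K\<ge>0. \<forall>\<epsilon> \<mu> t t'. 0 < \<epsilon> \<longrightarrow> \<epsilon> \<le> 1 \<longrightarrow> constructed_deficient_solution W \<Phi> T \<epsilon> \<mu>\<^sub>0 \<mu> \<longrightarrow>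
     t \<in> {0..T} \<longrightarrow> t' \<in> {0..T} \<longrightarrow> \<bar>(\<integral>x. \<phi> x \<partial>\<mu> t) - (\<integral>x. \<phi> x \<partial>\<mu> t')\<bar> \<le> K * \<bar>t - t'\<bar>"
proof -
  obtain L' M R where M0: "0 \<le> M" and L: "L'-lipschitz_on UNIV \<phi>" and M: "\<And>z. \<bar>\<phi> z\<bar> \<le> M"
    and R: "\<And>z. norm z \<ge> R \<Longrightarrow> \<phi> z = 0"
    using test_function_lipschitz[OF \<phi>] by blast
  obtain V where V0: "0 \<le> V"
    and V: "\<And>\<mu> x. subprob \<mu> \<Longrightarrow> norm x \<le> R \<Longrightarrow> norm (ham_field W \<Phi> \<mu> x) \<le> V"
    using ham_field_bound[of R] by blast
  have L0: "0 \<le> L'" using lipschitz_on_nonneg[OF L] .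
  define K where "K = 2 * (L' + M) * V"
  have K0: "0 \<le> K" using L0 M0 V0 by (simp add: K_def)
  show ?thesis
  proof (intro exI[of _ K] conjI K0 allI impI)
    fix \<epsilon> t t' :: real and \<mu>
    assume \<epsilon>: "0 < \<epsilon>" "\<epsilon> \<le> 1" and c: "constructed_deficient_solution W \<Phi> T \<epsilon> \<mu>\<^sub>0 \<mu>"
      and t: "t \<in> {0..T}" "t' \<in> {0..T}"
    show "\<bar>(\<integral>x. \<phi> x \<partial>\<mu> t) - (\<integral>x. \<phi> x \<partial>\<mu> t')\<bar> \<le> K * \<bar>t - t'\<bar>"
    proof (rule constructedD[OF c T \<epsilon>(1) \<mu>0])
      fix m and ns :: "nat \<Rightarrow> nat"
      assume d: "\<And>j. discretization W \<Phi> T \<epsilon> \<mu>\<^sub>0 (ns j) (m j)" and ns: "\<And>j. 1 \<le> ns j" "strict_mono ns"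
        and lim: "\<And>t. t \<in> {0..T} \<Longrightarrow> dist_conv (\<lambda>j. m j t) (\<mu> t)"
      have l: "(\<lambda>j. \<integral>x. \<phi> x \<partial>m j r) \<longlonglongrightarrow> (\<integral>x. \<phi> x \<partial>\<mu> r)" if "r \<in> {0..T}" for r
        using lim[OF that] \<phi> by (simp add: dist_conv_def)
      have "(\<lambda>j. T / real (ns j)) \<longlonglongrightarrow> 0"
        using LIMSEQ_subseq_LIMSEQ[OF lim_const_over_n[of T] ns(2)] by (simp add: o_def)
      then have "(\<lambda>j. K * (\<bar>t - t'\<bar> + 4 * (T / real (ns j)))) \<longlonglongrightarrow> K * (\<bar>t - t'\<bar> + 4 * 0)"
        by (intro tendsto_intros)
      moreover have "(\<lambda>j. \<bar>(\<integral>x. \<phi> x \<partial>m j t) - (\<integral>x. \<phi> x \<partial>m j t')\<bar>) \<longlonglongrightarrow> \<bar>(\<integral>x. \<phi> x \<partial>\<mu> t) - (\<integral>x. \<phi> x \<partial>\<mu> t')\<bar>"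
        by (intro tendsto_intros l t)
      moreover have "\<bar>(\<integral>x. \<phi> x \<partial>m j t) - (\<integral>x. \<phi> x \<partial>m j t')\<bar> \<le> K * (\<bar>t - t'\<bar> + 4 * (T / real (ns j)))" for j
      proof -
        have "\<bar>(\<integral>x. \<phi> x \<partial>m j t) - (\<integral>x. \<phi> x \<partial>m j t')\<bar> \<le> 2 * (L' + \<epsilon> * M) * V * (\<bar>t - t'\<bar> + 4 * (T / real (ns j)))"
          by (rule discretization_lipschitz[OF d T ns(1) _ \<mu>0 L M R V V0 t]) (use \<epsilon> in auto)
        also have "\<dots> \<le> K * (\<bar>t - t'\<bar> + 4 * (T / real (ns j)))"
          unfolding K_def using \<epsilon> M0 V0 L0 T
          by (intro mult_right_mono mult_left_mono add_left_mono) (auto intro: mult_left_le_one_le)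
        finally show ?thesis .
      qed
      ultimately show ?thesis by (intro LIMSEQ_le) auto
    qed
  qed
qed

end

section \<open>Propagation of confinement through the discretization\<close>

context barrier
begin

text \<open>The allowance for the momentum grows additively with the length of each step, so over
  many steps it depends on the elapsed time and not on their number.\<close>

lemma discretization_confined:
  assumes d: "discretization W \<Phi> T \<epsilon> \<mu>\<^sub>0 n m" and T: "0 < T" and n: "1 \<le> n" and \<epsilon>: "0 \<le> \<epsilon>"
    and \<mu>0: "subprob \<mu>\<^sub>0" and t: "t \<in> {0..T}" and P: "0 \<le> P"
    and C: "\<And>q. norm q \<le> r\<^sub>0 \<Longrightarrow> norm (grad \<Phi> q) \<le> C"
  shows "measure (m t) (- confined (P + (B + C) * t)) \<le> measure \<mu>\<^sub>0 (- confined P)"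
proof (rule grid_induct[OF T n t, of "\<lambda>t. measure (m t) (- confined (P + (B + C) * t)) \<le> measure \<mu>\<^sub>0 (- confined P)"])
  show "measure (m 0) (- confined (P + (B + C) * 0)) \<le> measure \<mu>\<^sub>0 (- confined P)"
    using discretizationD(2)[OF d T] by simp
  have BC: "0 \<le> B + C" using B_nonneg order_trans[OF norm_ge_zero C[of 0]] r0_pos by simp
  fix k s assume k: "k < n" "s \<in> {0..T / real n}"
    and IH: "measure (m (real k * (T / real n))) (- confined (P + (B + C) * (real k * (T / real n)))) \<le> measure \<mu>\<^sub>0 (- confined P)"
  let ?t = "real k * (T / real n)"
  have t': "?t \<in> {0..T}" "?t + s \<in> {0..T}" using grid_point[OF T k] by auto
  have sp: "subprob (m ?t)" "subprob (m (?t + s))"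
    using t' by (auto intro!: discretization_subprob[OF d T n \<epsilon> \<mu>0])
  interpret locally_lipschitz_field "ham_field W \<Phi> (m ?t)"
    by (rule ham_field_locally_lipschitz[OF sp(1)])
  have "measure (m (?t + s)) (- confined (P + (B + C) * (?t + s))) \<le> measure (m ?t) (- confined (P + (B + C) * ?t))"
  proof (rule transported_closed[OF discretizationD(3)[OF d T k] _ \<epsilon> sp(1) subprob_finite(5)[OF sp(2)]
        closed_confined closed_confined])
    show "0 \<le> s" using k by simp
    have "0 \<le> ?t + s" using t' by auto
    then show "confined (P + (B + C) * (?t + s)) \<noteq> {}"
      using P mult_nonneg_nonneg[OF BC \<open>0 \<le> ?t + s\<close>] by (intro confined_ne) simp
    fix x assume "x \<in> confined (P + (B + C) * ?t)" "ereal s < lifetime (ham_field W \<Phi> (m ?t)) x"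
    then have "flow (ham_field W \<Phi> (m ?t)) x s \<in> confined (P + (B + C) * ?t + (B + C) * s)"
      using confined_flow[OF sp(1) C] k by auto
    then show "flow (ham_field W \<Phi> (m ?t)) x s \<in> confined (P + (B + C) * (?t + s))"
      by (simp add: algebra_simps)
  qed
  then show "measure (m (?t + s)) (- confined (P + (B + C) * (?t + s))) \<le> measure \<mu>\<^sub>0 (- confined P)"
    using IH by linarith
qed

text \<open>The set on the left is open, as the passage to the limit demands, and lies outside
  \<open>confined\<close> at every time up to \<open>T\<close>, because \<open>escape\<close>
  contains no point of the open ball. The set on the right contains the complement of
  \<open>confined P\<close>.\<close>

lemma constructed_confined:
  assumes c: "constructed_deficient_solution W \<Phi> T \<epsilon> \<mu>\<^sub>0 \<mu>" and T: "0 < T" and \<epsilon>: "0 < \<epsilon>"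
    and \<mu>0: "subprob \<mu>\<^sub>0" and t: "t \<in> {0..T}" and P: "0 \<le> P"
    and C: "\<And>q. norm q \<le> r\<^sub>0 \<Longrightarrow> norm (grad \<Phi> q) \<le> C"
  shows "measure (\<mu> t) {x. norm (snd x) < r\<^sub>0 \<and> P + (B + C) * T < norm (fst x)}
     \<le> measure \<mu>\<^sub>0 {x. r\<^sub>0 < norm (snd x) \<or> P < norm (fst x)}"
proof (rule constructedD[OF c T \<epsilon> \<mu>0])
  fix m and ns :: "nat \<Rightarrow> nat"
  assume d: "\<And>j. discretization W \<Phi> T \<epsilon> \<mu>\<^sub>0 (ns j) (m j)" and ns: "\<And>j. 1 \<le> ns j"
    and spm: "\<And>j t. t \<in> {0..T} \<Longrightarrow> subprob (m j t)"
    and sp: "\<And>t. t \<in> {0..T} \<Longrightarrow> subprob (\<mu> t)"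
    and lim: "\<And>t. t \<in> {0..T} \<Longrightarrow> vague_conv (\<lambda>j. m j t) (\<mu> t)"
  have BC: "0 \<le> B + C" using B_nonneg order_trans[OF norm_ge_zero C[of 0]] r0_pos by simp
  let ?A = "{x :: 'a \<times> 'a. norm (snd x) < r\<^sub>0 \<and> P + (B + C) * T < norm (fst x)}"
  let ?D = "{x :: 'a \<times> 'a. r\<^sub>0 < norm (snd x) \<or> P < norm (fst x)}"
  have oA: "open ?A" by (intro open_Collect_conj open_Collect_less continuous_intros)
  have oD: "open ?D" by (intro open_Collect_disj open_Collect_less continuous_intros)
  show ?thesis
  proof (rule vague_limit_open[OF spm[OF t] sp[OF t] lim[OF t] oA])
    fix j
    interpret mj: finite_measure "m j t" using subprob_finite spm[OF t] by blast
    interpret m0: finite_measure "\<mu>\<^sub>0" using subprob_finite \<mu>0 by blast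
    have "(B + C) * t \<le> (B + C) * T" using t BC by (intro mult_left_mono) auto
    then have "?A \<subseteq> - confined (P + (B + C) * t)"
      by (auto simp: confined_def escape_def)
    then have "measure (m j t) ?A \<le> measure (m j t) (- confined (P + (B + C) * t))"
      using closed_confined subprob_finite(2)[OF spm[OF t]] by (intro mj.finite_measure_mono) auto
    also have "\<dots> \<le> measure \<mu>\<^sub>0 (- confined P)"
      by (rule discretization_confined[OF d T ns _ \<mu>0 t P C]) (use \<epsilon> in auto)
    also have "\<dots> \<le> measure \<mu>\<^sub>0 ?D"
      using oD subprob_finite(2)[OF \<mu>0] by (intro m0.finite_measure_mono) (auto simp: confined_def)
    finally show "measure (m j t) ?A \<le> measure \<mu>\<^sub>0 ?D" .
  qed simp
qed

end

section \<open>Passage to the limit\<close>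

text \<open>Tightness in \<open>p\<close> over bounded positions only: mass may still escape to
  infinity in \<open>q\<close>, where the compactly supported interaction no longer sees it.\<close>

definition momentum_tight :: "('a::euclidean_space \<times> 'a) measure set \<Rightarrow> bool" where
  "momentum_tight \<M> \<longleftrightarrow> (\<forall>\<rho>. \<forall>\<delta>>0. \<exists>P. \<forall>M\<in>\<M>. measure M {x. norm (snd x) < \<rho> \<and> P < norm (fst x)} \<le> \<delta>)"

lemma momentum_tight_subset: "momentum_tight \<M> \<Longrightarrow> \<N> \<subseteq> \<M> \<Longrightarrow> momentum_tight \<N>"
  unfolding momentum_tight_def by (meson subsetD)

lemma open_momentum: "open {x :: 'a::euclidean_space \<times> 'a. norm (snd x) < \<rho> \<and> P < norm (fst x)}"
  by (intro open_Collect_conj open_Collect_less continuous_intros)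

text \<open>The sets in the definition are open, so every bound passes to the vague limit with the
  same \<open>P\<close>.\<close>

lemma vague_limit_momentum_tight:
  fixes N :: "nat \<Rightarrow> ('a::euclidean_space \<times> 'a) measure"
  assumes "\<And>k. subprob (N k)" "subprob M" "vague_conv N M" "momentum_tight (range N)"
  shows "momentum_tight (insert M (range N))"
  unfolding momentum_tight_def
proof (intro allI impI)
  fix \<rho> \<delta> :: real assume "0 < \<delta>"
  then obtain P where P: "\<And>k. measure (N k) {x. norm (snd x) < \<rho> \<and> P < norm (fst x)} \<le> \<delta>"
    using assms(4) unfolding momentum_tight_def by blast
  have "measure M {x. norm (snd x) < \<rho> \<and> P < norm (fst x)} \<le> \<delta>"
    by (rule vague_limit_open[OF assms(1-3) open_momentum P]) (use \<open>0 < \<delta>\<close> in simp)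
  then show "\<exists>P. \<forall>M\<in>insert M (range N). measure M {x. norm (snd x) < \<rho> \<and> P < norm (fst x)} \<le> \<delta>"
    using P by blast
qed

text \<open>The cut-off is 1 up to momentum \<open>P\<close> and 0 from \<open>P + 1\<close> on; the
  error lives on the set of small measure.\<close>

lemma momentum_cutoff:
  fixes f :: "'a::euclidean_space \<times> 'a \<Rightarrow> real"
  assumes Q: "subprob Q" and small: "measure Q {x. norm (snd x) < \<rho> \<and> P < norm (fst x)} \<le> \<delta>"
    and f: "continuous_on UNIV f" "\<And>x. \<bar>f x\<bar> \<le> C" "\<And>x. \<rho> \<le> norm (snd x) \<Longrightarrow> f x = 0"
  shows "\<bar>(\<integral>x. f x \<partial>Q) - (\<integral>x. f x * max 0 (min 1 (P + 1 - norm (fst x))) \<partial>Q)\<bar> \<le> C * \<delta>"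
proof -
  interpret finite_measure Q using subprob_finite Q by blast
  let ?A = "{x :: 'a \<times> 'a. norm (snd x) < \<rho> \<and> P < norm (fst x)}"
  let ?\<chi> = "\<lambda>x :: 'a \<times> 'a. max 0 (min 1 (P + 1 - norm (fst x)))"
  have C0: "0 \<le> C" using order_trans[OF abs_ge_zero f(2)] .
  have i1: "integrable Q f"
    by (rule subprob_integrable[OF Q borel_measurable_continuous_onI[OF f(1)], of C]) (use f(2) in simp)
  have c2: "continuous_on UNIV (\<lambda>x. f x * ?\<chi> x)" by (intro continuous_intros f(1))
  have i2: "integrable Q (\<lambda>x. f x * ?\<chi> x)"
  proof (rule subprob_integrable[OF Q borel_measurable_continuous_onI[OF c2], of C])
    fix x
    have "\<bar>f x\<bar> * ?\<chi> x \<le> C * 1" using f(2)[of x] C0 by (intro mult_mono) auto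
    then show "norm (f x * ?\<chi> x) \<le> C" by (simp add: abs_mult)
  qed
  have "(\<integral>x. f x \<partial>Q) - (\<integral>x. f x * ?\<chi> x \<partial>Q) = (\<integral>x. f x - f x * ?\<chi> x \<partial>Q)"
    using i1 i2 by simp
  also have "\<bar>\<dots>\<bar> \<le> (\<integral>x. C * indicator ?A x \<partial>Q)"
  proof (rule integral_abs_bound_integral)
    show "integrable Q (\<lambda>x. f x - f x * ?\<chi> x)" using i1 i2 by simp
    show "integrable Q (\<lambda>x. C * indicator ?A x :: real)"
    proof (intro integrable_mult_right integrable_real_indicator)
      show "?A \<in> sets Q" unfolding subprob_finite(2)[OF Q] by (rule borel_open[OF open_momentum])
    qed (simp add: less_top[symmetric])
    fix x
    have "\<bar>f x - f x * ?\<chi> x\<bar> = \<bar>f x\<bar> * \<bar>1 - ?\<chi> x\<bar>"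
      unfolding abs_mult[symmetric] by (simp add: right_diff_distrib)
    also have "\<dots> \<le> C * indicator ?A x"
    proof (cases "x \<in> ?A")
      case True
      have "\<bar>f x\<bar> * \<bar>1 - ?\<chi> x\<bar> \<le> C * 1"
        using f(2)[of x] C0 by (intro mult_mono) auto
      then show ?thesis using True by simp
    next
      case False
      then have "\<rho> \<le> norm (snd x) \<or> norm (fst x) \<le> P" by auto
      then show ?thesis using False f(3)[of x] by auto
    qed
    finally show "\<bar>f x - f x * ?\<chi> x\<bar> \<le> C * indicator ?A x" .
  qed
  also have "\<dots> = C * measure Q ?A"
    using subprob_finite(3)[OF Q] by simp
  also have "\<dots> \<le> C * \<delta>" using small C0 by (rule mult_left_mono)
  finally show ?thesis .
qed

text \<open>Vague convergence extends to bounded continuous functions whose support is bounded in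
  \<open>q\<close> only: cutting in \<open>p\<close> gives an admissible test function, at a cost
  uniform along the sequence.\<close>

lemma momentum_tight_conv:
  fixes f :: "'a::euclidean_space \<times> 'a \<Rightarrow> real"
  assumes N: "\<And>k. subprob (N k)" and M: "subprob M" and conv: "vague_conv N M"
    and tight: "momentum_tight (insert M (range N))"
    and f: "continuous_on UNIV f" "\<And>x. \<bar>f x\<bar> \<le> C" "\<And>x. \<rho> \<le> norm (snd x) \<Longrightarrow> f x = 0"
  shows "(\<lambda>k. \<integral>x. f x \<partial>N k) \<longlonglongrightarrow> (\<integral>x. f x \<partial>M)"
proof (rule tendstoI)
  fix e :: real assume e: "0 < e"
  have C0: "0 \<le> C" using order_trans[OF abs_ge_zero f(2)] .
  define \<delta> where "\<delta> = e / (4 * (C + 1))"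
  have \<delta>: "0 < \<delta>" "C * \<delta> \<le> e / 4"
    using e C0 by (auto simp: \<delta>_def field_simps)
  obtain P where P: "\<And>Q. Q \<in> insert M (range N) \<Longrightarrow> measure Q {x. norm (snd x) < \<rho> \<and> P < norm (fst x)} \<le> \<delta>"
    using tight \<delta>(1) unfolding momentum_tight_def by blast
  let ?g = "\<lambda>x. f x * max 0 (min 1 (P + 1 - norm (fst x)))"
  have cut: "\<bar>(\<integral>x. f x \<partial>Q) - (\<integral>x. ?g x \<partial>Q)\<bar> \<le> e / 4" if "Q \<in> insert M (range N)" "subprob Q" for Q
    using momentum_cutoff[OF that(2) P[OF that(1)] f] \<delta>(2) by linarith
  have zero: "?g x = 0" if nx: "norm x > \<bar>P\<bar> + 1 + \<bar>\<rho>\<bar>" for x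
  proof -
    have "norm x \<le> norm (fst x) + norm (snd x)"
      using norm_Pair_le[of "fst x" "snd x"] by simp
    then have "\<rho> \<le> norm (snd x) \<or> P + 1 \<le> norm (fst x)" using nx by linarith
    then show ?thesis using f(3)[of x] by auto
  qed
  have "continuous_on UNIV ?g" by (intro continuous_intros f(1))
  then have "(\<lambda>k. \<integral>x. ?g x \<partial>N k) \<longlonglongrightarrow> (\<integral>x. ?g x \<partial>M)"
    using conv zero unfolding vague_conv_def by blast
  then have "\<forall>\<^sub>F k in sequentially. dist (\<integral>x. ?g x \<partial>N k) (\<integral>x. ?g x \<partial>M) < e / 4"
    using e by (intro tendstoD) auto
  then show "\<forall>\<^sub>F k in sequentially. dist (\<integral>x. f x \<partial>N k) (\<integral>x. f x \<partial>M) < e"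
  proof eventually_elim
    case (elim k)
    have "\<bar>(\<integral>x. f x \<partial>N k) - (\<integral>x. ?g x \<partial>N k)\<bar> \<le> e / 4" "\<bar>(\<integral>x. f x \<partial>M) - (\<integral>x. ?g x \<partial>M)\<bar> \<le> e / 4"
      by (rule cut; use N M in simp)+
    then show ?case using elim e unfolding dist_real_def by linarith
  qed
qed

lemma bounded_of_support:
  fixes f :: "'b::euclidean_space \<Rightarrow> 'c::real_normed_vector"
  assumes "continuous_on UNIV f" "\<And>x. \<rho> \<le> norm x \<Longrightarrow> f x = 0"
  shows "\<exists>C\<ge>0. \<forall>x. norm (f x) \<le> C"
proof -
  have "bounded (f ` cball 0 \<rho>)"
    by (intro compact_imp_bounded compact_continuous_image continuous_on_subset[OF assms(1)]) auto
  then obtain C where C: "\<forall>x\<in>cball 0 \<rho>. norm (f x) \<le> C" by (auto simp: bounded_iff)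
  have "norm (f x) \<le> max C 0" for x
    using bspec[OF C, of x] assms(2)[of x] by (cases "\<rho> \<le> norm x") (auto intro: max.coboundedI1)
  then show ?thesis by (intro exI[of _ "max C 0"]) auto
qed

text \<open>The time derivative and the spatial gradient of a slice are made of directional
  derivatives of \<phi> on space-time, which are continuous and of bounded support; hence the
  constants do not depend on \<open>t\<close>.\<close>

lemma test_function_slices:
  fixes \<phi> :: "real \<times> 'b::euclidean_space \<Rightarrow> real"
  assumes "test_function \<Omega> \<phi>"
  shows "\<exists>\<rho> C. 0 \<le> C \<and> (\<forall>t.
     continuous_on UNIV (\<lambda>x. deriv (\<lambda>s. \<phi> (s, x)) t) \<and>
     continuous_on UNIV (grad (\<lambda>y. \<phi> (t, y))) \<and>
     continuous_on UNIV (\<lambda>x. \<phi> (t, x)) \<and>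
     (\<forall>x. \<bar>deriv (\<lambda>s. \<phi> (s, x)) t\<bar> \<le> C \<and> norm (grad (\<lambda>y. \<phi> (t, y)) x) \<le> C \<and> \<bar>\<phi> (t, x)\<bar> \<le> C) \<and>
     (\<forall>x. \<rho> \<le> norm x \<longrightarrow> deriv (\<lambda>s. \<phi> (s, x)) t = 0 \<and> grad (\<lambda>y. \<phi> (t, y)) x = 0 \<and> \<phi> (t, x) = 0))"
proof -
  have C1: "C_k 1 \<phi>" and "compact_support_in \<Omega> \<phi>" using assms by (auto simp: test_function_def)
  then obtain \<rho> where \<rho>: "\<rho> > 0" "\<And>z. norm z \<ge> \<rho> \<Longrightarrow> \<phi> z = 0 \<and> (\<phi> has_derivative (\<lambda>h. 0)) (at z)"
    using compact_support_bound[of \<Omega> \<phi>] by blast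
  define D where "D h z = frechet_derivative \<phi> (at z) h" for h z
  have Dd: "(\<phi> has_derivative (\<lambda>h. D h z)) (at z)" for z
    unfolding D_def by (rule C_k_1D(1)[OF C1])
  have Dc: "continuous_on UNIV (D h)" for h
    unfolding D_def by (rule C_k_1D(2)[OF C1])
  have D0: "D h z = 0" if "norm z \<ge> \<rho>" for h z
    using fun_cong[OF has_derivative_unique[OF Dd conjunct2[OF \<rho>(2)[OF that]]], of h] by simp
  have \<phi>c: "continuous_on UNIV \<phi>" by (rule C_k_imp_continuous[OF C1])
  have pair_c: "continuous_on UNIV (\<lambda>x :: 'b. (t, x))" for t :: real by (intro continuous_intros)
  have sl: "continuous_on UNIV (\<lambda>x. g (t, x))" if "continuous_on UNIV g" for g :: "real \<times> 'b \<Rightarrow> real" and t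
    by (rule continuous_on_compose2[OF that pair_c]) simp
  have d1: "deriv (\<lambda>s. \<phi> (s, x)) t = D (1, 0) (t, x)" for t x
  proof -
    have "((\<lambda>s. (s, x)) has_derivative (\<lambda>h. (h, 0))) (at t)"
      by (rule has_derivative_Pair[OF has_derivative_ident has_derivative_const])
    from has_derivative_compose[OF this Dd]
    have *: "((\<lambda>s. \<phi> (s, x)) has_derivative (\<lambda>h. D (h, 0) (t, x))) (at t)" .
    have "D (h, 0) (t, x) = D (1, 0) (t, x) * h" for h
      using linear_scale[OF has_derivative_linear[OF *], of h 1] by simp
    then have eq: "(\<lambda>h. D (h, 0) (t, x)) = (*) (D (1, 0) (t, x))" by (rule ext)
    have "((\<lambda>s. \<phi> (s, x)) has_real_derivative D (1, 0) (t, x)) (at t)"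
      using * unfolding has_field_derivative_def eq .
    then show ?thesis by (rule DERIV_imp_deriv)
  qed
  have d2: "grad (\<lambda>y. \<phi> (t, y)) x = (\<Sum>b\<in>Basis. D (0, b) (t, x) *\<^sub>R b)" for t x
  proof -
    have "((\<lambda>y. (t, y)) has_derivative (\<lambda>h. (0, h))) (at x)"
      by (rule has_derivative_Pair[OF has_derivative_const has_derivative_ident])
    from has_derivative_compose[OF this Dd]
    have "((\<lambda>y. \<phi> (t, y)) has_derivative (\<lambda>h. D (0, h) (t, x))) (at x)" .
    from grad_frechet(2)[OF this] have gb: "grad (\<lambda>y. \<phi> (t, y)) x \<bullet> b = D (0, b) (t, x)" for b .
    show ?thesis
      using euclidean_representation[of "grad (\<lambda>y. \<phi> (t, y)) x", symmetric] by (simp only: gb)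
  qed
  have bd: "\<exists>C\<ge>0. \<forall>z. \<bar>D h z\<bar> \<le> C" for h
    using bounded_of_support[OF Dc D0] by simp
  obtain C1 where C1: "0 \<le> C1" "\<And>z. \<bar>D (1, 0) z\<bar> \<le> C1" using bd by blast
  have "\<forall>b. \<exists>C. 0 \<le> C \<and> (\<forall>z. \<bar>D (0, b) z\<bar> \<le> C)" using bd by blast
  from choice[OF this] obtain C2 where C2: "\<And>b. 0 \<le> C2 b" "\<And>b z. \<bar>D (0, b) z\<bar> \<le> C2 b" by blast
  obtain C3 where C3: "0 \<le> C3" "\<And>z. \<bar>\<phi> z\<bar> \<le> C3"
    using bounded_of_support[OF \<phi>c, of \<rho>] \<rho>(2) by auto
  define C where "C = C1 + (\<Sum>b\<in>Basis. C2 b) + C3"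
  have S2: "0 \<le> (\<Sum>b\<in>(Basis :: 'b set). C2 b)" by (intro sum_nonneg C2)
  have g: "norm (grad (\<lambda>y. \<phi> (t, y)) x) \<le> (\<Sum>b\<in>Basis. C2 b)" for t x
  proof -
    have "norm (grad (\<lambda>y. \<phi> (t, y)) x) \<le> (\<Sum>b\<in>Basis. norm (D (0, b) (t, x) *\<^sub>R b))"
      unfolding d2 by (rule norm_sum)
    also have "\<dots> \<le> (\<Sum>b\<in>Basis. C2 b)" using C2(2) by (intro sum_mono) simp
    finally show ?thesis .
  qed
  have big: "norm (t, x) \<ge> \<rho>" if "\<rho> \<le> norm x" for t :: real and x :: 'b
    using dist_snd_le[of "(t, x)" 0] that by simp
  have cg: "continuous_on UNIV (grad (\<lambda>y. \<phi> (t, y)))" for t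
    unfolding d2[abs_def] by (intro continuous_intros sl Dc)
  show ?thesis
  proof (rule exI[of _ \<rho>], rule exI[of _ C], intro conjI allI impI)
    show "0 \<le> C" using C1 S2 C3 by (simp add: C_def)
    fix t x
    show "continuous_on UNIV (\<lambda>x. deriv (\<lambda>s. \<phi> (s, x)) t)" unfolding d1 by (intro sl Dc)
    show "continuous_on UNIV (grad (\<lambda>y. \<phi> (t, y)))" by (rule cg)
    show "continuous_on UNIV (\<lambda>x. \<phi> (t, x))" by (intro sl \<phi>c)
    show "\<bar>deriv (\<lambda>s. \<phi> (s, x)) t\<bar> \<le> C" using C1(2)[of "(t, x)"] S2 C3(1) by (simp add: d1 C_def)
    show "norm (grad (\<lambda>y. \<phi> (t, y)) x) \<le> C" using g[of t x] C1(1) C3(1) by (simp add: C_def)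
    show "\<bar>\<phi> (t, x)\<bar> \<le> C" using C3(2)[of "(t, x)"] S2 C1(1) by (simp add: C_def)
    assume "\<rho> \<le> norm x"
    then have b: "norm (t, x) \<ge> \<rho>" by (rule big)
    show "deriv (\<lambda>s. \<phi> (s, x)) t = 0" using D0[OF b] by (simp add: d1)
    show "grad (\<lambda>y. \<phi> (t, y)) x = 0" using D0[OF b] by (simp add: d2)
    show "\<phi> (t, x) = 0" using \<rho>(2)[OF b] by simp
  qed
qed

section \<open>Convergence of the force and of the weak formulation\<close>

context interaction
begin

lemma ham_field_continuous: "subprob \<mu> \<Longrightarrow> continuous_on UNIV (ham_field W \<Phi> \<mu>)"
  by (rule locally_lipschitz_field.continuous[OF ham_field_locally_lipschitz])

text \<open>For fixed \<open>q\<close> each component of the kernel is a function of position alone,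
  supported within radius \<open>R + norm q\<close>: exactly the class covered by tightness in the
  momentum.\<close>

lemma force_tendsto:
  assumes N: "\<And>k. subprob (N k)" and M: "subprob M" and conv: "vague_conv N M"
    and tight: "momentum_tight (insert M (range N))"
  shows "(\<lambda>k. force W (N k) q) \<longlonglongrightarrow> force W M q"
  unfolding tendsto_componentwise_iff[of "\<lambda>k. force W (N k) q"]
proof
  fix b :: 'a assume b: "b \<in> Basis"
  have eq: "force W Q q \<bullet> b = (\<integral>y. grad W (q - snd y) \<bullet> b \<partial>Q)" if "subprob Q" for Q
    unfolding force_def using gradW_integrable[OF that] by simp
  have "(\<lambda>k. \<integral>y. grad W (q - snd y) \<bullet> b \<partial>N k) \<longlonglongrightarrow> (\<integral>y. grad W (q - snd y) \<bullet> b \<partial>M)"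
  proof (rule momentum_tight_conv[OF N M conv tight, where C=B and \<rho>="R + norm q"])
    show "continuous_on UNIV (\<lambda>y. grad W (q - snd y) \<bullet> b)"
      by (intro continuous_intros continuous_on_compose2[OF grad_continuous[OF W_C2]]) auto
    fix y :: "'a \<times> 'a"
    show "\<bar>grad W (q - snd y) \<bullet> b\<bar> \<le> B"
      using Basis_le_norm[OF b, of "grad W (q - snd y)"] gradW_bound[of "q - snd y"] by linarith
    assume "R + norm q \<le> norm (snd y)"
    then have "R \<le> norm (q - snd y)" using norm_triangle_ineq2[of "snd y" q] by (simp add: norm_minus_commute)
    then show "grad W (q - snd y) \<bullet> b = 0" by (simp add: gradW_zero)
  qed
  then show "(\<lambda>k. force W (N k) q \<bullet> b) \<longlonglongrightarrow> force W M q \<bullet> b"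
    by (simp add: eq N M)
qed

text \<open>All forces share the Lipschitz constant \<open>L\<close>, so pointwise convergence on a
  finite net gives uniform convergence on the ball.\<close>

lemma force_tendsto_uniform:
  assumes N: "\<And>k. subprob (N k)" and M: "subprob M" and conv: "vague_conv N M"
    and tight: "momentum_tight (insert M (range N))" and e: "0 < e"
  shows "\<forall>\<^sub>F k in sequentially. \<forall>q\<in>cball 0 \<rho>. norm (force W (N k) q - force W M q) < e"
proof -
  define \<eta> where "\<eta> = e / (4 * (L + 1))"
  have \<eta>: "0 < \<eta>" "L * \<eta> \<le> e / 4" using e L_nonneg by (auto simp: \<eta>_def field_simps)
  obtain Z where Z: "finite Z" "cball (0::'a) \<rho> \<subseteq> (\<Union>z\<in>Z. ball z \<eta>)"
    using compactE_image[OF compact_cball, of UNIV "\<lambda>z. ball z \<eta>"] \<eta>(1)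
    by (metis UNIV_I UN_I centre_in_ball open_ball subsetI)
  have "\<forall>\<^sub>F k in sequentially. dist (force W (N k) z) (force W M z) < e / 4" for z
    using e by (intro tendstoD[OF force_tendsto[OF N M conv tight]]) auto
  then have "\<forall>\<^sub>F k in sequentially. \<forall>z\<in>Z. dist (force W (N k) z) (force W M z) < e / 4"
    using Z(1) by (intro eventually_ball_finite) auto
  then show ?thesis
  proof eventually_elim
    case (elim k)
    show ?case
    proof
      fix q :: 'a assume "q \<in> cball 0 \<rho>"
      then obtain z where z: "z \<in> Z" "dist z q < \<eta>" using Z(2) by auto
      have "L * dist q z \<le> L * \<eta>" using z(2) L_nonneg by (intro mult_left_mono) (auto simp: dist_commute)
      then have l: "L * dist q z \<le> e / 4" using \<eta>(2) by linarith
      have l': "L * dist z q \<le> e / 4" using l by (simp add: dist_commute)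
      have "dist (force W (N k) q) (force W M q) \<le> dist (force W (N k) q) (force W (N k) z) +
          dist (force W (N k) z) (force W M z) + dist (force W M z) (force W M q)"
        using dist_triangle[of "force W (N k) q" "force W M q" "force W (N k) z"]
          dist_triangle[of "force W (N k) z" "force W M q" "force W M z"] by linarith
      also have "\<dots> < e / 4 + e / 4 + e / 4 + e / 4"
        using lipschitz_onD[OF force_lipschitz[OF N[of k]] UNIV_I UNIV_I, of q z]
          lipschitz_onD[OF force_lipschitz[OF M] UNIV_I UNIV_I, of z q]
          l l' bspec[OF elim z(1)] e by linarith
      finally show "norm (force W (N k) q - force W M q) < e" by (simp add: dist_norm)
    qed
  qed
qed

text \<open>The integrand of the weak formulation, where \<open>a\<close>, \<open>D\<close> and
  \<phi> stand for the time derivative, gradient and value of a slice. The measure in the field is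
  kept apart from the one integrated against, so that each can be replaced by its limit
  separately.\<close>

definition weak_term :: "real \<Rightarrow> ('a \<times> 'a \<Rightarrow> real) \<Rightarrow> ('a \<times> 'a \<Rightarrow> 'a \<times> 'a) \<Rightarrow> ('a \<times> 'a \<Rightarrow> real) \<Rightarrow>
    ('a \<times> 'a) measure \<Rightarrow> 'a \<times> 'a \<Rightarrow> real" where
  "weak_term \<epsilon> a D \<phi> \<mu> x = a x + D x \<bullet> ham_field W \<Phi> \<mu> x - \<epsilon> * norm (ham_field W \<Phi> \<mu> x) * \<phi> x"

lemma weak_term_bound:
  assumes bd: "\<And>x. \<bar>a x\<bar> \<le> C" "\<And>x. norm (D x) \<le> C" "\<And>x. \<bar>\<phi> x\<bar> \<le> C"
    and zero: "\<And>x. \<rho> \<le> norm x \<Longrightarrow> a x = 0 \<and> D x = 0 \<and> \<phi> x = 0"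
    and V: "\<And>\<mu> x. subprob \<mu> \<Longrightarrow> norm x \<le> \<rho> \<Longrightarrow> norm (ham_field W \<Phi> \<mu> x) \<le> V" "0 \<le> V"
    and \<epsilon>: "0 \<le> \<epsilon>" "\<epsilon> \<le> 1" and \<mu>: "subprob \<mu>"
  shows "\<bar>weak_term \<epsilon> a D \<phi> \<mu> x\<bar> \<le> C + C * V + V * C"
proof -
  have C0: "0 \<le> C" using order_trans[OF abs_ge_zero bd(1)] .
  show ?thesis
  proof (cases "\<rho> \<le> norm x")
    case True
    then show ?thesis using zero[OF True] C0 V(2) by (simp add: weak_term_def)
  next
    case False
    then have v: "norm (ham_field W \<Phi> \<mu> x) \<le> V" by (intro V(1)[OF \<mu>]) simp
    have "\<bar>D x \<bullet> ham_field W \<Phi> \<mu> x\<bar> \<le> norm (D x) * norm (ham_field W \<Phi> \<mu> x)"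
      by (rule Cauchy_Schwarz_ineq2)
    also have "\<dots> \<le> C * V" using bd(2) v C0 by (intro mult_mono) auto
    finally have 1: "\<bar>D x \<bullet> ham_field W \<Phi> \<mu> x\<bar> \<le> C * V" .
    have "\<epsilon> * norm (ham_field W \<Phi> \<mu> x) \<le> 1 * V" using \<epsilon> v by (intro mult_mono) auto
    then have "\<bar>\<epsilon> * norm (ham_field W \<Phi> \<mu> x) * \<phi> x\<bar> \<le> V * C"
      unfolding abs_mult using bd(3)[of x] V(2) \<epsilon>(1) by (intro mult_mono) auto
    then show ?thesis using 1 bd(1)[of x] unfolding weak_term_def by linarith
  qed
qed

text \<open>Replacing the field by its limit and \<epsilon> by 0 changes the integrand uniformly
  little, and the masses are at most 1. What remains is a fixed continuous integrand of bounded
  support, for which vague convergence suffices.\<close>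

lemma weak_term_tendsto:
  assumes N: "\<And>k. subprob (N k)" and M: "subprob M" and conv: "vague_conv N M"
    and tight: "momentum_tight (insert M (range N))"
    and \<epsilon>: "\<epsilon> \<longlonglongrightarrow> 0" "\<And>k. 0 \<le> \<epsilon> k" "\<And>k. \<epsilon> k \<le> 1"
    and cont: "continuous_on UNIV a" "continuous_on UNIV D" "continuous_on UNIV \<phi>"
    and bd: "\<And>x. \<bar>a x\<bar> \<le> C" "\<And>x. norm (D x) \<le> C" "\<And>x. \<bar>\<phi> x\<bar> \<le> C"
    and zero: "\<And>x. \<rho> \<le> norm x \<Longrightarrow> a x = 0 \<and> D x = 0 \<and> \<phi> x = 0"
  shows "(\<lambda>k. \<integral>x. weak_term (\<epsilon> k) a D \<phi> (N k) x \<partial>N k) \<longlonglongrightarrow> (\<integral>x. weak_term 0 a D \<phi> M x \<partial>M)"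
proof -
  have C0: "0 \<le> C" using order_trans[OF abs_ge_zero bd(1)] .
  obtain V where V0: "0 \<le> V"
    and V: "\<And>\<mu> x. subprob \<mu> \<Longrightarrow> norm x \<le> \<rho> \<Longrightarrow> norm (ham_field W \<Phi> \<mu> x) \<le> V"
    using ham_field_bound[of \<rho>] by blast
  have wc: "continuous_on UNIV (weak_term e a D \<phi> Q)" if "subprob Q" for e Q
    unfolding weak_term_def[abs_def] by (intro continuous_intros cont ham_field_continuous that)
  have wi: "integrable P (weak_term e a D \<phi> Q)" if "subprob Q" "subprob P" "0 \<le> e" "e \<le> 1" for e P Q
    using weak_term_bound[where a=a and D=D and \<phi>=\<phi>, OF bd zero V V0 that(3,4) that(1)]
    by (intro subprob_integrable[OF that(2) borel_measurable_continuous_onI[OF wc[OF that(1)]]]) auto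
  have main: "(\<lambda>k. \<integral>x. weak_term 0 a D \<phi> M x \<partial>N k) \<longlonglongrightarrow> (\<integral>x. weak_term 0 a D \<phi> M x \<partial>M)"
  proof -
    have "\<forall>x. norm x > \<rho> \<longrightarrow> weak_term 0 a D \<phi> M x = 0" using zero by (simp add: weak_term_def)
    then show ?thesis using conv wc[OF M] unfolding vague_conv_def by blast
  qed
  have "(\<lambda>k. (\<integral>x. weak_term (\<epsilon> k) a D \<phi> (N k) x \<partial>N k) - (\<integral>x. weak_term 0 a D \<phi> M x \<partial>N k)) \<longlonglongrightarrow> 0"
  proof (rule tendstoI)
    fix e :: real assume e: "0 < e"
    define e' where "e' = e / (2 * (C + 1))"
    have e': "0 < e'" "C * e' \<le> e / 2" using e C0 by (auto simp: e'_def field_simps)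
    have "(\<lambda>k. \<epsilon> k * (V * C)) \<longlonglongrightarrow> 0 * (V * C)" by (intro tendsto_intros \<epsilon>)
    then have "\<forall>\<^sub>F k in sequentially. \<epsilon> k * (V * C) < e / 2"
      using e by (intro order_tendstoD) auto
    moreover have "\<forall>\<^sub>F k in sequentially. \<forall>q\<in>cball 0 \<rho>. norm (force W (N k) q - force W M q) < e'"
      by (rule force_tendsto_uniform[OF N M conv tight e'(1)])
    ultimately show "\<forall>\<^sub>F k in sequentially.
        dist ((\<integral>x. weak_term (\<epsilon> k) a D \<phi> (N k) x \<partial>N k) - (\<integral>x. weak_term 0 a D \<phi> M x \<partial>N k)) 0 < e"
    proof eventually_elim
      case (elim k)
      have pt: "\<bar>weak_term (\<epsilon> k) a D \<phi> (N k) x - weak_term 0 a D \<phi> M x\<bar> \<le> C * e' + \<epsilon> k * (V * C)" for x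
      proof (cases "\<rho> \<le> norm x")
        case True
        then show ?thesis
          using zero[OF True] C0 V0 e' \<epsilon>(2)[of k] by (simp add: weak_term_def)
      next
        case False
        then have x: "norm x \<le> \<rho>" by simp
        then have "snd x \<in> cball 0 \<rho>" using norm_components_le(2)[of x] by simp
        then have f: "norm (force W (N k) (snd x) - force W M (snd x)) \<le> e'" using elim by (auto intro: less_imp_le)
        have "ham_field W \<Phi> (N k) x - ham_field W \<Phi> M x = (- (force W (N k) (snd x) - force W M (snd x)), 0)"
          by (simp add: ham_field_eq N M)
        then have "norm (ham_field W \<Phi> (N k) x - ham_field W \<Phi> M x) \<le> e'"
          using f by (simp add: norm_Pair norm_minus_commute)
        then have "norm (D x) * norm (ham_field W \<Phi> (N k) x - ham_field W \<Phi> M x) \<le> C * e'"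
          using bd(2)[of x] C0 by (intro mult_mono) auto
        then have 1: "\<bar>D x \<bullet> (ham_field W \<Phi> (N k) x - ham_field W \<Phi> M x)\<bar> \<le> C * e'"
          using Cauchy_Schwarz_ineq2[of "D x" "ham_field W \<Phi> (N k) x - ham_field W \<Phi> M x"] by linarith
        have "norm (ham_field W \<Phi> (N k) x) * \<bar>\<phi> x\<bar> \<le> V * C"
          using V[OF N x] bd(3)[of x] V0 by (intro mult_mono) auto
        then have 2: "\<bar>\<epsilon> k * norm (ham_field W \<Phi> (N k) x) * \<phi> x\<bar> \<le> \<epsilon> k * (V * C)"
          using \<epsilon>(2)[of k] by (simp add: abs_mult mult.assoc mult_left_mono)
        have "weak_term (\<epsilon> k) a D \<phi> (N k) x - weak_term 0 a D \<phi> M x =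
            D x \<bullet> (ham_field W \<Phi> (N k) x - ham_field W \<Phi> M x) - \<epsilon> k * norm (ham_field W \<Phi> (N k) x) * \<phi> x"
          by (simp add: weak_term_def inner_diff_right)
        then show ?thesis using 1 2 by linarith
      qed
      have "(\<integral>x. weak_term (\<epsilon> k) a D \<phi> (N k) x \<partial>N k) - (\<integral>x. weak_term 0 a D \<phi> M x \<partial>N k) =
          (\<integral>x. weak_term (\<epsilon> k) a D \<phi> (N k) x - weak_term 0 a D \<phi> M x \<partial>N k)"
        using wi[OF N N \<epsilon>(2,3)] wi[OF M N] by simp
      also have "norm \<dots> \<le> C * e' + \<epsilon> k * (V * C)"
        by (rule subprob_integral_bound[OF N]) (use pt in simp)
      also have "\<dots> < e" using elim(1) e'(2) by linarith
      finally show ?case by simp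
    qed
  qed
  from tendsto_add[OF this main] show ?thesis by simp
qed

end

section \<open>A subsequence that converges at all times\<close>

lemma diagonal_vague:
  fixes N :: "nat \<Rightarrow> nat \<Rightarrow> 'b::euclidean_space measure"
  assumes N: "\<And>i k. subprob (N i k)"
  obtains d where "strict_mono (d :: nat \<Rightarrow> nat)" "\<And>i. \<exists>M. subprob M \<and> vague_conv (\<lambda>k. N i (d k)) M"
proof -
  define Q where "Q i r \<longleftrightarrow> (\<exists>M. subprob M \<and> vague_conv (\<lambda>k. N i (r k)) M)" for i and r :: "nat \<Rightarrow> nat"
  interpret subseqs Q
  proof
    fix i and s :: "nat \<Rightarrow> nat" assume "strict_mono s"
    obtain r M where "strict_mono (r :: nat \<Rightarrow> nat)" "subprob M" "vague_conv ((\<lambda>k. N i (s k)) \<circ> r) M"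
      by (rule vague_compactness[of "\<lambda>k. N i (s k)", OF N])
    then show "\<exists>r'. strict_mono r' \<and> Q i (s \<circ> r')"
      unfolding Q_def o_def by blast
  qed
  have "\<exists>M. subprob M \<and> vague_conv (\<lambda>k. N i (diagseq k)) M" for i
  proof -
    have "Q i (diagseq \<circ> ((+) (Suc i)))"
    proof (rule diagseq_holds)
      fix r s :: "nat \<Rightarrow> nat" and n assume r: "strict_mono r" and "Q n s"
      then obtain M where M: "subprob M" "vague_conv (\<lambda>k. N n (s k)) M" by (auto simp: Q_def)
      have "vague_conv (\<lambda>k. N n (s (r k))) M"
        unfolding vague_conv_def
      proof (intro allI impI)
        fix \<phi> :: "'b \<Rightarrow> real" and R assume "continuous_on UNIV \<phi>" "\<forall>x. R < norm x \<longrightarrow> \<phi> x = 0"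
        then have "(\<lambda>k. \<integral>x. \<phi> x \<partial>N n (s k)) \<longlonglongrightarrow> (\<integral>x. \<phi> x \<partial>M)"
          using M(2) unfolding vague_conv_def by blast
        from LIMSEQ_subseq_LIMSEQ[OF this r] show "(\<lambda>k. \<integral>x. \<phi> x \<partial>N n (s (r k))) \<longlonglongrightarrow> (\<integral>x. \<phi> x \<partial>M)"
          by (simp add: o_def)
      qed
      then show "Q n (s \<circ> r)" using M(1) by (auto simp: Q_def o_def)
    qed
    then obtain M where M: "subprob M" "vague_conv (\<lambda>k. N i (diagseq (Suc i + k))) M"
      by (auto simp: Q_def)
    have "vague_conv (\<lambda>k. N i (diagseq k)) M"
      unfolding vague_conv_def
    proof (intro allI impI)
      fix \<phi> :: "'b \<Rightarrow> real" and R assume "continuous_on UNIV \<phi>" "\<forall>x. R < norm x \<longrightarrow> \<phi> x = 0"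
      then have "(\<lambda>k. \<integral>x. \<phi> x \<partial>N i (diagseq (Suc i + k))) \<longlonglongrightarrow> (\<integral>x. \<phi> x \<partial>M)"
        using M(2) unfolding vague_conv_def by blast
      \<comment> \<open>The diagonal sequence is a subsequence of the \<open>i\<close>-th extraction
        only beyond index \<open>i\<close>; dropping finitely many terms does not affect the
        limit.\<close>
      then have "(\<lambda>k. \<integral>x. \<phi> x \<partial>N i (diagseq (k + Suc i))) \<longlonglongrightarrow> (\<integral>x. \<phi> x \<partial>M)"
        by (simp only: add.commute)
      then show "(\<lambda>k. \<integral>x. \<phi> x \<partial>N i (diagseq k)) \<longlonglongrightarrow> (\<integral>x. \<phi> x \<partial>M)"
        by (rule LIMSEQ_offset)
    qed
    then show ?thesis using M(1) by blast
  qed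
  then show thesis using subseq_diagseq that by blast
qed

text \<open>Convergence at nearby dense times and the common Lipschitz constant make the integrals
  at \<open>t\<close> Cauchy sequences. That their limits come from one measure is ensured by vague
  compactness at \<open>t\<close>, along a subsequence of which the whole sequence inherits the
  limit.\<close>

lemma equicontinuous_dist_conv:
  fixes N :: "nat \<Rightarrow> real \<Rightarrow> 'b::euclidean_space measure" and \<tau> :: "nat \<Rightarrow> real"
  assumes N: "\<And>k t. t \<in> {0..T} \<Longrightarrow> subprob (N k t)"
    and dense: "\<And>t e. t \<in> {0..T} \<Longrightarrow> 0 < e \<Longrightarrow> \<exists>i. \<tau> i \<in> {0..T} \<and> \<bar>\<tau> i - t\<bar> < e"
    and conv: "\<And>i. \<exists>M. vague_conv (\<lambda>k. N k (\<tau> i)) M"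
    and lip: "\<And>\<phi> :: 'b \<Rightarrow> real. test_function UNIV \<phi> \<Longrightarrow> \<exists>K\<ge>0. \<forall>k. \<forall>t\<in>{0..T}. \<forall>t'\<in>{0..T}.
        \<bar>(\<integral>x. \<phi> x \<partial>N k t) - (\<integral>x. \<phi> x \<partial>N k t')\<bar> \<le> K * \<bar>t - t'\<bar>"
    and t: "t \<in> {0..T}"
  shows "\<exists>M. subprob M \<and> dist_conv (\<lambda>k. N k t) M"
proof -
  obtain r M where r: "strict_mono (r :: nat \<Rightarrow> nat)" and M: "subprob M" "vague_conv ((\<lambda>k. N k t) \<circ> r) M"
    by (rule vague_compactness[of "\<lambda>k. N k t", OF N[OF t]])
  have "dist_conv (\<lambda>k. N k t) M"
    unfolding dist_conv_def
  proof (intro allI impI)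
    fix \<phi> :: "'b \<Rightarrow> real" assume \<phi>: "test_function UNIV \<phi>"
    then have "compact_support_in UNIV \<phi>" by (simp add: test_function_def)
    from compact_support_bound[OF this] obtain R where R: "\<forall>x. norm x > R \<longrightarrow> \<phi> x = 0"
      by (meson less_imp_le)
    note \<phi>c = test_function_continuous[OF \<phi>]
    define a where "a k s = (\<integral>x. \<phi> x \<partial>N k s)" for k s
    obtain K where K: "0 \<le> K" "\<And>k t t'. t \<in> {0..T} \<Longrightarrow> t' \<in> {0..T} \<Longrightarrow> \<bar>a k t - a k t'\<bar> \<le> K * \<bar>t - t'\<bar>"
      using lip[OF \<phi>] unfolding a_def by blast
    have "Cauchy (\<lambda>k. a k t)"
    proof (rule metric_CauchyI)
      fix e :: real assume e: "0 < e"
      obtain i where i: "\<tau> i \<in> {0..T}" "\<bar>\<tau> i - t\<bar> < e / (4 * (K + 1))"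
        using dense[OF t, of "e / (4 * (K + 1))"] e K(1) by auto
      have "K * \<bar>\<tau> i - t\<bar> \<le> (K + 1) * (e / (4 * (K + 1)))"
        using i(2) K(1) by (intro mult_mono) auto
      also have "\<dots> = e / 4" using K(1) by (simp add: field_simps)
      finally have close: "\<bar>a k (\<tau> i) - a k t\<bar> \<le> e / 4" for k
        using K(2)[OF i(1) t, of k] by linarith
      obtain Mi where "vague_conv (\<lambda>k. N k (\<tau> i)) Mi" using conv by blast
      then have "(\<lambda>k. a k (\<tau> i)) \<longlonglongrightarrow> (\<integral>x. \<phi> x \<partial>Mi)"
        using \<phi>c R unfolding vague_conv_def a_def by blast
      then have "Cauchy (\<lambda>k. a k (\<tau> i))" by (rule LIMSEQ_imp_Cauchy)
      then obtain n where n: "\<And>j k. j \<ge> n \<Longrightarrow> k \<ge> n \<Longrightarrow> dist (a j (\<tau> i)) (a k (\<tau> i)) < e / 4"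
        using e metric_CauchyD[of "\<lambda>k. a k (\<tau> i)" "e / 4"] by auto
      have "dist (a j t) (a k t) < e" if "j \<ge> n" "k \<ge> n" for j k
        using n[OF that] close[of j] close[of k] e unfolding dist_real_def by linarith
      then show "\<exists>n. \<forall>j\<ge>n. \<forall>k\<ge>n. dist (a j t) (a k t) < e" by blast
    qed
    then obtain l where l: "(\<lambda>k. a k t) \<longlonglongrightarrow> l" using Cauchy_convergent convergent_def by blast
    have "(\<lambda>k. a (r k) t) \<longlonglongrightarrow> l" using LIMSEQ_subseq_LIMSEQ[OF l r] by (simp add: o_def)
    moreover have "(\<lambda>k. a (r k) t) \<longlonglongrightarrow> (\<integral>x. \<phi> x \<partial>M)"
      using M(2)[unfolded vague_conv_def, rule_format, OF \<phi>c R[rule_format]] by (simp add: a_def)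
    ultimately have "l = (\<integral>x. \<phi> x \<partial>M)" by (rule LIMSEQ_unique)
    then show "(\<lambda>k. \<integral>x. \<phi> x \<partial>N k t) \<longlonglongrightarrow> (\<integral>x. \<phi> x \<partial>M)" using l by (simp add: a_def)
  qed
  then show ?thesis using M(1) by blast
qed

text \<open>Clipping places every term in [0, T], where the measures are known to be
  sub-probabilities. It never increases the distance to a point of the interval, so density
  persists.\<close>

lemma clipped_rationals_dense:
  fixes T :: real
  assumes T: "0 < T"
  defines "\<tau> \<equiv> \<lambda>i. max 0 (min T (of_rat (nat_to_rat_surj i)))"
  shows "\<tau> i \<in> {0..T}" and "t \<in> {0..T} \<Longrightarrow> 0 < e \<Longrightarrow> \<exists>i. \<tau> i \<in> {0..T} \<and> \<bar>\<tau> i - t\<bar> < e"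
proof -
  show 1: "\<tau> i \<in> {0..T}" for i using T by (auto simp: \<tau>_def)
  assume t: "t \<in> {0..T}" and e: "0 < e"
  obtain q where q: "t < of_rat q" "of_rat q < t + e" using of_rat_dense[of t "t + e"] e by auto
  obtain i where "q = nat_to_rat_surj i" using surj_nat_to_rat_surj by (metis surjD)
  then have "\<bar>\<tau> i - t\<bar> < e" using q t by (auto simp: \<tau>_def)
  then show "\<exists>i. \<tau> i \<in> {0..T} \<and> \<bar>\<tau> i - t\<bar> < e" using 1 by blast
qed

section \<open>The limit equation\<close>

context interaction
begin

text \<open>The inner integrals converge at every time and are bounded uniformly in
  \<open>k\<close>; dominated convergence on (0, T) yields measurability, integrability and the
  vanishing integral of the limit.\<close>

lemma hamiltonian_ode_limit:
  assumes N: "\<And>k t. t \<in> {0..T} \<Longrightarrow> subprob (N k t)" and M: "\<And>t. t \<in> {0..T} \<Longrightarrow> subprob (M t)"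
    and conv: "\<And>t. t \<in> {0..T} \<Longrightarrow> vague_conv (\<lambda>k. N k t) (M t)"
    and tight: "\<And>t. t \<in> {0..T} \<Longrightarrow> momentum_tight (range (\<lambda>k. N k t))"
    and \<epsilon>: "\<epsilon> \<longlonglongrightarrow> 0" "\<And>k. 0 \<le> \<epsilon> k" "\<And>k. \<epsilon> k \<le> 1"
    and ode: "\<And>k. deficient_ode W \<Phi> T (\<epsilon> k) (N k)"
  shows "hamiltonian_ode W \<Phi> T M"
  unfolding hamiltonian_ode_def solves_transport_def Let_def
proof (intro allI impI)
  fix \<phi> :: "real \<times> 'a \<times> 'a \<Rightarrow> real" assume \<phi>: "test_function ({0<..<T} \<times> UNIV) \<phi>"
  define a where "a t x = deriv (\<lambda>s. \<phi> (s, x)) t" for t x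
  define D where "D t = grad (\<lambda>y. \<phi> (t, y))" for t
  define p where "p t x = \<phi> (t, x)" for t x
  define F where "F t = (\<integral>x. weak_term 0 (a t) (D t) (p t) (M t) x \<partial>M t)" for t
  define G where "G k t = (\<integral>x. weak_term (\<epsilon> k) (a t) (D t) (p t) (N k t) x \<partial>N k t)" for k t
  obtain \<rho> C where C0: "0 \<le> C" and reg: "\<And>t. continuous_on UNIV (a t)" "\<And>t. continuous_on UNIV (D t)"
      "\<And>t. continuous_on UNIV (p t)"
    and bd: "\<And>t x. \<bar>a t x\<bar> \<le> C" "\<And>t x. norm (D t x) \<le> C" "\<And>t x. \<bar>p t x\<bar> \<le> C"
    and zero: "\<And>t x. \<rho> \<le> norm x \<Longrightarrow> a t x = 0 \<and> D t x = 0 \<and> p t x = 0"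
    using test_function_slices[OF \<phi>] unfolding a_def D_def p_def by blast
  obtain V where V0: "0 \<le> V"
    and V: "\<And>\<mu> x. subprob \<mu> \<Longrightarrow> norm x \<le> \<rho> \<Longrightarrow> norm (ham_field W \<Phi> \<mu> x) \<le> V"
    using ham_field_bound[of \<rho>] by blast
  have G: "set_integrable lborel {0<..<T} (G k)" "(LINT t:{0<..<T}|lborel. G k t) = 0" for k
    using ode[of k, unfolded deficient_ode_def solves_transport_def Let_def, rule_format, OF \<phi>]
    unfolding G_def weak_term_def a_def D_def p_def by simp_all
  have lim: "(\<lambda>k. G k t) \<longlonglongrightarrow> F t" if t: "t \<in> {0<..<T}" for t
  proof -
    have t': "t \<in> {0..T}" using t by auto
    show ?thesis
      unfolding G_def F_def
      by (rule weak_term_tendsto[OF N[OF t'] M[OF t'] conv[OF t']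
            vague_limit_momentum_tight[OF N[OF t'] M[OF t'] conv[OF t'] tight[OF t']]
            \<epsilon> reg bd zero])
  qed
  have Gb: "\<bar>G k t\<bar> \<le> C + C * V + V * C" if t: "t \<in> {0<..<T}" for k t
  proof -
    have sp: "subprob (N k t)" using N t by auto
    have "norm (G k t) \<le> C + C * V + V * C"
      unfolding G_def
    proof (rule subprob_integral_bound[OF sp])
      show "norm (weak_term (\<epsilon> k) (a t) (D t) (p t) (N k t) x) \<le> C + C * V + V * C" for x
        using weak_term_bound[where a="a t" and D="D t" and \<phi>="p t", OF bd zero V V0 \<epsilon>(2,3) sp] by simp
    qed
    then show ?thesis by simp
  qed
  let ?I = "\<lambda>f t. indicator {0<..<T} t *\<^sub>R f t"
  have Gm: "?I (G k) \<in> borel_measurable lborel" for k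
    using G(1)[of k] unfolding set_integrable_def by (rule borel_measurable_integrable)
  have lim': "(\<lambda>k. ?I (G k) t) \<longlonglongrightarrow> ?I F t" for t
    using lim[of t] by (cases "t \<in> {0<..<T}") auto
  have Fm: "?I F \<in> borel_measurable lborel"
    by (rule borel_measurable_LIMSEQ_real[OF lim' Gm])
  have w: "integrable lborel (\<lambda>t. (C + C * V + V * C) * indicator {0<..<T} t :: real)"
    by (intro integrable_mult_right integrable_real_indicator) (cases "0 \<le> T"; simp)+
  have b: "norm (?I (G k) t) \<le> (C + C * V + V * C) * indicator {0<..<T} t" for k t
    using Gb[of t k] by (auto simp: indicator_def)
  have "integrable lborel (?I F)"
    by (rule integrable_dominated_convergence[where s="\<lambda>k. ?I (G k)", OF Fm Gm w]) (use lim' b in auto)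
  moreover have "(\<lambda>k. LINT t|lborel. ?I (G k) t) \<longlonglongrightarrow> (LINT t|lborel. ?I F t)"
    by (rule integral_dominated_convergence[where s="\<lambda>k. ?I (G k)", OF Fm Gm w]) (use lim' b in auto)
  ultimately have "set_integrable lborel {0<..<T} F" "(LINT t:{0<..<T}|lborel. F t) = 0"
    using G(2) by (auto simp: set_integrable_def set_lebesgue_integral_def LIMSEQ_const_iff)
  then show "set_integrable lborel {0<..<T}
          (\<lambda>t. \<integral>x. (deriv (\<lambda>s. \<phi> (s, x)) t + grad (\<lambda>y. \<phi> (t, y)) x \<bullet> ham_field W \<Phi> (M t) x - 0 * \<phi> (t, x)) \<partial>M t) \<and>
        (LINT t:{0<..<T}|lborel.
          \<integral>x. (deriv (\<lambda>s. \<phi> (s, x)) t + grad (\<lambda>y. \<phi> (t, y)) x \<bullet> ham_field W \<Phi> (M t) x - 0 * \<phi> (t, x)) \<partial>M t) = 0"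
    unfolding F_def weak_term_def a_def D_def p_def by simp
qed

text \<open>Convergence of the measures needs only the uniform Lipschitz bounds and compactness;
  tightness in the momentum enters when the nonlinear equation is passed to the limit.\<close>

lemma vanishing_deficiency_limit:
  assumes T: "0 < T" and \<mu>0: "subprob \<mu>\<^sub>0"
    and mue: "\<And>\<epsilon>. 0 < \<epsilon> \<Longrightarrow> constructed_deficient_solution W \<Phi> T \<epsilon> \<mu>\<^sub>0 (\<mu>e \<epsilon>)"
    and tight: "momentum_tight {\<mu>e \<epsilon> t | \<epsilon> t. 0 < \<epsilon> \<and> t \<in> {0..T}}"
  shows "\<exists>(\<epsilon> :: nat \<Rightarrow> real) (\<mu> :: real \<Rightarrow> ('a \<times> 'a) measure).
           (\<forall>k. 0 < \<epsilon> k) \<and> \<epsilon> \<longlonglongrightarrow> 0 \<and> \<mu> 0 = \<mu>\<^sub>0 \<and>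
           (\<forall>t\<in>{0..T}. dist_conv (\<lambda>k. \<mu>e (\<epsilon> k) t) (\<mu> t)) \<and>
           (\<forall>t\<in>{0..T}. finite_borel (\<mu> t) \<and> emeasure (\<mu> t) UNIV \<le> 1) \<and>
           dist_continuous_on {0..T} \<mu> \<and>
           hamiltonian_ode W \<Phi> T \<mu>"
proof -
  define \<tau> :: "nat \<Rightarrow> real" where "\<tau> i = max 0 (min T (of_rat (nat_to_rat_surj i)))" for i
  have \<tau>T: "\<tau> i \<in> {0..T}" for i
    unfolding \<tau>_def by (rule clipped_rationals_dense(1)[OF T])
  have dense: "\<exists>i. \<tau> i \<in> {0..T} \<and> \<bar>\<tau> i - t\<bar> < e" if "t \<in> {0..T}" "0 < e" for t e
    using clipped_rationals_dense(2)[OF T that] unfolding \<tau>_def .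
  have sp: "subprob (\<mu>e \<epsilon> t)" if "0 < \<epsilon>" "t \<in> {0..T}" for \<epsilon> t
    using constructed_subprob[OF mue[OF that(1)] T that(1) \<mu>0 that(2)] .
  obtain d where d: "strict_mono (d :: nat \<Rightarrow> nat)"
    and diag: "\<And>i. \<exists>M. subprob M \<and> vague_conv (\<lambda>k. \<mu>e (1 / real (Suc (d k))) (\<tau> i)) M"
    using diagonal_vague[of "\<lambda>i k. \<mu>e (1 / real (Suc k)) (\<tau> i)"] sp \<tau>T
    by (metis divide_pos_pos of_nat_0_less_iff zero_less_Suc zero_less_one)
  \<comment> \<open>These values never exceed 1, the range in which the Lipschitz constant is
    uniform.\<close>
  define \<epsilon> where "\<epsilon> k = 1 / real (Suc (d k))" for k
  have \<epsilon>: "0 < \<epsilon> k" "\<epsilon> k \<le> 1" for k by (auto simp: \<epsilon>_def)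
  have \<epsilon>0: "\<epsilon> \<longlonglongrightarrow> 0"
    using LIMSEQ_subseq_LIMSEQ[OF LIMSEQ_inverse_real_of_nat d]
    by (simp add: o_def \<epsilon>_def[abs_def] inverse_eq_divide)
  define N where "N k = \<mu>e (\<epsilon> k)" for k
  have N: "subprob (N k t)" if "t \<in> {0..T}" for k t using sp[OF \<epsilon>(1) that] by (simp add: N_def)
  have lip: "\<exists>K\<ge>0. \<forall>k. \<forall>t\<in>{0..T}. \<forall>t'\<in>{0..T}. \<bar>(\<integral>x. \<phi> x \<partial>N k t) - (\<integral>x. \<phi> x \<partial>N k t')\<bar> \<le> K * \<bar>t - t'\<bar>"
    if \<phi>: "test_function UNIV \<phi>" for \<phi> :: "'a \<times> 'a \<Rightarrow> real"
  proof -
    obtain K where "0 \<le> K" and K: "\<And>\<epsilon> \<mu> t t'. 0 < \<epsilon> \<Longrightarrow> \<epsilon> \<le> 1 \<Longrightarrow>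
        constructed_deficient_solution W \<Phi> T \<epsilon> \<mu>\<^sub>0 \<mu> \<Longrightarrow> t \<in> {0..T} \<Longrightarrow> t' \<in> {0..T} \<Longrightarrow>
        \<bar>(\<integral>x. \<phi> x \<partial>\<mu> t) - (\<integral>x. \<phi> x \<partial>\<mu> t')\<bar> \<le> K * \<bar>t - t'\<bar>"
      using constructed_lipschitz[OF T \<mu>0 \<phi>] by blast
    from this(1) show ?thesis
      unfolding N_def by (intro exI[of _ K] conjI allI ballI K[OF \<epsilon> mue[OF \<epsilon>(1)]])
  qed
  have "\<exists>M. subprob M \<and> dist_conv (\<lambda>k. N k t) M" if "t \<in> {0..T}" for t
    by (rule equicontinuous_dist_conv[OF N dense _ lip that])
       (use diag in \<open>auto simp: N_def \<epsilon>_def\<close>)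
  then have "\<forall>t. \<exists>M. t \<in> {0..T} \<longrightarrow> subprob M \<and> dist_conv (\<lambda>k. N k t) M" by blast
  from choice[OF this] obtain M where
    M: "\<And>t. t \<in> {0..T} \<Longrightarrow> subprob (M t)" "\<And>t. t \<in> {0..T} \<Longrightarrow> dist_conv (\<lambda>k. N k t) (M t)"
    by blast
  have conv: "vague_conv (\<lambda>k. N k t) (M t)" if "t \<in> {0..T}" for t
    using dist_conv_vague[OF N[OF that] subprob_finite(5)[OF M(1)[OF that]] M(2)[OF that]] by blast
  have N0: "N k 0 = \<mu>\<^sub>0" for k
    unfolding N_def by (rule constructed_initial[OF mue[OF \<epsilon>(1)] T \<epsilon>(1) \<mu>0])
  have 0: "0 \<in> {0..T}" using T by simp
  have "M 0 = \<mu>\<^sub>0"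
  proof (rule finite_borel_eqI[OF subprob_finite(5)[OF M(1)[OF 0]] subprob_finite(5)[OF \<mu>0]])
    fix \<phi> :: "'a \<times> 'a \<Rightarrow> real" assume "test_function UNIV \<phi>"
    then show "(\<integral>x. \<phi> x \<partial>M 0) = (\<integral>x. \<phi> x \<partial>\<mu>\<^sub>0)"
      using M(2)[OF 0] unfolding dist_conv_def N0 by (simp add: LIMSEQ_const_iff)
  qed
  moreover have "dist_continuous_on {0..T} M"
    unfolding dist_continuous_on_def
  proof (intro allI impI)
    fix \<phi> :: "'a \<times> 'a \<Rightarrow> real" assume \<phi>: "test_function UNIV \<phi>"
    obtain K where K: "0 \<le> K" "\<And>k t t'. t \<in> {0..T} \<Longrightarrow> t' \<in> {0..T} \<Longrightarrow>
        \<bar>(\<integral>x. \<phi> x \<partial>N k t) - (\<integral>x. \<phi> x \<partial>N k t')\<bar> \<le> K * \<bar>t - t'\<bar>"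
      using lip[OF \<phi>] by blast
    have "K-lipschitz_on {0..T} (\<lambda>t. \<integral>x. \<phi> x \<partial>M t)"
    proof (rule lipschitz_onI[OF _ K(1)])
      fix t t' assume t: "t \<in> {0..T}" "t' \<in> {0..T}"
      have "(\<lambda>k. \<bar>(\<integral>x. \<phi> x \<partial>N k t) - (\<integral>x. \<phi> x \<partial>N k t')\<bar>) \<longlonglongrightarrow> \<bar>(\<integral>x. \<phi> x \<partial>M t) - (\<integral>x. \<phi> x \<partial>M t')\<bar>"
        using M(2)[OF t(1)] M(2)[OF t(2)] \<phi> unfolding dist_conv_def by (intro tendsto_intros) auto
      then have "\<bar>(\<integral>x. \<phi> x \<partial>M t) - (\<integral>x. \<phi> x \<partial>M t')\<bar> \<le> K * \<bar>t - t'\<bar>"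
        by (rule LIMSEQ_le_const2) (use K(2)[OF t] in blast)
      then show "dist (\<integral>x. \<phi> x \<partial>M t) (\<integral>x. \<phi> x \<partial>M t') \<le> K * dist t t'" by (simp add: dist_real_def)
    qed
    then show "continuous_on {0..T} (\<lambda>t. \<integral>x. \<phi> x \<partial>M t)" by (rule lipschitz_on_continuous_on)
  qed
  moreover have "hamiltonian_ode W \<Phi> T M"
  proof (rule hamiltonian_ode_limit[OF N M(1) conv _ \<epsilon>0])
    show "momentum_tight (range (\<lambda>k. N k t))" if "t \<in> {0..T}" for t
      by (rule momentum_tight_subset[OF tight]) (use that \<epsilon>(1) in \<open>auto simp: N_def\<close>)
    show "deficient_ode W \<Phi> T (\<epsilon> k) (N k)" for k
      using mue[OF \<epsilon>(1)] unfolding N_def constructed_deficient_solution_def by blast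
  qed (use \<epsilon> in \<open>auto intro: less_imp_le\<close>)
  ultimately show ?thesis
    using \<epsilon>(1) \<epsilon>0 M subprob_finite(5)[OF M(1)]
    by (intro exI[of _ \<epsilon>] exI[of _ M] conjI) (auto simp: N_def subprob_def)
qed

end

section \<open>From the hypotheses to tightness\<close>

text \<open>The gradient vanishes outside a ball, so its norm attains its maximum; the strict
  pointwise bound thereby becomes a strict uniform one.\<close>

lemma compact_support_gradient:
  fixes W :: "'a::euclidean_space \<Rightarrow> real"
  assumes W: "C_k 2 W" "compact_support_in UNIV W" and B: "\<And>q. norm (grad W q) < B"
  shows "\<exists>L R B\<^sub>1. L-lipschitz_on UNIV (grad W) \<and> (\<forall>q. R \<le> norm q \<longrightarrow> grad W q = 0) \<and>
    (\<forall>q. norm (grad W q) \<le> B\<^sub>1) \<and> B\<^sub>1 < B"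
proof -
  obtain R where R: "R > 0" "\<And>q. norm q \<ge> R \<Longrightarrow> grad W q = 0"
    using compact_support_bound[OF W(2)] zero_derivative_grad by metis
  obtain L where "L-lipschitz_on (cball 0 R) (grad W)" using grad_lipschitz[OF W(1)] by blast
  then have L: "L-lipschitz_on UNIV (grad W)" by (rule lipschitz_extend_zero) (rule R)
  have "continuous_on (cball 0 R) (\<lambda>q. norm (grad W q))"
    by (intro continuous_intros continuous_on_subset[OF grad_continuous[OF W(1)]]) auto
  then obtain q0 where q0: "\<forall>q\<in>cball 0 R. norm (grad W q) \<le> norm (grad W q0)"
    using continuous_attains_sup[of "cball 0 R" "\<lambda>q. norm (grad W q)"] R(1) by auto
  have "norm (grad W q) \<le> norm (grad W q0)" for q
    using bspec[OF q0, of q] R(2)[of q] by (cases "R \<le> norm q") auto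
  then show ?thesis using L R(2) B[of q0] by blast
qed

text \<open>A real \<open>SUP\<close> dominates its terms only over a bounded family; boundedness
  comes from continuity of the gradient on the compact sphere.\<close>

lemma radial_derivative_le:
  fixes \<Phi> :: "'a::euclidean_space \<Rightarrow> real"
  assumes "C_k 2 \<Phi>"
  shows "grad \<Phi> q \<bullet> sgn q \<le> max_radial_deriv \<Phi> (norm q)"
  unfolding max_radial_deriv_def
proof (rule cSUP_upper)
  have "bounded (grad \<Phi> ` sphere 0 (norm q))"
    by (intro compact_imp_bounded compact_continuous_image continuous_on_subset[OF grad_continuous[OF assms]]) auto
  then obtain C where C: "\<forall>x\<in>sphere 0 (norm q). norm (grad \<Phi> x) \<le> C" by (auto simp: bounded_iff)
  show "bdd_above ((\<lambda>q. grad \<Phi> q \<bullet> sgn q) ` sphere 0 (norm q))"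
  proof (rule bdd_aboveI2)
    fix x :: 'a assume x: "x \<in> sphere 0 (norm q)"
    have "grad \<Phi> x \<bullet> sgn x \<le> norm (grad \<Phi> x) * norm (sgn x)" by (rule norm_cauchy_schwarz)
    also have "\<dots> \<le> norm (grad \<Phi> x)" by (simp add: norm_sgn)
    finally show "grad \<Phi> x \<bullet> sgn x \<le> C" using bspec[OF C x] by linarith
  qed
qed simp

lemma measure_outside_ball_small:
  fixes \<mu> :: "'b::euclidean_space measure"
  assumes "subprob \<mu>" "0 < \<delta>"
  shows "\<exists>R. measure \<mu> {x. R < norm x} \<le> \<delta>"
proof -
  interpret finite_measure \<mu> using subprob_finite assms by blast
  have "(\<lambda>n. measure \<mu> {x. real n < norm x}) \<longlonglongrightarrow> measure \<mu> (\<Inter>n. {x. real n < norm x})"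
  proof (rule finite_Lim_measure_decseq)
    show "range (\<lambda>n. {x :: 'b. real n < norm x}) \<subseteq> sets \<mu>"
    proof (rule image_subsetI)
      show "{x :: 'b. real n < norm x} \<in> sets \<mu>" for n
        unfolding subprob_finite(2)[OF assms(1)]
        by (intro borel_open open_Collect_less continuous_intros)
    qed
    show "decseq (\<lambda>n. {x :: 'b. real n < norm x})"
      unfolding decseq_def by (auto intro: le_less_trans[OF of_nat_mono])
  qed
  moreover have "(\<Inter>n. {x :: 'b. real n < norm x}) = {}"
    using real_arch_simple by (auto simp: set_eq_iff not_less)
  ultimately have "(\<lambda>n. measure \<mu> {x. real n < norm x}) \<longlonglongrightarrow> 0" by simp
  then have "\<forall>\<^sub>F n in sequentially. measure \<mu> {x. real n < norm x} < \<delta>"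
    using assms(2) by (rule order_tendstoD)
  then obtain n where "measure \<mu> {x. real n < norm x} < \<delta>" by (auto simp: eventually_sequentially)
  then show ?thesis by (intro exI[of _ "real n"]) simp
qed

theorem theorem3p8:
  fixes W \<Phi> :: "'a::euclidean_space \<Rightarrow> real"
    and B B\<^sub>1 b\<^sub>2 T \<alpha>\<^sub>0 :: real
    and \<mu>\<^sub>0 :: "('a \<times> 'a) measure"
    and \<mu>e :: "real \<Rightarrow> real \<Rightarrow> ('a \<times> 'a) measure"
  assumes W_C2: "C_k 2 W" and W_supp: "compact_support_in UNIV W" and W_even: "\<And>q. W (- q) = W q"
    and Phi_C2: "C_k 2 \<Phi>"
    and Phi_growth: "\<And>q. q \<noteq> 0 \<Longrightarrow> \<bar>\<Phi> q\<bar> \<le> B\<^sub>1 * norm q powr b\<^sub>2"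
    and B_pos: "0 < B" and dyn: "dynamical_hypothesis W \<Phi> B"
    and T_pos: "0 < T" and alpha_pos: "0 < \<alpha>\<^sub>0"
    and mu0_borel: "sets \<mu>\<^sub>0 = sets borel" and mu0_mass: "emeasure \<mu>\<^sub>0 UNIV = 1"
    and mu0_exp: "integrable \<mu>\<^sub>0 (\<lambda>x. exp (\<alpha>\<^sub>0 * norm x))"
    and mue: "\<And>\<epsilon>. 0 < \<epsilon> \<Longrightarrow> constructed_deficient_solution W \<Phi> T \<epsilon> \<mu>\<^sub>0 (\<mu>e \<epsilon>)"
  shows "\<exists>(\<epsilon> :: nat \<Rightarrow> real) (\<mu> :: real \<Rightarrow> ('a \<times> 'a) measure).
           (\<forall>k. 0 < \<epsilon> k) \<and> \<epsilon> \<longlonglongrightarrow> 0 \<and> \<mu> 0 = \<mu>\<^sub>0 \<and>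
           (\<forall>t\<in>{0..T}. dist_conv (\<lambda>k. \<mu>e (\<epsilon> k) t) (\<mu> t)) \<and>
           (\<forall>t\<in>{0..T}. finite_borel (\<mu> t) \<and> emeasure (\<mu> t) UNIV \<le> 1) \<and>
           dist_continuous_on {0..T} \<mu> \<and>
           hamiltonian_ode W \<Phi> T \<mu>"
proof -
  have Wb: "\<bar>W q\<bar> \<le> B" and gWb: "norm (grad W q) < B" for q
    using dyn by (auto simp: dynamical_hypothesis_def)
  obtain u :: "real \<Rightarrow> real" and qs :: "nat \<Rightarrow> 'a" where u: "C_k 2 u"
    and ur: "\<And>r. 0 < r \<Longrightarrow> B + max_radial_deriv \<Phi> r \<le> deriv u r"
    and qs: "filterlim (\<lambda>L. norm (qs L)) at_top sequentially"
    and below: "\<And>L q :: 'a. 1 \<le> L \<Longrightarrow> norm (qs L) < norm q \<Longrightarrow> u (norm q) < u (norm (qs L))"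
    using dyn unfolding dynamical_hypothesis_def by blast
  obtain L R B' where LR: "L-lipschitz_on UNIV (grad W)" "\<And>q. R \<le> norm q \<Longrightarrow> grad W q = 0"
    and B': "\<And>q. norm (grad W q) \<le> B'" "B' < B"
    using compact_support_gradient[OF W_C2 W_supp gWb] by blast
  interpret interaction W \<Phi> B L R
    by unfold_locales (use W_C2 Phi_C2 Wb gWb LR in \<open>auto intro: less_imp_le\<close>)
  have \<mu>0: "subprob \<mu>\<^sub>0" using mu0_borel mu0_mass by (simp add: subprob_def)
  have du: "DERIV u r :> deriv u r" for r
  proof -
    \<comment> \<open>On the real line the inner product is multiplication, so \<open>grad u\<close>
      is the ordinary derivative.\<close>
    have "DERIV u r :> grad u r"
      using C_k_2D(1)[OF u, of r] by (simp add: gderiv_deriv)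
    then show ?thesis using DERIV_imp_deriv by metis
  qed
  have tight: "momentum_tight {\<mu>e \<epsilon> t | \<epsilon> t. 0 < \<epsilon> \<and> t \<in> {0..T}}"
    unfolding momentum_tight_def
  proof (intro allI impI)
    fix \<rho> \<delta> :: real assume \<delta>: "0 < \<delta>"
    obtain R0 where R0: "measure \<mu>\<^sub>0 {x. R0 < norm x} \<le> \<delta>"
      using measure_outside_ball_small[OF \<mu>0 \<delta>] by blast
    have "\<forall>\<^sub>F l in sequentially. max 1 (max \<rho> R0) \<le> norm (qs l)"
      using qs unfolding filterlim_at_top by (rule spec)
    then obtain l0 where l0: "\<And>l. l0 \<le> l \<Longrightarrow> max 1 (max \<rho> R0) \<le> norm (qs l)"
      by (auto simp: eventually_sequentially)
    \<comment> \<open>The hypothesis covers indices from 1 on. The radius is made at least 1 to be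
      positive, at least \<rho> to enclose the given positions, and at least \<open>R0\<close> so
      that little initial mass lies outside.\<close>
    define l where "l = max 1 l0"
    define r\<^sub>0 where "r\<^sub>0 = norm (qs l)"
    have l: "1 \<le> l" and r0: "1 \<le> r\<^sub>0" "\<rho> \<le> r\<^sub>0" "R0 \<le> r\<^sub>0"
      using l0[of l] by (auto simp: l_def r\<^sub>0_def)
    interpret barrier W \<Phi> B L R u B' r\<^sub>0
    proof unfold_locales
      show "DERIV u r :> deriv u r" for r by (rule du)
      show "norm (grad W q) \<le> B'" for q by (rule B')
      show "B' < B" by (rule B')
      show "B + grad \<Phi> q \<bullet> sgn q \<le> deriv u (norm q)" if "q \<noteq> 0" for q
        using radial_derivative_le[OF Phi_C2, of q] ur[of "norm q"] that by simp
      show "0 < r\<^sub>0" using r0 by simp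
      show "u r < u r\<^sub>0" if rr: "r\<^sub>0 < r" for r
      proof -
        \<comment> \<open>Every radius is the norm of some vector, so the comparison stated for
          vectors holds for radii.\<close>
        obtain q :: 'a where "norm q = r" using vector_choose_size[of r] rr r0 by auto
        then show ?thesis using below[OF l, of q] rr by (simp add: r\<^sub>0_def)
      qed
    qed
    have "bounded (grad \<Phi> ` cball 0 r\<^sub>0)"
      by (intro compact_imp_bounded compact_continuous_image continuous_on_subset[OF grad_continuous[OF Phi_C2]]) auto
    then obtain C where C: "\<forall>q\<in>cball 0 r\<^sub>0. norm (grad \<Phi> q) \<le> C" by (auto simp: bounded_iff)
    interpret m0: finite_measure \<mu>\<^sub>0 using subprob_finite \<mu>0 by blast
    have init: "measure \<mu>\<^sub>0 {x. r\<^sub>0 < norm (snd x) \<or> r\<^sub>0 < norm (fst x)} \<le> \<delta>"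
    proof -
      have "R0 < norm x" if "r\<^sub>0 < norm (snd x) \<or> r\<^sub>0 < norm (fst x)" for x :: "'a \<times> 'a"
        using that r0(3) norm_components_le[of x] by linarith
      then have "{x :: 'a \<times> 'a. r\<^sub>0 < norm (snd x) \<or> r\<^sub>0 < norm (fst x)} \<subseteq> {x. R0 < norm x}"
        by blast
      moreover have "{x :: 'a \<times> 'a. R0 < norm x} \<in> sets \<mu>\<^sub>0"
        unfolding mu0_borel by (intro borel_open open_Collect_less continuous_intros)
      ultimately have "measure \<mu>\<^sub>0 {x. r\<^sub>0 < norm (snd x) \<or> r\<^sub>0 < norm (fst x)} \<le> measure \<mu>\<^sub>0 {x. R0 < norm x}"
        by (rule m0.finite_measure_mono)
      then show ?thesis using R0 by linarith
    qed
    show "\<exists>P. \<forall>M\<in>{\<mu>e \<epsilon> t | \<epsilon> t. 0 < \<epsilon> \<and> t \<in> {0..T}}. measure M {x. norm (snd x) < \<rho> \<and> P < norm (fst x)} \<le> \<delta>"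
    \<comment> \<open>The sphere radius doubles as the initial bound on the momentum;
      \<open>(B + C) * T\<close> is the most that can be gained inside the ball.\<close>
    proof (intro exI[of _ "r\<^sub>0 + (B + C) * T"] ballI)
      fix M assume "M \<in> {\<mu>e \<epsilon> t | \<epsilon> t. 0 < \<epsilon> \<and> t \<in> {0..T}}"
      then obtain \<epsilon> t where M: "M = \<mu>e \<epsilon> t" and \<epsilon>: "0 < \<epsilon>" and t: "t \<in> {0..T}" by blast
      have sp: "subprob M" unfolding M by (rule constructed_subprob[OF mue[OF \<epsilon>] T_pos \<epsilon> \<mu>0 t])
      interpret M: finite_measure M using subprob_finite sp by blast
      let ?A = "\<lambda>r. {x :: 'a \<times> 'a. norm (snd x) < r \<and> r\<^sub>0 + (B + C) * T < norm (fst x)}"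
      have "?A \<rho> \<subseteq> ?A r\<^sub>0" using r0 by auto
      moreover have "?A r\<^sub>0 \<in> sets M"
        unfolding subprob_finite(2)[OF sp] by (rule borel_open[OF open_momentum])
      ultimately have "measure M (?A \<rho>) \<le> measure M (?A r\<^sub>0)" by (rule M.finite_measure_mono)
      also have "\<dots> \<le> measure \<mu>\<^sub>0 {x. r\<^sub>0 < norm (snd x) \<or> r\<^sub>0 < norm (fst x)}"
        unfolding M by (rule constructed_confined[OF mue[OF \<epsilon>] T_pos \<epsilon> \<mu>0 t]) (use r0 C in auto)
      also have "\<dots> \<le> \<delta>" by (rule init)
      finally show "measure M (?A \<rho>) \<le> \<delta>" .
    qed
  qed
  show ?thesis by (rule vanishing_deficiency_limit[OF T_pos \<mu>0 mue tight])
qed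

end
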